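(* Let $X$ be a compact metric space. Let $\mathcal{T}$ be a backward linear transfer on $\mathcal{P}(X)\times\mathcal{P}(X)$ that is (real-valued and) weak$^*$-continuous on $\mathcal{P}(X)\times\mathcal{P}(X)$, and let $T$ be its backward Kantorovich operator, assumed to map $C(X)$ into $C(X)$. Then there exist a constant $c=c(\mathcal{T})\in\mathbb{R}$ and a backward linear transfer $\mathcal{T}_\infty$ on $\mathcal{P}(X)\times\mathcal{P}(X)$ with corresponding backward Kantorovich operator $T^\infty$ such that: \begin{enumerate} \item For all $\mu,\nu\in\mathcal{P}(X)$, $\mathcal{T}_\infty(\mu,\nu)=(\mathcal{T}+c)\star\mathcal{T}_\infty(\mu,\nu)$ and $\mathcal{T}_\infty(\mu,\nu)=\mathcal{T}_\infty\star\mathcal{T}_\infty(\mu,\nu)$. \item For all $f\in C(X)$, $T^\infty\circ T^\infty f=T^\infty f$. \item $-c(\mathcal{T})=\inf\{\mathcal{T}(\mu,\mu):\mu\in\mathcal{P}(X)\}$, and this infimum is attained by a probability measure $\bar\mu$ in the set $\{\mu\in\mathcal{P}(X):\mathcal{T}_\infty(\mu,\mu)=0\}$ such that $$(\bar\mu,\bar\mu)\in\mathcal{D}:=\{(\mu,\nu)\in\mathcal{P}(X)\times\mathcal{P}(X):\mathcal{T}(\mu,\nu)+\mathcal{T}_\infty(\nu,\mu)=-c\}.$$ \item For every $f\in C(X)$, the function $u=T^\infty f$ satisfies $T^n u-nc=u$ for every $n\in\mathbb{N}$; moreover, every $u\in C(X)$ satisfying $T^nu-nc=u$ for every $n\in\mathbb{N}$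 is of the form $u=T^\infty f$ for some $f\in C(X)$. \end{enumerate}
   Context: $C(X)$, $LSC(X)$ denote the real continuous, respectively lower semicontinuous, functions on the compact space $X$; $\mathcal{M}(X)$ the signed Radon measures; $\mathcal{P}(X)$ the probability measures. Functionals on $\mathcal{P}(X)\times\mathcal{P}(Y)$ are extended by $+\infty$ to $\mathcal{M}(X)\times\mathcal{M}(Y)$. For such a functional $\mathcal{T}$ put $\mathcal{T}_\mu(\nu)=\mathcal{T}(\mu,\nu)$, $\mathcal{T}_\mu^*(g)=\sup\{\int_Y g\,d\nu-\mathcal{T}(\mu,\nu):\nu\in\mathcal{P}(Y)\}$, and $D_1(\mathcal{T})=\{\mu\in\mathcal{P}(X):\exists\nu\in\mathcal{P}(Y),\ \mathcal{T}(\mu,\nu)<+\infty\}$. A backward linear transfer on $\mathcal{P}(X)\times\mathcal{P}(Y)$ is a proper, bounded below, (jointly) convex, weak$^*$ lower semicontinuous functional $\mathcal{T}:\mathcal{P}(X)\times\mathcal{P}(Y)\to\mathbb{R}\cup\{+\infty\}$ for which there is a map $T^-:C(Y)\to LSC(X)$ (its backward Kantorovich operator, written $T$ in the claim) such that $\mathcal{T}_\mu^*(g)=\int_X T^-g\,d\mu$ for all $\mu\in D_1(\mathcal{T})$ and $g\in C(Y)$. (When all Dirac masses are in $D_1(\mathcal{T})$, $T^-g$ is automatically continuous, so Kantorovich operators can be composed.) Inf-convolution: $\mathcal{T}_1\star\mathcal{T}_2(\mu,\nu)=\inf\{\mathcal{T}_1(\mu,\sigma)+\mathcal{T}_2(\sigma,\nu):\sigma\in\mathcal{P}(X)\}$.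 $T^n$ is the $n$-fold composition of $T$. *)

theory Defs
  imports "HOL-Probability.Probability"
begin

text \<open>
  The underlying spaces are compact metric spaces, given as types of class
  \<open>metric_space\<close> whose universe is assumed to be compact wherever that matters.
  On such a space every finite Borel measure is Radon, so no regularity condition is needed.
  A functional on pairs of probability measures is a function on pairs of measures of which
  only the values at probability measures are ever used; its extension by \<open>\<infinity>\<close>
  to all signed measures is left implicit.
\<close>

definition prob_measures :: "'a::metric_space measure set" where
  "prob_measures = {\<mu>. prob_space \<mu> \<and> sets \<mu> = sets borel}"

definition cont_funs :: "('a::metric_space \<Rightarrow> real) set" where
  "cont_funs = {f. continuous_on UNIV f}"

definition lsc_map :: "'a topology \<Rightarrow> ('a \<Rightarrow> 'b::linorder) \<Rightarrow> bool" where
  "lsc_map X f \<longleftrightarrow> (\<forall>a. openin X {x \<in> topspace X. a < f x})"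

definition lsc_funs :: "('a::metric_space \<Rightarrow> real) set" where
  "lsc_funs = {f. lsc_map euclidean f}"

definition weak_star :: "'a::metric_space measure topology" where
  "weak_star = topology_generated_by
     {{\<mu> \<in> prob_measures. (\<integral>x. f x \<partial>\<mu>) \<in> U} | f U. f \<in> cont_funs \<and> open U}"

lemma topspace_weak_star: "topspace weak_star = prob_measures"
proof -
  have "(\<lambda>x. 0) \<in> (cont_funs :: ('a \<Rightarrow> real) set)"
    by (simp add: cont_funs_def)
  then have "\<exists>f U. (prob_measures :: 'a measure set) = {\<mu> \<in> prob_measures. (\<integral>x. f x \<partial>\<mu>) \<in> U} \<and>
      f \<in> cont_funs \<and> open (U :: real set)"
    by (intro exI[of _ "\<lambda>x. 0"] exI[of _ UNIV]) auto
  then show ?thesis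
    unfolding weak_star_def topology_generated_by_topspace by blast
qed

definition mixture :: "real \<Rightarrow> 'a measure \<Rightarrow> 'a measure \<Rightarrow> 'a measure" where
  "mixture t \<mu> \<nu> = measure_of (space \<mu>) (sets \<mu>)
     (\<lambda>A. ennreal t * emeasure \<mu> A + ennreal (1 - t) * emeasure \<nu> A)"

lemma emeasure_mixture:
  assumes "sets \<mu> = sets \<nu>" and A: "A \<in> sets \<mu>"
  shows "emeasure (mixture t \<mu> \<nu>) A = ennreal t * emeasure \<mu> A + ennreal (1 - t) * emeasure \<nu> A"
  unfolding mixture_def
proof (rule emeasure_measure_of_sigma[OF sets.sigma_algebra_axioms _ _ A])
  show "positive (sets \<mu>) (\<lambda>A. ennreal t * emeasure \<mu> A + ennreal (1 - t) * emeasure \<nu> A)"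
    by (simp add: positive_def)
  show "countably_additive (sets \<mu>) (\<lambda>A. ennreal t * emeasure \<mu> A + ennreal (1 - t) * emeasure \<nu> A)"
  proof (rule countably_additiveI)
    fix B :: "nat \<Rightarrow> 'a set"
    assume B: "range B \<subseteq> sets \<mu>" "disjoint_family B" "(\<Union>i. B i) \<in> sets \<mu>"
    then show "(\<Sum>i. ennreal t * emeasure \<mu> (B i) + ennreal (1 - t) * emeasure \<nu> (B i)) =
        ennreal t * emeasure \<mu> (\<Union>i. B i) + ennreal (1 - t) * emeasure \<nu> (\<Union>i. B i)"
      using assms(1) by (simp add: suminf_add[symmetric] suminf_emeasure)
  qed
qed

lemma mixture_in_prob_measures:
  assumes "\<mu> \<in> prob_measures" "\<nu> \<in> prob_measures" "0 \<le> t" "t \<le> 1"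
  shows "mixture t \<mu> \<nu> \<in> prob_measures"
proof -
  interpret M: prob_space \<mu> using assms by (simp add: prob_measures_def)
  interpret N: prob_space \<nu> using assms by (simp add: prob_measures_def)
  have s: "sets \<mu> = sets \<nu>" "space \<nu> = space \<mu>"
    using assms sets_eq_imp_space_eq by (auto simp: prob_measures_def)
  have "emeasure (mixture t \<mu> \<nu>) (space \<mu>) = 1"
    using assms(3,4) M.emeasure_space_1 N.emeasure_space_1 emeasure_mixture[OF s(1) sets.top]
    by (simp add: s flip: ennreal_plus)
  moreover have "sets (mixture t \<mu> \<nu>) = sets \<mu>" "space (mixture t \<mu> \<nu>) = space \<mu>"
    by (simp_all add: mixture_def)
  ultimately show ?thesis
    using assms(1) by (simp add: prob_spaceI prob_measures_def)
qed

definition transfer_domain1 ::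
    "('a::metric_space measure \<Rightarrow> 'b::metric_space measure \<Rightarrow> ereal) \<Rightarrow> 'a measure set" where
  "transfer_domain1 T = {\<mu> \<in> prob_measures. \<exists>\<nu>\<in>prob_measures. T \<mu> \<nu> < \<infinity>}"

definition legendre ::
    "('a::metric_space measure \<Rightarrow> 'b::metric_space measure \<Rightarrow> ereal)
      \<Rightarrow> 'a measure \<Rightarrow> ('b \<Rightarrow> real) \<Rightarrow> ereal" where
  "legendre T \<mu> g = (SUP \<nu>\<in>prob_measures. ereal (\<integral>y. g y \<partial>\<nu>) - T \<mu> \<nu>)"

definition jointly_convex ::
    "('a::metric_space measure \<Rightarrow> 'b::metric_space measure \<Rightarrow> ereal) \<Rightarrow> bool" where
  "jointly_convex T \<longleftrightarrow>
     (\<forall>\<mu>\<^sub>1\<in>prob_measures. \<forall>\<mu>\<^sub>2\<in>prob_measures. \<forall>\<nu>\<^sub>1\<in>prob_measures. \<forall>\<nu>\<^sub>2\<in>prob_measures.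
      \<forall>t. 0 \<le> t \<and> t \<le> 1 \<longrightarrow>
        T (mixture t \<mu>\<^sub>1 \<mu>\<^sub>2) (mixture t \<nu>\<^sub>1 \<nu>\<^sub>2) \<le> ereal t * T \<mu>\<^sub>1 \<nu>\<^sub>1 + ereal (1 - t) * T \<mu>\<^sub>2 \<nu>\<^sub>2)"

text \<open>
  The Bochner integral of a non-integrable function is \<open>0\<close>. In the next definition
  integrability is therefore demanded explicitly; it is part of the meaning of the equation, since
  for a \<open>T\<close> that is bounded below the left-hand side is finite, whereas a lower
  semicontinuous function on a compact space is bounded below and has integral \<open>\<infinity>\<close>
  if it is not integrable.
\<close>

definition backward_kantorovich_operator ::
    "('a::metric_space measure \<Rightarrow> 'b::metric_space measure \<Rightarrow> ereal)
      \<Rightarrow> (('b \<Rightarrow> real) \<Rightarrow> ('a \<Rightarrow> real)) \<Rightarrow> bool" where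
  "backward_kantorovich_operator T K \<longleftrightarrow>
     (\<forall>g\<in>cont_funs. K g \<in> lsc_funs) \<and>
     (\<forall>\<mu>\<in>transfer_domain1 T. \<forall>g\<in>cont_funs.
        integrable \<mu> (K g) \<and> legendre T \<mu> g = ereal (\<integral>x. K g x \<partial>\<mu>))"

definition backward_linear_transfer ::
    "('a::metric_space measure \<Rightarrow> 'b::metric_space measure \<Rightarrow> ereal) \<Rightarrow> bool" where
  "backward_linear_transfer T \<longleftrightarrow>
     (\<exists>\<mu>\<in>prob_measures. \<exists>\<nu>\<in>prob_measures. T \<mu> \<nu> < \<infinity>) \<and>
     (\<exists>m::real. \<forall>\<mu>\<in>prob_measures. \<forall>\<nu>\<in>prob_measures. ereal m \<le> T \<mu> \<nu>) \<and>
     jointly_convex T \<and>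
     lsc_map (prod_topology weak_star weak_star) (\<lambda>(\<mu>, \<nu>). T \<mu> \<nu>) \<and>
     (\<exists>K. backward_kantorovich_operator T K)"

definition inf_convolution ::
    "('a::metric_space measure \<Rightarrow> 'b::metric_space measure \<Rightarrow> ereal)
      \<Rightarrow> ('b measure \<Rightarrow> 'c::metric_space measure \<Rightarrow> ereal)
      \<Rightarrow> 'a measure \<Rightarrow> 'c measure \<Rightarrow> ereal" where
  "inf_convolution T\<^sub>1 T\<^sub>2 \<mu> \<nu> = (INF \<sigma>\<in>prob_measures. T\<^sub>1 \<mu> \<sigma> + T\<^sub>2 \<sigma> \<nu>)"

end

theory Submission
  imports Defs
begin

text \<open>
  Normalise by \<open>c = - min T(\<mu>, \<mu>)\<close>, so that \<open>T \<ge> 0\<close> on the diagonal. A minimax theorem on probability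
  measures gives the duality \<open>T(\<mu>, \<nu>) = sup\<^sub>g (\<integral> g d\<nu> - \<integral> K g d\<mu>)\<close>, and, applied once more to
  \<open>T(\<mu>, \<mu>) \<ge> 0\<close>, functions with \<open>K g \<le> g + \<epsilon>\<close>. As \<open>K\<close> has uniformly bounded oscillation, the iterates
  \<open>K\<^sup>n 0\<close> are bounded above; testing with the minimal measure bounds them below.
  The operator \<open>K\<close> is monotone, convex and commutes with constants, and its range is equicontinuous.
  Hence the limsup of an orbit is a subsolution whose iterates increase to a fixed point of \<open>K\<close>. This
  defines a projection \<open>P\<close> onto the fixed points of \<open>K\<close> that is again monotone, convex and commutes
  with constants. The limiting transfer is the dual functional
  \<open>sup\<^sub>g (\<integral> g d\<nu> - \<integral> P g d\<mu>)\<close>; the minimax theorem turns \<open>K P = P\<close> and \<open>P P = P\<close> into the two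
  inf-convolution identities.
\<close>

subsection \<open>Integrals of continuous functions and mixtures\<close>

text \<open>The obstacle is that an orbit of the normalised operator need not converge: an optimal
  transport cost that favours swapping two points produces orbits of period two. The limsup is
  chosen because, unlike the liminf, it respects convex combinations, which an operator dual to a
  transfer must do; its price is that it yields only a subsolution, whence the second, monotone
  limit. Both limits are pointwise, whereas a nonexpansive operator can be exchanged only with
  uniform ones. The modulus of continuity shared by all \<open>K g\<close> closes this gap. Minimax
  provides no extremal function, hence only approximate subsolutions; their error is therefore
  chosen after the number of iterations. The minimal measure \<mu> enters through
  \<open>\<integral> g d\<mu> \<le> \<integral> K g d\<mu>\<close>, which makes integrals grow along
  orbits and so prevents them from drifting to minus infinity. All compactness is used along
  sequences, so the minimax argument goes through a countable dense set of test functions, and weak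
  limits come from a Borel coding of the space by the line.\<close>

definition weakly_converges :: "(nat \<Rightarrow> 'a::metric_space measure) \<Rightarrow> 'a measure \<Rightarrow> bool" where
  "weakly_converges s \<mu> \<longleftrightarrow> (\<forall>f\<in>cont_funs. (\<lambda>n. \<integral>x. f x \<partial>s n) \<longlonglongrightarrow> (\<integral>x. f x \<partial>\<mu>))"

lemma cont_funs_const [simp]: "(\<lambda>x. c) \<in> cont_funs"
  and cont_funs_add: "f \<in> cont_funs \<Longrightarrow> g \<in> cont_funs \<Longrightarrow> (\<lambda>x. f x + g x) \<in> cont_funs"
  and cont_funs_diff: "f \<in> cont_funs \<Longrightarrow> g \<in> cont_funs \<Longrightarrow> (\<lambda>x. f x - g x) \<in> cont_funs"
  and cont_funs_mult: "f \<in> cont_funs \<Longrightarrow> g \<in> cont_funs \<Longrightarrow> (\<lambda>x. f x * g x) \<in> cont_funs"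
  by (auto simp: cont_funs_def intro!: continuous_intros)

lemma cont_funs_affine:
  "f \<in> cont_funs \<Longrightarrow> g \<in> cont_funs \<Longrightarrow> (\<lambda>x. t * f x + s * g x) \<in> cont_funs"
  by (auto simp: cont_funs_def intro!: continuous_intros)

lemma prob_measures_prob_space: "\<mu> \<in> prob_measures \<Longrightarrow> prob_space \<mu>"
  by (simp add: prob_measures_def)

lemma sets_prob_measures: "\<mu> \<in> prob_measures \<Longrightarrow> sets \<mu> = sets borel"
  by (simp add: prob_measures_def)

lemma space_prob_measures: "\<mu> \<in> prob_measures \<Longrightarrow> space \<mu> = UNIV"
  by (metis sets_eq_imp_space_eq sets_prob_measures space_borel)

lemma return_in_prob_measures [simp]: "return borel x \<in> prob_measures"
  by (simp add: prob_measures_def prob_space_return)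

lemma cont_funs_measurable:
  assumes "f \<in> cont_funs" "\<mu> \<in> prob_measures"
  shows "f \<in> borel_measurable \<mu>"
proof -
  have "f \<in> borel_measurable borel"
    using assms(1) by (simp add: cont_funs_def borel_measurable_continuous_onI)
  then show ?thesis
    using measurable_cong_sets[OF sets_prob_measures[OF assms(2)] refl] by blast
qed

lemma integral_return_cont [simp]:
  assumes "f \<in> cont_funs" shows "(\<integral>y. f y \<partial>return borel x) = f x"
  using assms by (intro integral_return) (auto simp: cont_funs_def borel_measurable_continuous_onI)

lemma sets_mixture [simp]: "sets (mixture t \<mu> \<nu>) = sets \<mu>"
  and space_mixture [simp]: "space (mixture t \<mu> \<nu>) = space \<mu>"
  by (simp_all add: mixture_def)

lemma nn_integral_mixture:
  fixes \<mu> \<nu> :: "'b measure"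
  assumes s: "sets \<mu> = sets \<nu>" and f: "f \<in> borel_measurable \<mu>"
  shows "(\<integral>\<^sup>+x. f x \<partial>mixture t \<mu> \<nu>) =
    ennreal t * (\<integral>\<^sup>+x. f x \<partial>\<mu>) + ennreal (1 - t) * (\<integral>\<^sup>+x. f x \<partial>\<nu>)"
  using f
proof (induction rule: borel_measurable_induct)
  case (cong f g)
  then show ?case
    using sets_eq_imp_space_eq[OF s]
    by (metis (no_types, lifting) nn_integral_cong space_mixture)
next
  case (set A)
  then show ?case using s by (simp add: emeasure_mixture)
next
  case (mult u c)
  then have "u \<in> borel_measurable \<nu>" "u \<in> borel_measurable (mixture t \<mu> \<nu>)"
    using s by (auto cong: measurable_cong_sets)
  with mult show ?case by (simp add: nn_integral_cmult algebra_simps)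
next
  case (add u v)
  then have "u \<in> borel_measurable \<nu>" "u \<in> borel_measurable (mixture t \<mu> \<nu>)"
      "v \<in> borel_measurable \<nu>" "v \<in> borel_measurable (mixture t \<mu> \<nu>)"
    using s by (auto cong: measurable_cong_sets)
  with add show ?case by (simp add: nn_integral_add algebra_simps)
next
  case (seq U)
  then have m: "\<And>i. U i \<in> borel_measurable \<nu>" "\<And>i. U i \<in> borel_measurable (mixture t \<mu> \<nu>)"
    using s by (auto cong: measurable_cong_sets)
  have inc: "incseq (\<lambda>i. ennreal c * (\<integral>\<^sup>+x. U i x \<partial>M))" for c and M :: "'b measure"
    using seq(3) by (intro incseq_SucI mult_left_mono nn_integral_mono) (auto dest: incseq_SucD le_funD)
  have "(\<integral>\<^sup>+x. (SUP i. U i x) \<partial>mixture t \<mu> \<nu>) = (SUP i. \<integral>\<^sup>+x. U i x \<partial>mixture t \<mu> \<nu>)"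
    using seq m by (intro nn_integral_monotone_convergence_SUP) auto
  also have "\<dots> = (SUP i. ennreal t * (\<integral>\<^sup>+x. U i x \<partial>\<mu>) + ennreal (1 - t) * (\<integral>\<^sup>+x. U i x \<partial>\<nu>))"
    using seq by simp
  also have "\<dots> = (SUP i. ennreal t * (\<integral>\<^sup>+x. U i x \<partial>\<mu>)) + (SUP i. ennreal (1 - t) * (\<integral>\<^sup>+x. U i x \<partial>\<nu>))"
    by (intro ennreal_SUP_add inc)
  also have "\<dots> = ennreal t * (SUP i. \<integral>\<^sup>+x. U i x \<partial>\<mu>) + ennreal (1 - t) * (SUP i. \<integral>\<^sup>+x. U i x \<partial>\<nu>)"
    by (simp add: SUP_mult_left_ennreal)
  also have "\<dots> = ennreal t * (\<integral>\<^sup>+x. (SUP i. U i x) \<partial>\<mu>) + ennreal (1 - t) * (\<integral>\<^sup>+x. (SUP i. U i x) \<partial>\<nu>)"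
    using seq m by (simp add: nn_integral_monotone_convergence_SUP)
  finally show ?case by (simp add: image_comp)
qed

lemma integral_const_prob:
  assumes "\<mu> \<in> prob_measures" shows "(\<integral>x. (c::real) \<partial>\<mu>) = c"
proof -
  interpret prob_space \<mu> using assms by (rule prob_measures_prob_space)
  show ?thesis by (simp add: prob_space)
qed

context
  assumes compact_UNIV: "compact (UNIV :: 'a::metric_space set)"
begin

lemma cont_funs_bounded:
  fixes f :: "'a \<Rightarrow> real"
  assumes "f \<in> cont_funs"
  obtains B where "0 \<le> B" "\<And>x. \<bar>f x\<bar> \<le> B"
proof -
  have "compact (range f)"
    using assms compact_UNIV by (auto simp: cont_funs_def intro: compact_continuous_image)
  then obtain B where "\<forall>y\<in>range f. norm y \<le> B"
    using compact_imp_bounded bounded_iff by metis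
  then show thesis
    using that[of "max B 0"] by (auto simp: le_max_iff_disj)
qed

lemma cont_funs_uniform:
  fixes f :: "'a \<Rightarrow> real"
  assumes "f \<in> cont_funs" "0 < e"
  obtains d where "0 < d" "\<And>x y. dist x y < d \<Longrightarrow> \<bar>f x - f y\<bar> \<le> e"
proof -
  have "uniformly_continuous_on UNIV f"
    using assms compact_UNIV by (auto simp: cont_funs_def intro: compact_uniformly_continuous)
  then obtain d where "d > 0" "\<forall>x y. dist y x < d \<longrightarrow> dist (f y) (f x) < e"
    using assms(2) unfolding uniformly_continuous_on_def by (metis UNIV_I)
  then show thesis
    using that[of d] by (metis dist_real_def less_le)
qed

lemma cont_funs_integrable:
  fixes f :: "'a \<Rightarrow> real"
  assumes "f \<in> cont_funs" "\<mu> \<in> prob_measures"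
  shows "integrable \<mu> f"
proof -
  interpret prob_space \<mu> using assms(2) by (rule prob_measures_prob_space)
  obtain B where "\<And>x. \<bar>f x\<bar> \<le> B" using cont_funs_bounded[OF assms(1)] by blast
  then show ?thesis
    using cont_funs_measurable[OF assms] by (intro integrable_const_bound[of _ B]) auto
qed

lemma integral_affine:
  fixes f g :: "'a \<Rightarrow> real"
  assumes "f \<in> cont_funs" "g \<in> cont_funs" "\<mu> \<in> prob_measures"
  shows "(\<integral>x. s * f x + t * g x \<partial>\<mu>) = s * (\<integral>x. f x \<partial>\<mu>) + t * (\<integral>x. g x \<partial>\<mu>)"
  using assms cont_funs_integrable by simp

lemma integral_diff_cont:
  fixes f g :: "'a \<Rightarrow> real"
  assumes "f \<in> cont_funs" "g \<in> cont_funs" "\<mu> \<in> prob_measures"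
  shows "(\<integral>x. f x - g x \<partial>\<mu>) = (\<integral>x. f x \<partial>\<mu>) - (\<integral>x. g x \<partial>\<mu>)"
  using assms cont_funs_integrable by simp

lemma integral_le_affine:
  fixes f g h :: "'a \<Rightarrow> real"
  assumes "f \<in> cont_funs" "g \<in> cont_funs" "h \<in> cont_funs" "\<mu> \<in> prob_measures"
    and le: "\<And>x. h x \<le> s * f x + t * g x + k"
  shows "(\<integral>x. h x \<partial>\<mu>) \<le> s * (\<integral>x. f x \<partial>\<mu>) + t * (\<integral>x. g x \<partial>\<mu>) + k"
proof -
  interpret prob_space \<mu> using assms(4) by (rule prob_measures_prob_space)
  have i: "integrable \<mu> f" "integrable \<mu> g" "integrable \<mu> h"
    using assms cont_funs_integrable by auto
  have "(\<integral>x. h x \<partial>\<mu>) \<le> (\<integral>x. s * f x + t * g x + k \<partial>\<mu>)"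
    using i le by (intro integral_mono) auto
  also have "\<dots> = s * (\<integral>x. f x \<partial>\<mu>) + t * (\<integral>x. g x \<partial>\<mu>) + k"
    using i by (simp add: prob_space)
  finally show ?thesis .
qed

lemma integral_le_add:
  fixes g h :: "'a \<Rightarrow> real"
  assumes "g \<in> cont_funs" "h \<in> cont_funs" "\<mu> \<in> prob_measures" "\<And>x. h x \<le> g x + k"
  shows "(\<integral>x. h x \<partial>\<mu>) \<le> (\<integral>x. g x \<partial>\<mu>) + k"
  using integral_le_affine[of g g h \<mu> 1 0 k] assms by simp

text \<open>The nonnegative integral is already affine in the measure. Adding the bound
  \<open>B\<close> makes \<open>f\<close> nonnegative and changes every integral by the same
  constant, as all measures involved have mass one.\<close>

lemma integral_mixture:
  fixes f :: "'a \<Rightarrow> real"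
  assumes f: "f \<in> cont_funs" and P: "\<mu> \<in> prob_measures" "\<nu> \<in> prob_measures" and t: "0 \<le> t" "t \<le> 1"
  shows "(\<integral>x. f x \<partial>mixture t \<mu> \<nu>) = t * (\<integral>x. f x \<partial>\<mu>) + (1 - t) * (\<integral>x. f x \<partial>\<nu>)"
proof -
  obtain B where B: "\<And>x. \<bar>f x\<bar> \<le> B" using cont_funs_bounded[OF f] by blast
  define g where "g = (\<lambda>x. f x + B)"
  have g: "g \<in> cont_funs" unfolding g_def by (intro cont_funs_add f cont_funs_const)
  have g0: "0 \<le> g x" for x using B[of x] by (auto simp: g_def abs_le_iff)
  have M: "mixture t \<mu> \<nu> \<in> prob_measures" using P t by (rule mixture_in_prob_measures)
  have nn: "ennreal (\<integral>x. g x \<partial>\<rho>) = (\<integral>\<^sup>+x. ennreal (g x) \<partial>\<rho>)" if "\<rho> \<in> prob_measures" for \<rho>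
    using cont_funs_integrable[OF g that] g0 by (simp add: nn_integral_eq_integral)
  have i0: "0 \<le> (\<integral>x. g x \<partial>\<rho>)" for \<rho> using g0 by simp
  have "ennreal (\<integral>x. g x \<partial>mixture t \<mu> \<nu>) = ennreal (t * (\<integral>x. g x \<partial>\<mu>) + (1 - t) * (\<integral>x. g x \<partial>\<nu>))"
    using nn_integral_mixture[of \<mu> \<nu> "\<lambda>x. ennreal (g x)" t] cont_funs_measurable[OF g P(1)] P t i0
    by (simp add: nn[OF M] sets_prob_measures nn[OF P(1), symmetric] nn[OF P(2), symmetric]
        ennreal_mult ennreal_plus)
  then have "(\<integral>x. g x \<partial>mixture t \<mu> \<nu>) = t * (\<integral>x. g x \<partial>\<mu>) + (1 - t) * (\<integral>x. g x \<partial>\<nu>)"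
    using i0 t by (subst (asm) ennreal_inj) auto
  moreover have "(\<integral>x. g x \<partial>\<rho>) = (\<integral>x. f x \<partial>\<rho>) + B" if "\<rho> \<in> prob_measures" for \<rho>
    using integral_affine[OF f _ that, of "\<lambda>_. B" 1 1] integral_const_prob[OF that] by (simp add: g_def)
  ultimately show ?thesis using M P by (simp add: algebra_simps)
qed

text \<open>A finite \<open>d\<close>-net reduces the claim to finitely many points. One third of
  \<open>e\<close> each pays for moving the argument of \<open>s n\<close> to the net, moving that
  of \<open>l\<close>, and convergence on the net.\<close>

lemma pointwise_imp_uniform:
  fixes s :: "nat \<Rightarrow> 'a \<Rightarrow> real"
  assumes eq: "\<And>e. 0 < e \<Longrightarrow> \<exists>d>0. \<forall>n x y. dist x y < d \<longrightarrow> \<bar>s n x - s n y\<bar> \<le> e"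
    and lim: "\<And>x. (\<lambda>n. s n x) \<longlonglongrightarrow> l x" and e: "0 < e"
  shows "\<exists>N. \<forall>n\<ge>N. \<forall>x. \<bar>s n x - l x\<bar> \<le> e"
proof -
  obtain d where d: "d > 0" "\<And>n x y. dist x y < d \<Longrightarrow> \<bar>s n x - s n y\<bar> \<le> e/3"
    using eq[of "e/3"] e by auto
  have ld: "\<bar>l x - l y\<bar> \<le> e/3" if "dist x y < d" for x y
  proof (rule LIMSEQ_le_const2)
    show "(\<lambda>n. \<bar>s n x - s n y\<bar>) \<longlonglongrightarrow> \<bar>l x - l y\<bar>" by (intro tendsto_intros lim)
  qed (use d that in auto)
  obtain F :: "'a set" where F: "finite F" "UNIV \<subseteq> (\<Union>x\<in>F. ball x d)"
    using seq_compact_imp_totally_bounded[of UNIV] compact_UNIV d(1)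
    by (metis compact_eq_seq_compact_metric)
  have "\<exists>N. \<forall>n\<ge>N. \<forall>x\<in>F. \<bar>s n x - l x\<bar> < e/3"
  proof -
    have "\<forall>x\<in>F. eventually (\<lambda>n. \<bar>s n x - l x\<bar> < e/3) sequentially"
      using tendstoD[OF lim, of "e/3"] e by (auto simp: dist_real_def)
    then have "eventually (\<lambda>n. \<forall>x\<in>F. \<bar>s n x - l x\<bar> < e/3) sequentially"
      using F(1) by (simp add: eventually_ball_finite)
    then show ?thesis by (simp add: eventually_sequentially)
  qed
  then obtain N where N: "\<And>n x. n \<ge> N \<Longrightarrow> x \<in> F \<Longrightarrow> \<bar>s n x - l x\<bar> < e/3" by blast
  have "\<bar>s n y - l y\<bar> \<le> e" if "n \<ge> N" for n y
  proof -
    have "y \<in> (\<Union>x\<in>F. ball x d)" using F(2) by blast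
    then obtain x where x: "x \<in> F" "dist x y < d" by auto
    have "\<bar>s n x - s n y\<bar> \<le> e/3" "\<bar>l x - l y\<bar> \<le> e/3" "\<bar>s n x - l x\<bar> < e/3"
      using x d(2) ld N that by auto
    then show ?thesis by linarith
  qed
  then show ?thesis by blast
qed

end

subsection \<open>Weak sequential compactness of the probability measures\<close>

text \<open>The membership pattern of \<open>x\<close>, read as a point of the Cantor set. Digits 0
  and 2 in base 3 leave gaps, so that close codes must share their first digits; binary digits would
  fail here, because 0.0111... and 0.1000... agree.\<close>

definition ternary_code :: "(nat \<Rightarrow> 'a set) \<Rightarrow> 'a \<Rightarrow> real" where
  "ternary_code B x = (\<Sum>j. (if x \<in> B j then 2 else 0) / 3 ^ Suc j)"

lemma summable_ternary: "summable (\<lambda>j. 2 / 3 ^ Suc j :: real)"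
  and suminf_ternary: "(\<Sum>j. 2 / 3 ^ Suc j :: real) = 1"
proof -
  have "(\<lambda>j. (2/3) * (1/3) ^ j :: real) sums ((2/3) * (1 / (1 - 1/3)))"
    by (intro sums_mult geometric_sums) auto
  moreover have "(\<lambda>j. (2/3) * (1/3) ^ j :: real) = (\<lambda>j. 2 / 3 ^ Suc j)"
    by (auto simp: power_one_over field_simps)
  ultimately have "(\<lambda>j. 2 / 3 ^ Suc j :: real) sums 1" by simp
  then show "summable (\<lambda>j. 2 / 3 ^ Suc j :: real)" "(\<Sum>j. 2 / 3 ^ Suc j :: real) = 1"
    by (auto simp: sums_iff)
qed

lemma summable_ternary_code: "summable (\<lambda>j. (if x \<in> B j then 2 else 0) / 3 ^ Suc j :: real)"
  by (rule summable_comparison_test'[OF summable_ternary, of 0]) auto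

lemma ternary_code_bounds: "0 \<le> ternary_code B x" "ternary_code B x \<le> 1"
proof -
  show "0 \<le> ternary_code B x"
    unfolding ternary_code_def by (intro suminf_nonneg summable_ternary_code) auto
  have "ternary_code B x \<le> (\<Sum>j. 2 / 3 ^ Suc j :: real)"
    unfolding ternary_code_def
    by (intro suminf_le summable_ternary_code summable_ternary) (auto simp: field_simps)
  then show "ternary_code B x \<le> 1" by (simp only: suminf_ternary)
qed

text \<open>At the first index \<open>i\<close> where the patterns differ, the digit contributes
  \<open>2 / 3 ^ Suc i\<close>, and all later digits together can cancel at most half of
  that.\<close>

lemma ternary_code_close:
  assumes "\<bar>ternary_code B x - ternary_code B y\<bar> < 1 / 3 ^ k" "j < k"
  shows "x \<in> B j \<longleftrightarrow> y \<in> B j"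
proof (rule ccontr)
  assume "\<not> (x \<in> B j \<longleftrightarrow> y \<in> B j)"
  define i where "i = (LEAST j. \<not> (x \<in> B j \<longleftrightarrow> y \<in> B j))"
  have i: "\<not> (x \<in> B i \<longleftrightarrow> y \<in> B i)" and "i \<le> j"
    using \<open>\<not> (x \<in> B j \<longleftrightarrow> y \<in> B j)\<close> unfolding i_def by (rule LeastI, rule Least_le)
  have below: "x \<in> B l \<longleftrightarrow> y \<in> B l" if "l < i" for l
    using not_less_Least that unfolding i_def by blast
  define d :: "nat \<Rightarrow> real" where
    "d l = (if x \<in> B l then 2 else 0) / 3 ^ Suc l - (if y \<in> B l then 2 else 0) / 3 ^ Suc l" for l
  have d_le: "\<bar>d l\<bar> \<le> 2 / 3 ^ Suc l" for l by (auto simp: d_def)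
  have sd: "summable d"
    unfolding d_def by (intro summable_diff summable_ternary_code)
  have "ternary_code B x - ternary_code B y = suminf d"
    unfolding ternary_code_def d_def
    by (intro suminf_diff summable_ternary_code)
  also have "\<dots> = (\<Sum>l. d (l + Suc i)) + (\<Sum>l<Suc i. d l)"
    by (rule suminf_split_initial_segment[OF sd])
  also have "(\<Sum>l<Suc i. d l) = d i" using below by (simp add: d_def)
  finally have eq: "ternary_code B x - ternary_code B y = (\<Sum>l. d (l + Suc i)) + d i" .
  have tail: "summable (\<lambda>l. (2 / 3 ^ Suc l) / 3 ^ Suc i :: real)"
    by (intro summable_divide summable_ternary)
  have "\<bar>\<Sum>l. d (l + Suc i)\<bar> \<le> (\<Sum>l. (2 / 3 ^ Suc l) / 3 ^ Suc i)"
  proof -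
    have le: "\<bar>d (l + Suc i)\<bar> \<le> (2 / 3 ^ Suc l) / 3 ^ Suc i" for l
      using d_le[of "l + Suc i"] by (simp add: power_add mult_ac)
    have s: "summable (\<lambda>l. \<bar>d (l + Suc i)\<bar>)"
      by (rule summable_comparison_test'[OF tail, of 0]) (use le in auto)
    have "\<bar>\<Sum>l. d (l + Suc i)\<bar> \<le> (\<Sum>l. \<bar>d (l + Suc i)\<bar>)" by (rule summable_rabs[OF s])
    also have "\<dots> \<le> (\<Sum>l. (2 / 3 ^ Suc l) / 3 ^ Suc i)" by (rule suminf_le[OF le s tail])
    finally show ?thesis .
  qed
  also have "\<dots> = 1 / 3 ^ Suc i"
    using suminf_divide[OF summable_ternary, of "3 ^ Suc i"] suminf_ternary by simp
  finally have "\<bar>\<Sum>l. d (l + Suc i)\<bar> \<le> 1 / 3 ^ Suc i" .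
  moreover have "\<bar>d i\<bar> = 2 / 3 ^ Suc i" using i by (auto simp: d_def)
  ultimately have "1 / 3 ^ Suc i \<le> \<bar>ternary_code B x - ternary_code B y\<bar>"
    unfolding eq by linarith
  moreover have "1 / 3 ^ k \<le> (1 / 3 ^ Suc i :: real)"
    using \<open>i \<le> j\<close> \<open>j < k\<close> by (intro divide_left_mono power_increasing) auto
  ultimately show False using assms(1) by linarith
qed

lemma ternary_code_measurable:
  assumes "\<And>j. B j \<in> sets M" "space M = UNIV"
  shows "ternary_code B \<in> borel_measurable M"
proof -
  have "(\<lambda>x. (if x \<in> B j then 2 else 0) / 3 ^ Suc j :: real) \<in> borel_measurable M" for j
    using assms by (intro borel_measurable_divide measurable_If_set borel_measurable_const) auto
  then show ?thesis
    unfolding ternary_code_def[abs_def] by (rule borel_measurable_suminf)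
qed

context
  assumes compact_UNIV: "compact (UNIV :: 'a::metric_space set)"
begin

lemma finite_net:
  assumes "0 < e"
  obtains F :: "'a set" where "finite F" "\<And>y. \<exists>x\<in>F. dist x y < e"
proof -
  obtain F :: "'a set" where F: "finite F" "UNIV \<subseteq> (\<Union>x\<in>F. ball x e)"
    using seq_compact_imp_totally_bounded[of UNIV] compact_UNIV assms
    by (metis compact_eq_seq_compact_metric)
  have "\<exists>x\<in>F. dist x y < e" for y
  proof -
    have "y \<in> (\<Union>x\<in>F. ball x e)" using F(2) by blast
    then show ?thesis by auto
  qed
  then show thesis using that F(1) by blast
qed

lemma convergent_subsequence:
  fixes s :: "nat \<Rightarrow> 'a"
  obtains l r where "strict_mono (r :: nat \<Rightarrow> nat)" "(\<lambda>n. s (r n)) \<longlonglongrightarrow> l"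
proof -
  have "seq_compact (UNIV :: 'a set)" using compact_UNIV by (simp add: compact_eq_seq_compact_metric)
  then show thesis using that unfolding seq_compact_def comp_def by (metis UNIV_I)
qed

text \<open>The sets are the balls of radius \<open>1 / Suc n\<close> around a finite net, for all
  \<open>n\<close> in one enumeration. For a given \<open>e\<close> a single net with
  \<open>1 / Suc n < e / 2\<close> is enough, and being finite its balls occur below some index
  \<open>k\<close>.\<close>

lemma separating_sets:
  obtains B :: "nat \<Rightarrow> 'a set" where "\<And>j. B j \<in> sets borel"
    "\<And>e. 0 < e \<Longrightarrow> \<exists>k. \<forall>x y. (\<forall>j<k. x \<in> B j \<longleftrightarrow> y \<in> B j) \<longrightarrow> dist x y < e"
proof -
  have "\<forall>n::nat. \<exists>F :: 'a set. finite F \<and> (\<forall>y. \<exists>x\<in>F. dist x y < 1 / Suc n)"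
    using finite_net by (metis of_nat_0_less_iff zero_less_Suc zero_less_divide_1_iff)
  then obtain F :: "nat \<Rightarrow> 'a set" where F: "\<And>n. finite (F n)"
      "\<And>n y. \<exists>x\<in>F n. dist x y < 1 / Suc n" by metis
  define \<B> where "\<B> = (\<Union>n. (\<lambda>x. ball x (1 / Suc n)) ` F n)"
  have cB: "countable \<B>" unfolding \<B>_def using F(1) by (auto intro: countable_finite)
  have "\<B> \<noteq> {}" unfolding \<B>_def using F(2) by fastforce
  define B where "B = from_nat_into \<B>"
  show thesis
  proof
    fix j
    have "B j \<in> \<B>" unfolding B_def using \<open>\<B> \<noteq> {}\<close> by (rule from_nat_into)
    then show "B j \<in> sets borel" unfolding \<B>_def by auto
  next
    fix e :: real assume "0 < e"
    obtain n :: nat where n: "1 / Suc n < e / 2" using nat_approx_posE[of "e/2"] \<open>0 < e\<close> by auto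
    have "\<exists>j. ball x (1 / Suc n) = B j" if "x \<in> F n" for x
      using that from_nat_into_surj[OF cB, of "ball x (1 / Suc n)"] unfolding B_def \<B>_def by force
    then obtain J where J: "\<And>x. x \<in> F n \<Longrightarrow> ball x (1 / Suc n) = B (J x)" by metis
    obtain k where k: "\<forall>j\<in>J ` F n. j < k" using finite_nat_set_iff_bounded F(1) by blast
    have "dist x y < e" if "\<forall>j<k. x \<in> B j \<longleftrightarrow> y \<in> B j" for x y
    proof -
      obtain z where z: "z \<in> F n" "dist z x < 1 / Suc n" using F(2) by blast
      then have "x \<in> ball z (1 / Suc n)" by simp
      then have "x \<in> B (J z)" unfolding J[OF z(1)] .
      moreover have "J z < k" using k z(1) by blast
      ultimately have "y \<in> B (J z)" using that by simp
      then have "y \<in> ball z (1 / Suc n)" unfolding J[OF z(1)] .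
      then have "dist z y < 1 / Suc n" by simp
      then show ?thesis using z(2) n dist_triangle3[of x y z] by linarith
    qed
    then show "\<exists>k. \<forall>x y. (\<forall>j<k. x \<in> B j \<longleftrightarrow> y \<in> B j) \<longrightarrow> dist x y < e"
      by (intro exI[of _ k] allI impI)
  qed
qed

text \<open>Coding points by reals transports sequences of measures to the line, where Helly's selection
  theorem applies; the inverse of the code is uniformly continuous, hence extends to the closed set
  that carries the limit measure.\<close>

lemma coding:
  obtains s :: "'a \<Rightarrow> real" and \<phi> :: "real \<Rightarrow> 'a" where
    "s \<in> borel_measurable borel" "\<And>x. 0 \<le> s x" "\<And>x. s x \<le> 1"
    "continuous_on (closure (range s)) \<phi>" "\<And>x. \<phi> (s x) = x"
proof -
  obtain B :: "nat \<Rightarrow> 'a set" where B: "\<And>j. B j \<in> sets borel"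
    and sep: "\<And>e. 0 < e \<Longrightarrow> \<exists>k. \<forall>x y. (\<forall>j<k. x \<in> B j \<longleftrightarrow> y \<in> B j) \<longrightarrow> dist x y < e"
    using separating_sets by blast
  define s where "s = ternary_code B"
  \<comment> \<open>The code \<open>s\<close> is merely Borel, but its inverse is uniformly
    continuous, and only the inverse is extended.\<close>
  have uc: "\<exists>d>0. \<forall>x y. \<bar>s x - s y\<bar> < d \<longrightarrow> dist x y < e" if e: "0 < e" for e
  proof -
    obtain k where k: "\<forall>x y. (\<forall>j<k. x \<in> B j \<longleftrightarrow> y \<in> B j) \<longrightarrow> dist x y < e"
      using sep[OF e] by (rule exE)
    have "dist x y < e" if "\<bar>s x - s y\<bar> < 1 / 3 ^ k" for x y
      using k[rule_format, of x y] ternary_code_close[OF that[unfolded s_def]] by simp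
    then show ?thesis by (intro exI[of _ "1 / 3 ^ k"]) auto
  qed
  \<comment> \<open>A point \<open>y\<close> of the closure is a limit of codes. By compactness
    their preimages converge along a subsequence to some \<open>x\<close>, and \<open>uc\<close>
    forces every point whose code is near \<open>y\<close> to be near this \<open>x\<close>.\<close>
  have ex: "\<exists>x. \<forall>e>0. \<exists>d>0. \<forall>z. \<bar>s z - y\<bar> < d \<longrightarrow> dist z x < e" if "y \<in> closure (range s)" for y
  proof -
    obtain w where w: "\<forall>n. w n \<in> range s" "w \<longlonglongrightarrow> y"
      using \<open>y \<in> closure (range s)\<close> unfolding closure_sequential by (elim exE conjE)
    have "\<forall>n. \<exists>z. w n = s z" using w(1) by blast
    then obtain z where z: "\<And>n. w n = s (z n)" by metis
    obtain r x where r: "strict_mono r" "(\<lambda>n. z (r n)) \<longlonglongrightarrow> x" using convergent_subsequence by blast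
    have "(\<lambda>n. s (z (r n))) \<longlonglongrightarrow> y"
      using LIMSEQ_subseq_LIMSEQ[OF w(2) r(1)] by (simp add: comp_def z)
    have "\<exists>d>0. \<forall>z. \<bar>s z - y\<bar> < d \<longrightarrow> dist z x < e" if "0 < e" for e
    proof -
      obtain d where d: "d > 0" "\<And>x y. \<bar>s x - s y\<bar> < d \<Longrightarrow> dist x y < e / 2"
        using uc[of "e/2"] \<open>0 < e\<close> by auto
      have "dist v x < e" if v: "\<bar>s v - y\<bar> < d / 2" for v
      proof -
        have "eventually (\<lambda>n. dist (s (z (r n))) y < d / 2) sequentially"
          using \<open>(\<lambda>n. s (z (r n))) \<longlonglongrightarrow> y\<close> d(1) by (intro tendstoD) auto
        moreover have "eventually (\<lambda>n. dist (z (r n)) x < e / 2) sequentially"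
          using r(2) \<open>0 < e\<close> by (intro tendstoD) auto
        ultimately have "eventually (\<lambda>n. dist (s (z (r n))) y < d / 2 \<and> dist (z (r n)) x < e / 2) sequentially"
          by (rule eventually_conj)
        then obtain n where n: "dist (s (z (r n))) y < d / 2" "dist (z (r n)) x < e / 2"
          using eventually_happens' trivial_limit_sequentially by blast
        have "\<bar>s v - s (z (r n))\<bar> < d" using n(1) v unfolding dist_real_def by arith
        then show ?thesis using d(2) n(2) dist_triangle_half_l[of v "z (r n)" e x]
          by (metis dist_commute dist_triangle_half_r)
      qed
      then show ?thesis using d(1) by (intro exI[of _ "d/2"]) auto
    qed
    then show ?thesis by blast
  qed
  then obtain \<phi> where \<phi>: "\<And>y e. y \<in> closure (range s) \<Longrightarrow> 0 < e \<Longrightarrow>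
      \<exists>d>0. \<forall>z. \<bar>s z - y\<bar> < d \<longrightarrow> dist z (\<phi> y) < e" by metis
  show thesis
  proof
    show "s \<in> borel_measurable borel"
      unfolding s_def using B by (intro ternary_code_measurable) auto
    show "0 \<le> s x" "s x \<le> 1" for x unfolding s_def by (rule ternary_code_bounds)+
    \<comment> \<open>The point \<open>x\<close> itself has code at distance 0 from
      \<open>s x\<close>, so it is closer to \<open>\<phi> (s x)\<close> than any positive
      bound.\<close>
    show "\<phi> (s x) = x" for x
    proof (rule ccontr)
      assume "\<phi> (s x) \<noteq> x"
      then have "0 < dist x (\<phi> (s x))" by auto
      then obtain d where "d > 0" "\<forall>z. \<bar>s z - s x\<bar> < d \<longrightarrow> dist z (\<phi> (s x)) < dist x (\<phi> (s x))"
        using \<phi>[OF subsetD[OF closure_subset rangeI]] by blast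
      moreover from this have "\<bar>s x - s x\<bar> < d" by simp
      ultimately show False by blast
    qed
    show "continuous_on (closure (range s)) \<phi>"
      unfolding continuous_on_iff
    proof (intro ballI allI impI)
      fix y and e :: real assume y: "y \<in> closure (range s)" and "0 < e"
      obtain d where d: "d > 0" "\<And>z. \<bar>s z - y\<bar> < d \<Longrightarrow> dist z (\<phi> y) < e / 2"
        using \<phi>[OF y, of "e/2"] \<open>0 < e\<close> by auto
      have "dist (\<phi> y') (\<phi> y) < e" if y': "y' \<in> closure (range s)" "dist y' y < d / 2" for y'
      proof -
        obtain d' where d': "d' > 0" "\<And>z. \<bar>s z - y'\<bar> < d' \<Longrightarrow> dist z (\<phi> y') < e / 2"
          using \<phi>[OF y'(1), of "e/2"] \<open>0 < e\<close> by auto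
        obtain z where z: "dist (s z) y' < min d' (d / 2)"
          using y'(1) d(1) d'(1) unfolding closure_approachable
          by (metis half_gt_zero imageE min_less_iff_conj)
        have "\<bar>s z - y'\<bar> < d'" "\<bar>s z - y\<bar> < d"
          using z y'(2) unfolding dist_real_def min_less_iff_conj by arith+
        then have "dist z (\<phi> y') < e / 2" "dist z (\<phi> y) < e / 2"
          using d(2) d'(2) by blast+
        then show ?thesis using dist_triangle3[of "\<phi> y'" "\<phi> y" z] by linarith
      qed
      then show "\<exists>d>0. \<forall>x'\<in>closure (range s). dist x' y < d \<longrightarrow> dist (\<phi> x') (\<phi> y) < e"
        using d(1) by (intro exI[of _ "d/2"]) auto
    qed
  qed
qed

text \<open>The images of the measures under the code have a limit \<open>M\<close> on the line,
  which is carried by the closure of the codes and is pulled back by \<open>\<phi>\<close>. A test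
  function \<open>f\<close> on the space corresponds to \<open>f \<circ> \<phi>\<close>, which is
  continuous only on that closed set and has to be extended before convergence on the line can be
  applied to it.\<close>

theorem prob_measures_seq_compact:
  fixes \<mu> :: "nat \<Rightarrow> 'a measure"
  assumes P: "\<And>n. \<mu> n \<in> prob_measures"
  obtains r \<nu> where "strict_mono (r :: nat \<Rightarrow> nat)" "\<nu> \<in> prob_measures"
    "weakly_converges (\<lambda>n. \<mu> (r n)) \<nu>"
proof -
  obtain s :: "'a \<Rightarrow> real" and \<phi> where s: "s \<in> borel_measurable borel"
    and s01: "\<And>x. 0 \<le> s x" "\<And>x. s x \<le> 1"
    and \<phi>: "continuous_on (closure (range s)) \<phi>" and \<phi>s: "\<And>x. \<phi> (s x) = x"
    using coding by blast
  define C where "C = closure (range s)"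
  have C: "closed C" "C \<noteq> {}" "\<And>x. s x \<in> C"
    using closure_subset[of "range s"] by (auto simp: C_def)
  have sm: "s \<in> measurable (\<mu> n) borel" for n
    using s measurable_cong_sets[OF sets_prob_measures[OF P] refl] by blast
  define m where "m n = distr (\<mu> n) borel s" for n
  have rd: "real_distribution (m n)" for n
  proof -
    interpret prob_space "\<mu> n" using P by (rule prob_measures_prob_space)
    interpret R: prob_space "m n" unfolding m_def by (rule prob_space_distr[OF sm])
    show ?thesis by unfold_locales (auto simp: m_def)
  qed
  \<comment> \<open>All codes lie between 0 and 1, so one half-open interval carries every
    \<open>m n\<close>.\<close>
  have "tight m"
    unfolding tight_def
  proof (intro conjI allI impI)
    fix e :: real assume "0 < e"
    have "measure (m n) {-1<..1} = 1" for n
    proof -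
      interpret prob_space "\<mu> n" using P by (rule prob_measures_prob_space)
      have "s -` {-1<..1} = UNIV" using s01 by (force simp: less_le_trans[of "-1" 0])
      then show ?thesis
        unfolding m_def using sm[of n] prob_space space_prob_measures[OF P[of n]] by (simp add: measure_distr)
    qed
    then show "\<exists>a b. a < b \<and> (\<forall>n. 1 - e < measure (m n) {a<..b})"
      using \<open>0 < e\<close> by (intro exI[of _ "-1"] exI[of _ 1]) auto
  qed (rule rd)
  then obtain r M where r: "strict_mono r" and M: "real_distribution M" and
      wc: "weak_conv_m (m \<circ> id \<circ> r) M"
    using tight_imp_convergent_subsubsequence[of m id] strict_mono_id by auto
  interpret M: real_distribution M by (rule M)
  have conv: "(\<lambda>n. \<integral>x. h (s x) \<partial>\<mu> (r n)) \<longlonglongrightarrow> (\<integral>y. h y \<partial>M)"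
    if h: "continuous_on UNIV h" "\<And>y. norm (h y) \<le> b" for h :: "real \<Rightarrow> real" and b
  proof -
    have hc: "isCont h y" for y using h(1) by (simp add: continuous_on_eq_continuous_at)
    have rd': "\<And>n. real_distribution ((m \<circ> id \<circ> r) n)" using rd by simp
    have "(\<lambda>n. integral\<^sup>L ((m \<circ> id \<circ> r) n) h) \<longlonglongrightarrow> integral\<^sup>L M h"
      by (rule weak_conv_imp_integral_bdd_continuous_conv[OF rd' M wc hc h(2)])
    moreover have "integral\<^sup>L (m n) h = (\<integral>x. h (s x) \<partial>\<mu> n)" for n
      unfolding m_def using h(1) by (intro integral_distr sm borel_measurable_continuous_onI)
    ultimately show ?thesis by (simp add: comp_def)
  qed
  \<comment> \<open>The truncated distance is a bounded continuous test function that vanishes on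
    all codes. Its integral against \<open>M\<close> is therefore 0, which puts \<open>M\<close> on
    the closed set \<open>C\<close>.\<close>
  define dC where "dC y = min 1 (infdist y C)" for y
  have dC: "continuous_on UNIV dC" "\<And>y. norm (dC y) \<le> 1"
    by (auto simp: dC_def infdist_nonneg intro!: continuous_intros)
  have "(\<integral>y. dC y \<partial>M) = 0"
    using conv[OF dC] C(3) by (simp add: dC_def LIMSEQ_const_iff)
  moreover have "integrable M dC"
    using dC(2) borel_measurable_continuous_onI[OF dC(1)]
    by (intro M.integrable_const_bound[of _ 1]) (auto cong: measurable_cong_sets)
  ultimately have "AE y in M. dC y = 0"
    by (subst (asm) integral_nonneg_eq_0_iff_AE) (auto simp: dC_def infdist_nonneg)
  then have AEC: "AE y in M. y \<in> C"
    by eventually_elim (use C in_closed_iff_infdist_zero[OF C(1,2)] in \<open>auto simp: dC_def min_def split: if_splits\<close>)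
  \<comment> \<open>Off the \<open>M\<close>-null complement of \<open>C\<close> any constant value
    will do; it makes the map Borel on the whole line.\<close>
  define \<psi> where "\<psi> y = (if y \<in> C then \<phi> y else \<phi> 0)" for y
  have \<psi>m: "\<psi> \<in> measurable M borel"
  proof -
    have "\<psi> \<in> measurable borel borel"
      unfolding \<psi>_def
    proof (subst measurable_If_restrict_space_iff)
      show "\<phi> \<in> measurable (restrict_space borel {y. y \<in> C}) borel \<and>
          (\<lambda>y. \<phi> 0) \<in> measurable (restrict_space borel {y. y \<notin> C}) borel"
        using borel_measurable_continuous_on_restrict[OF \<phi>] by (simp add: C_def)
    qed (use C(1) in auto)
    then show ?thesis by (simp cong: measurable_cong_sets)
  qed
  define \<nu> where "\<nu> = distr M borel \<psi>"
  have \<nu>: "\<nu> \<in> prob_measures"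
    unfolding prob_measures_def \<nu>_def using M.prob_space_distr[OF \<psi>m] by simp
  have "weakly_converges (\<lambda>n. \<mu> (r n)) \<nu>"
    unfolding weakly_converges_def
  proof
    fix f :: "'a \<Rightarrow> real" assume f: "f \<in> cont_funs"
    obtain b where b: "0 \<le> b" "\<And>x. \<bar>f x\<bar> \<le> b" using cont_funs_bounded[OF compact_UNIV f] by blast
    have "continuous_on C (f \<circ> \<phi>)"
      using f \<phi> unfolding cont_funs_def C_def
      by (intro continuous_on_compose) (auto intro: continuous_on_subset)
    \<comment> \<open>Tietze's theorem keeps the bound \<open>b\<close>, as the convergence
      \<open>conv\<close> is available for bounded functions.\<close>
    then obtain h where h: "continuous_on UNIV h" "\<And>y. y \<in> C \<Longrightarrow> h y = (f \<circ> \<phi>) y" "\<And>y. norm (h y) \<le> b"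
      using Tietze[of C "f \<circ> \<phi>" UNIV b] b C(1) by (auto simp: closed_closedin[symmetric])
    have "(\<integral>y. h y \<partial>M) = (\<integral>y. f (\<psi> y) \<partial>M)"
    proof (rule integral_cong_AE)
      show "h \<in> borel_measurable M"
        using h(1) by (simp add: borel_measurable_continuous_onI cong: measurable_cong_sets)
      have "f \<in> borel_measurable borel" using f by (simp add: cont_funs_def borel_measurable_continuous_onI)
      then show "(\<lambda>y. f (\<psi> y)) \<in> borel_measurable M" using \<psi>m by (rule measurable_compose[rotated])
      show "AE y in M. h y = f (\<psi> y)" using AEC by eventually_elim (simp add: \<psi>_def h(2))
    qed
    also have "\<dots> = (\<integral>x. f x \<partial>\<nu>)"
      unfolding \<nu>_def using f \<psi>m
      by (intro integral_distr[symmetric]) (auto simp: cont_funs_def borel_measurable_continuous_onI)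
    finally show "(\<lambda>n. \<integral>x. f x \<partial>\<mu> (r n)) \<longlonglongrightarrow> (\<integral>x. f x \<partial>\<nu>)"
      using conv[OF h(1,3)] h(2) C(3) \<phi>s by simp
  qed
  then show thesis using that r \<nu> by blast
qed

end

subsection \<open>Minimax\<close>

text \<open>Separation in the plane. The pairs lying strictly above some
  \<open>(f x - a, g x - a)\<close> form a convex set that avoids the origin, so a nonzero linear
  functional is nonnegative on it; its normalised coefficients are \<open>t\<close> and
  \<open>1 - t\<close>. Convexity enters through the existence of a dominating \<open>z\<close>,
  because measures do not form a vector space here.\<close>

lemma two_function_minimax:
  fixes f g :: "'b \<Rightarrow> real"
  assumes cv: "\<And>x y t. x \<in> S \<Longrightarrow> y \<in> S \<Longrightarrow> 0 \<le> t \<Longrightarrow> t \<le> 1 \<Longrightarrow>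
      \<exists>z\<in>S. f z \<le> t * f x + (1 - t) * f y \<and> g z \<le> t * g x + (1 - t) * g y"
    and ge: "\<And>x. x \<in> S \<Longrightarrow> a \<le> f x \<or> a \<le> g x"
  obtains t where "0 \<le> t" "t \<le> 1" "\<And>x. x \<in> S \<Longrightarrow> a \<le> t * f x + (1 - t) * g x"
proof (cases "S = {}")
  case True
  then show thesis using that[of 0] by auto
next
  case False
  then obtain x0 where x0: "x0 \<in> S" by blast
  define A where "A = {p :: real \<times> real. \<exists>x\<in>S. f x - a < fst p \<and> g x - a < snd p}"
  have "convex A"
    unfolding convex_alt
  proof (intro ballI allI impI)
    fix p q :: "real \<times> real" and u :: real
    assume "p \<in> A" "q \<in> A" and u: "0 \<le> u \<and> u \<le> 1"
    then obtain x y where x: "x \<in> S" "f x - a < fst p" "g x - a < snd p"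
      and y: "y \<in> S" "f y - a < fst q" "g y - a < snd q" unfolding A_def by blast
    obtain z where z: "z \<in> S" "f z \<le> (1 - u) * f x + (1 - (1 - u)) * f y"
        "g z \<le> (1 - u) * g x + (1 - (1 - u)) * g y"
      using cv[OF x(1) y(1), of "1 - u"] u by auto
    have conv: "(1 - u) * b + u * d < (1 - u) * b' + u * d'" if "b < b'" "d < d'" for b b' d d' :: real
    proof (cases "u = 0")
      case False
      then show ?thesis using that u
        by (intro add_le_less_mono mult_left_mono mult_strict_left_mono) auto
    qed (use that in simp)
    have "f z - a < (1 - u) * fst p + u * fst q" "g z - a < (1 - u) * snd p + u * snd q"
      using conv[OF x(2) y(2)] conv[OF x(3) y(3)] z(2,3) by (auto simp: algebra_simps)
    then show "(1 - u) *\<^sub>R p + u *\<^sub>R q \<in> A" using z(1) unfolding A_def by auto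
  qed
  moreover have "0 \<notin> A" using ge by (force simp: A_def)
  ultimately have "\<exists>c. c \<noteq> 0 \<and> (\<forall>p\<in>A. 0 \<le> inner c p)"
    by (rule separating_hyperplane_set_0)
  then obtain c where c: "c \<noteq> 0" "\<And>p. p \<in> A \<Longrightarrow> 0 \<le> inner c p" by auto
  define c1 c2 where "c1 = fst c" and "c2 = snd c"
  have pos: "0 \<le> c1 * p + c2 * q" if "x \<in> S" "f x - a < p" "g x - a < q" for x p q
    using c(2)[of "(p, q)"] that unfolding A_def c1_def c2_def by (auto simp: inner_prod_def)
  \<comment> \<open>The set \<open>A\<close> is closed under increasing either coordinate. Moving
    arbitrarily far along one axis rules out a negative coefficient.\<close>
  have nonneg: "0 \<le> b" if "\<And>n::nat. 0 \<le> b * real n + d" for b d :: real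
  proof (rule ccontr)
    assume "\<not> 0 \<le> b"
    obtain n where "d / (- b) < real n" using reals_Archimedean2 by blast
    then have "b * real n + d < 0" using \<open>\<not> 0 \<le> b\<close> by (simp add: field_simps)
    then show False using that[of n] by simp
  qed
  have "0 \<le> c1"
    by (rule nonneg[of _ "c1 * (f x0 - a + 1) + c2 * (g x0 - a + 1)"])
      (use pos[OF x0, of "f x0 - a + 1 + real n" "g x0 - a + 1" for n] in \<open>simp add: algebra_simps\<close>)
  have "0 \<le> c2"
    by (rule nonneg[of _ "c1 * (f x0 - a + 1) + c2 * (g x0 - a + 1)"])
      (use pos[OF x0, of "f x0 - a + 1" "g x0 - a + 1 + real n" for n] in \<open>simp add: algebra_simps\<close>)
  have "c1 + c2 > 0"
    using \<open>0 \<le> c1\<close> \<open>0 \<le> c2\<close> c(1) by (auto simp: c1_def c2_def prod_eq_iff add_nonneg_eq_0_iff less_le)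
  show thesis
  proof (rule that[of "c1 / (c1 + c2)"])
    show "0 \<le> c1 / (c1 + c2)" "c1 / (c1 + c2) \<le> 1" using \<open>0 \<le> c1\<close> \<open>0 \<le> c2\<close> \<open>c1 + c2 > 0\<close> by auto
    fix x assume x: "x \<in> S"
    \<comment> \<open>The boundary point itself is not in \<open>A\<close>, which is defined by
      strict inequalities; it is approached by adding \<open>e'\<close> to both coordinates.\<close>
    have "0 \<le> c1 * (f x - a) + c2 * (g x - a)"
    proof (rule field_le_epsilon)
      fix e :: real assume "0 < e"
      define e' where "e' = e / (c1 + c2)"
      have "e' > 0" "(c1 + c2) * e' = e" using \<open>0 < e\<close> \<open>c1 + c2 > 0\<close> by (auto simp: e'_def)
      have "0 \<le> c1 * (f x - a + e') + c2 * (g x - a + e')"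
        using pos[OF x] \<open>e' > 0\<close> by simp
      also have "\<dots> = c1 * (f x - a) + c2 * (g x - a) + (c1 + c2) * e'" by (simp add: algebra_simps)
      finally show "0 \<le> c1 * (f x - a) + c2 * (g x - a) + e" unfolding \<open>(c1 + c2) * e' = e\<close> .
    qed
    also have "c1 * (f x - a) + c2 * (g x - a) =
        (c1 + c2) * (c1 / (c1 + c2) * (f x - a) + c2 / (c1 + c2) * (g x - a))"
      by (simp only: distrib_left mult.assoc[symmetric] times_divide_eq_right
          nonzero_mult_div_cancel_left[OF less_imp_neq[OF \<open>c1 + c2 > 0\<close>, symmetric]])
    finally have "0 \<le> c1 / (c1 + c2) * (f x - a) + c2 / (c1 + c2) * (g x - a)"
      using \<open>c1 + c2 > 0\<close> by (simp only: zero_le_mult_iff) auto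
    moreover define t where "t = c1 / (c1 + c2)"
    moreover have "c2 / (c1 + c2) = 1 - t" using \<open>c1 + c2 > 0\<close> by (simp add: t_def field_simps)
    ultimately have "0 \<le> t * (f x - a) + (1 - t) * (g x - a)" by simp
    then have "a \<le> t * f x + (1 - t) * g x" by (simp add: algebra_simps)
    then show "a \<le> c1 / (c1 + c2) * f x + (1 - c1 / (c1 + c2)) * g x" by (simp only: t_def)
  qed
qed

context
  assumes compact_UNIV: "compact (UNIV :: 'a::metric_space set)"
begin

text \<open>Averages of rational values, weighted by tent functions on the balls around a finite
  net. Such an average at \<open>x\<close> involves only net points close to \<open>x\<close>, so
  uniform continuity controls the error, and the parameters are countable.\<close>

lemma cont_funs_countable_dense:
  obtains D :: "nat \<Rightarrow> 'a \<Rightarrow> real" where "\<And>n. D n \<in> cont_funs"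
    "\<And>g e. g \<in> cont_funs \<Longrightarrow> 0 < e \<Longrightarrow> \<exists>n. \<forall>x. \<bar>D n x - g x\<bar> \<le> e"
proof -
  have "\<exists>xs :: 'a list. \<forall>y. \<exists>x\<in>set xs. dist x y < 1 / Suc n" for n
  proof -
    obtain F :: "'a set" where "finite F" "\<And>y. \<exists>x\<in>F. dist x y < 1 / Suc n"
      using finite_net[OF compact_UNIV, of "1 / Suc n"] by auto
    then show ?thesis using finite_list by metis
  qed
  then obtain xs :: "nat \<Rightarrow> 'a list" where xs: "\<And>n y. \<exists>x\<in>set (xs n). dist x y < 1 / Suc n"
    by metis
  define w where "w n i x = max 0 (1 / Suc n - dist (xs n ! i) x)" for n i x
  define W where "W n x = (\<Sum>i<length (xs n). w n i x)" for n x
  \<comment> \<open>A list shorter than the net makes \<open>!\<close> return unspecified rationals.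
    The resulting function is still continuous, so no restriction on the parameter is
    imposed.\<close>
  define E where "E p x = (\<Sum>i<length (xs (fst p)). of_rat (snd p ! i) * w (fst p) i x) / W (fst p) x"
    for p :: "nat \<times> rat list" and x
  have w0: "0 \<le> w n i x" for n i x by (simp add: w_def)
  have W0: "0 < W n x" for n x
  proof -
    obtain i where i: "i < length (xs n)" "dist (xs n ! i) x < 1 / Suc n"
      using xs[of n x] by (auto simp: in_set_conv_nth)
    have "0 < w n i x" using i(2) by (simp add: w_def)
    also have "w n i x \<le> W n x" unfolding W_def using i(1) w0 by (intro member_le_sum) auto
    finally show ?thesis .
  qed
  have E_cont: "E p \<in> cont_funs" for p
    unfolding cont_funs_def E_def mem_Collect_eq
    using W0 by (intro continuous_intros) (auto simp: W_def w_def less_le intro!: continuous_intros)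
  have dense: "\<exists>p. \<forall>x. \<bar>E p x - g x\<bar> \<le> e" if g: "g \<in> cont_funs" and "0 < e" for g :: "'a \<Rightarrow> real" and e
  proof -
    obtain d where d: "0 < d" "\<And>x y. dist x y < d \<Longrightarrow> \<bar>g x - g y\<bar> \<le> e/2"
      using cont_funs_uniform[OF compact_UNIV g, of "e/2"] \<open>0 < e\<close> by auto
    obtain n :: nat where n: "1 / Suc n < d" using nat_approx_posE[OF d(1)] by blast
    have "\<exists>q. \<bar>of_rat q - g x\<bar> \<le> e/2" for x
    proof -
      obtain q where "g x < of_rat q" "of_rat q < g x + e/2"
        using of_rat_dense[of "g x" "g x + e/2"] \<open>0 < e\<close> by auto
      then show ?thesis by (intro exI[of _ q]) auto
    qed
    then obtain q where q: "\<And>x. \<bar>of_rat (q x) - g x\<bar> \<le> e/2" by metis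
    have "\<bar>E (n, map q (xs n)) x - g x\<bar> \<le> e" for x
    proof -
      have le: "\<bar>of_rat (q (xs n ! i)) - g x\<bar> * w n i x \<le> e * w n i x" for i
      proof (cases "dist (xs n ! i) x < 1 / Suc n")
        case True
        then have "\<bar>of_rat (q (xs n ! i)) - g x\<bar> \<le> e"
          using q[of "xs n ! i"] d(2)[of "xs n ! i" x] n by linarith
        then show ?thesis by (intro mult_right_mono w0)
      qed (simp add: w_def)
      have "E (n, map q (xs n)) x - g x =
          ((\<Sum>i<length (xs n). of_rat (q (xs n ! i)) * w n i x) - g x * W n x) / W n x"
        using W0[of n x] by (simp add: E_def field_simps)
      also have "\<dots> = (\<Sum>i<length (xs n). (of_rat (q (xs n ! i)) - g x) * w n i x) / W n x"
        by (simp add: W_def sum_distrib_left sum_subtractf algebra_simps)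
      also have "\<bar>\<dots>\<bar> \<le> (\<Sum>i<length (xs n). e * w n i x) / W n x"
      proof -
        have "\<bar>\<Sum>i<length (xs n). (of_rat (q (xs n ! i)) - g x) * w n i x\<bar>
            \<le> (\<Sum>i<length (xs n). \<bar>(of_rat (q (xs n ! i)) - g x) * w n i x\<bar>)" by (rule sum_abs)
        also have "\<dots> \<le> (\<Sum>i<length (xs n). e * w n i x)"
          using le w0 by (intro sum_mono) (simp add: abs_mult)
        finally show ?thesis using W0[of n x] by (simp add: abs_div divide_right_mono)
      qed
      also have "\<dots> = e" using W0[of n x] by (simp add: W_def sum_distrib_left[symmetric])
      finally show ?thesis .
    qed
    then show ?thesis by blast
  qed
  show thesis
  proof (rule that[of "\<lambda>k. E (from_nat k)"])
    fix g :: "'a \<Rightarrow> real" and e :: real assume "g \<in> cont_funs" "0 < e"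
    then obtain p where "\<forall>x. \<bar>E p x - g x\<bar> \<le> e" using dense by blast
    then show "\<exists>n. \<forall>x. \<bar>E (from_nat n) x - g x\<bar> \<le> e" by (intro exI[of _ "to_nat p"]) simp
  qed (rule E_cont)
qed

text \<open>By induction on \<open>G\<close>. The part \<open>S'\<close> of \<open>S\<close> where
  \<open>g0\<close> fails is closed under mixtures, being a sublevel set, and is covered by the
  remaining functions, which yields one \<open>h\<close> that works there. The two functions
  \<open>g0\<close> and \<open>h\<close> then cover \<open>S\<close> and are merged by
  \<open>two_function_minimax\<close>.\<close>

lemma finite_minimax:
  fixes F :: "('a \<Rightarrow> real) \<Rightarrow> 'a measure \<Rightarrow> real"
  assumes cvx: "\<And>g \<sigma> \<tau> t. g \<in> cont_funs \<Longrightarrow> \<sigma> \<in> prob_measures \<Longrightarrow> \<tau> \<in> prob_measures \<Longrightarrow>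
      0 \<le> t \<Longrightarrow> t \<le> 1 \<Longrightarrow> F g (mixture t \<sigma> \<tau>) \<le> t * F g \<sigma> + (1 - t) * F g \<tau>"
    and ccv: "\<And>g h \<sigma> t. g \<in> cont_funs \<Longrightarrow> h \<in> cont_funs \<Longrightarrow> \<sigma> \<in> prob_measures \<Longrightarrow>
      0 \<le> t \<Longrightarrow> t \<le> 1 \<Longrightarrow> t * F g \<sigma> + (1 - t) * F h \<sigma> \<le> F (\<lambda>x. t * g x + (1 - t) * h x) \<sigma>"
    and "finite G" "G \<subseteq> cont_funs" "S \<subseteq> prob_measures"
    and "\<And>\<sigma> \<tau> t. \<sigma> \<in> S \<Longrightarrow> \<tau> \<in> S \<Longrightarrow> 0 \<le> t \<Longrightarrow> t \<le> 1 \<Longrightarrow> mixture t \<sigma> \<tau> \<in> S"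
    and "\<And>\<sigma>. \<sigma> \<in> S \<Longrightarrow> \<exists>g\<in>G. a \<le> F g \<sigma>"
  shows "\<exists>g\<in>cont_funs. \<forall>\<sigma>\<in>S. a \<le> F g \<sigma>"
  using assms(3-)
proof (induction G arbitrary: S rule: finite_induct)
  case empty
  then have "S = {}" by auto
  then show ?case using cont_funs_const by blast
next
  case (insert g0 G)
  have g0: "g0 \<in> cont_funs" using insert.prems by blast
  define S' where "S' = {\<sigma>\<in>S. F g0 \<sigma> < a}"
  have "\<exists>h\<in>cont_funs. \<forall>\<sigma>\<in>S'. a \<le> F h \<sigma>"
  proof (rule insert.IH)
    fix \<sigma> \<tau> and t :: real assume st: "\<sigma> \<in> S'" "\<tau> \<in> S'" "0 \<le> t" "t \<le> 1"
    have "F g0 (mixture t \<sigma> \<tau>) \<le> t * F g0 \<sigma> + (1 - t) * F g0 \<tau>"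
      using st insert.prems(2) g0 by (intro cvx) (auto simp: S'_def)
    also have "\<dots> < a"
    proof (rule convex_bound_lt)
      show "F g0 \<sigma> < a" "F g0 \<tau> < a" using st by (auto simp: S'_def)
    qed (use st in auto)
    finally show "mixture t \<sigma> \<tau> \<in> S'" using st insert.prems(3) by (auto simp: S'_def)
  next
    fix \<sigma> assume "\<sigma> \<in> S'"
    then show "\<exists>g\<in>G. a \<le> F g \<sigma>" using insert.prems(4)[of \<sigma>] by (auto simp: S'_def)
  qed (use insert.prems in \<open>auto simp: S'_def\<close>)
  then obtain h where h: "h \<in> cont_funs" "\<And>\<sigma>. \<sigma> \<in> S' \<Longrightarrow> a \<le> F h \<sigma>" by blast
  obtain t where t: "0 \<le> t" "t \<le> 1" "\<And>\<sigma>. \<sigma> \<in> S \<Longrightarrow> a \<le> t * F g0 \<sigma> + (1 - t) * F h \<sigma>"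
  proof (rule two_function_minimax[of S "F g0" "F h" a])
    fix \<sigma> \<tau> and t :: real assume st: "\<sigma> \<in> S" "\<tau> \<in> S" "0 \<le> t" "t \<le> 1"
    then show "\<exists>z\<in>S. F g0 z \<le> t * F g0 \<sigma> + (1 - t) * F g0 \<tau> \<and> F h z \<le> t * F h \<sigma> + (1 - t) * F h \<tau>"
      using insert.prems(2,3) g0 h(1)
      by (intro bexI[of _ "mixture t \<sigma> \<tau>"] conjI cvx) auto
  next
    fix \<sigma> assume "\<sigma> \<in> S"
    then show "a \<le> F g0 \<sigma> \<or> a \<le> F h \<sigma>" using h(2)[of \<sigma>] by (cases "F g0 \<sigma> < a") (simp_all add: S'_def)
  next
    fix t :: real assume t: "0 \<le> t" "t \<le> 1" and le: "\<And>\<sigma>. \<sigma> \<in> S \<Longrightarrow> a \<le> t * F g0 \<sigma> + (1 - t) * F h \<sigma>"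
    show thesis by (rule that[OF t le])
  qed
  show ?case
  proof (rule bexI[of _ "\<lambda>x. t * g0 x + (1 - t) * h x"])
    show "\<forall>\<sigma>\<in>S. a \<le> F (\<lambda>x. t * g0 x + (1 - t) * h x) \<sigma>"
      using t ccv[OF g0 h(1) _ t(1,2)] insert.prems(2) by (meson order_trans subset_iff)
  qed (use g0 h(1) in \<open>rule cont_funs_affine\<close>)
qed

text \<open>If no finite part of the countable dense set covered all measures, a sequence of
  uncovered measures would have a weak limit, and lower semicontinuity would leave this limit
  uncovered too. The strict inequality in \<open>ex\<close> becomes a weak one in the conclusion;
  the slack pays for the approximation and for the limit.\<close>

theorem minimax:
  fixes F :: "('a \<Rightarrow> real) \<Rightarrow> 'a measure \<Rightarrow> real"
  assumes cvx: "\<And>g \<sigma> \<tau> t. g \<in> cont_funs \<Longrightarrow> \<sigma> \<in> prob_measures \<Longrightarrow> \<tau> \<in> prob_measures \<Longrightarrow>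
      0 \<le> t \<Longrightarrow> t \<le> 1 \<Longrightarrow> F g (mixture t \<sigma> \<tau>) \<le> t * F g \<sigma> + (1 - t) * F g \<tau>"
    and ccv: "\<And>g h \<sigma> t. g \<in> cont_funs \<Longrightarrow> h \<in> cont_funs \<Longrightarrow> \<sigma> \<in> prob_measures \<Longrightarrow>
      0 \<le> t \<Longrightarrow> t \<le> 1 \<Longrightarrow> t * F g \<sigma> + (1 - t) * F h \<sigma> \<le> F (\<lambda>x. t * g x + (1 - t) * h x) \<sigma>"
    and lsc: "\<And>g s \<sigma> b. g \<in> cont_funs \<Longrightarrow> (\<And>n. s n \<in> prob_measures) \<Longrightarrow> \<sigma> \<in> prob_measures \<Longrightarrow>
      weakly_converges s \<sigma> \<Longrightarrow> eventually (\<lambda>n. F g (s n) \<le> b) sequentially \<Longrightarrow> F g \<sigma> \<le> b"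
    and lip: "\<And>g h \<sigma> e. g \<in> cont_funs \<Longrightarrow> h \<in> cont_funs \<Longrightarrow> \<sigma> \<in> prob_measures \<Longrightarrow>
      (\<And>x. \<bar>g x - h x\<bar> \<le> e) \<Longrightarrow> F h \<sigma> \<le> F g \<sigma> + 2 * e"
    and ex: "\<And>\<sigma>. \<sigma> \<in> prob_measures \<Longrightarrow> \<exists>g\<in>cont_funs. a < F g \<sigma>"
  obtains g where "g \<in> cont_funs" "\<And>\<sigma>. \<sigma> \<in> prob_measures \<Longrightarrow> a \<le> F g \<sigma>"
proof -
  obtain D :: "nat \<Rightarrow> 'a \<Rightarrow> real" where D: "\<And>n. D n \<in> cont_funs"
    "\<And>g e. g \<in> cont_funs \<Longrightarrow> 0 < e \<Longrightarrow> \<exists>n. \<forall>x. \<bar>D n x - g x\<bar> \<le> e"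
    using cont_funs_countable_dense by blast
  have exD: "\<exists>n. a < F (D n) \<sigma>" if \<sigma>: "\<sigma> \<in> prob_measures" for \<sigma>
  proof -
    obtain g where g: "g \<in> cont_funs" "a < F g \<sigma>" using ex[OF \<sigma>] by blast
    \<comment> \<open>By \<open>lip\<close> the value drops by at most twice the distance, so a
      third of the gap keeps it above \<open>a\<close>.\<close>
    obtain n where n: "\<And>x. \<bar>D n x - g x\<bar> \<le> (F g \<sigma> - a) / 3"
      using D(2)[OF g(1), of "(F g \<sigma> - a) / 3"] g(2) by auto
    have "F g \<sigma> \<le> F (D n) \<sigma> + 2 * ((F g \<sigma> - a) / 3)" by (rule lip[OF D(1) g(1) \<sigma> n])
    then have "a < F (D n) \<sigma>" using g(2) by argo
    then show ?thesis by blast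
  qed
  have "\<exists>N. \<forall>\<sigma>\<in>prob_measures. \<exists>n<N. a \<le> F (D n) \<sigma>"
  proof (rule ccontr)
    assume "\<nexists>N. \<forall>\<sigma>\<in>prob_measures. \<exists>n<N. a \<le> F (D n) \<sigma>"
    then have "\<forall>N. \<exists>\<sigma>\<in>prob_measures. \<forall>n<N. F (D n) \<sigma> < a" by (metis not_less)
    then obtain s where s: "\<And>N. s N \<in> prob_measures" "\<And>N n. n < N \<Longrightarrow> F (D n) (s N) < a" by metis
    obtain r \<sigma> where r: "strict_mono r" and \<sigma>: "\<sigma> \<in> prob_measures" "weakly_converges (\<lambda>n. s (r n)) \<sigma>"
      using prob_measures_seq_compact[OF compact_UNIV, of s] s(1) by blast
    obtain n where n: "a < F (D n) \<sigma>" using exD[OF \<sigma>(1)] by blast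
    have "F (D n) \<sigma> \<le> a"
    proof (rule lsc[OF D(1) _ \<sigma>])
      show "s (r k) \<in> prob_measures" for k by (rule s(1))
      show "eventually (\<lambda>k. F (D n) (s (r k)) \<le> a) sequentially"
        using eventually_gt_at_top[of n]
      proof eventually_elim
        case (elim k)
        then have "n < r k" using seq_suble[OF r, of k] by linarith
        then show ?case using s(2) less_imp_le by blast
      qed
    qed
    then show False using n by simp
  qed
  then obtain N where "\<forall>\<sigma>\<in>prob_measures. \<exists>n<N. a \<le> F (D n) \<sigma>" by blast
  then have "\<exists>g\<in>cont_funs. \<forall>\<sigma>\<in>prob_measures. a \<le> F g \<sigma>"
    using D(1) by (intro finite_minimax[of F "D ` {..<N}"] cvx ccv mixture_in_prob_measures) auto
  then show thesis using that by blast
qed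

end

subsection \<open>Fixed points of convex operators\<close>

text \<open>One inequality packs several properties: \<open>t = 1\<close> gives monotonicity and
  compatibility with added constants, hence nonexpansiveness in the uniform norm, and
  \<open>k = 0\<close> gives convexity. In this form it is carried through iterates and through
  pointwise limits at one stroke.\<close>

definition convex_operator :: "(('a::metric_space \<Rightarrow> real) \<Rightarrow> ('a \<Rightarrow> real)) \<Rightarrow> bool" where
  "convex_operator A \<longleftrightarrow> (\<forall>f\<in>cont_funs. A f \<in> cont_funs) \<and>
     (\<forall>h\<in>cont_funs. \<forall>f\<in>cont_funs. \<forall>g\<in>cont_funs. \<forall>t k. 0 \<le> t \<longrightarrow> t \<le> 1 \<longrightarrow>
        (\<forall>x. h x \<le> t * f x + (1 - t) * g x + k) \<longrightarrow>
        (\<forall>x. A h x \<le> t * A f x + (1 - t) * A g x + k))"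

definition equicontinuous :: "('a::metric_space \<Rightarrow> real) set \<Rightarrow> bool" where
  "equicontinuous H \<longleftrightarrow>
     (\<forall>e>0. \<exists>d>0. \<forall>h\<in>H. \<forall>x y. dist x y < d \<longrightarrow> \<bar>h x - h y\<bar> \<le> e)"

lemma convex_operator_cont: "convex_operator A \<Longrightarrow> f \<in> cont_funs \<Longrightarrow> A f \<in> cont_funs"
  by (simp add: convex_operator_def)

lemma convex_operator_le:
  "convex_operator A \<Longrightarrow> h \<in> cont_funs \<Longrightarrow> f \<in> cont_funs \<Longrightarrow> g \<in> cont_funs \<Longrightarrow> 0 \<le> t \<Longrightarrow> t \<le> 1 \<Longrightarrow>
    (\<And>x. h x \<le> t * f x + (1 - t) * g x + k) \<Longrightarrow> A h x \<le> t * A f x + (1 - t) * A g x + k"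
  unfolding convex_operator_def by blast

lemma convex_operator_mono_add:
  assumes "convex_operator A" "h \<in> cont_funs" "f \<in> cont_funs" "\<And>x. h x \<le> f x + k"
  shows "A h x \<le> A f x + k"
  using convex_operator_le[OF assms(1,2,3,3), of 1 k x] assms(4) by simp

lemma convex_operator_mono:
  assumes "convex_operator A" "h \<in> cont_funs" "f \<in> cont_funs" "\<And>x. h x \<le> f x"
  shows "A h x \<le> A f x"
  using convex_operator_mono_add[OF assms(1-3), of 0 x] assms(4) by simp

lemma convex_operator_add_const:
  assumes "convex_operator A" "f \<in> cont_funs"
  shows "A (\<lambda>x. f x + k) x = A f x + k"
proof (rule antisym)
  have fk: "(\<lambda>x. f x + k) \<in> cont_funs" using assms(2) by (intro cont_funs_add cont_funs_const)
  show "A (\<lambda>x. f x + k) x \<le> A f x + k"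
    by (rule convex_operator_mono_add[OF assms(1) fk assms(2)]) simp
  show "A f x + k \<le> A (\<lambda>x. f x + k) x"
    using convex_operator_mono_add[OF assms(1,2) fk, of "-k" x] by simp
qed

lemma convex_operator_nonexpansive:
  assumes "convex_operator A" "f \<in> cont_funs" "g \<in> cont_funs" "\<And>x. \<bar>f x - g x\<bar> \<le> e"
  shows "\<bar>A f x - A g x\<bar> \<le> e"
proof -
  have "f x \<le> g x + e" "g x \<le> f x + e" for x using assms(4)[of x] by auto
  then have "A f x \<le> A g x + e" "A g x \<le> A f x + e"
    using assms(1-3) by (auto intro: convex_operator_mono_add)
  then show ?thesis by linarith
qed

lemma convex_operator_power: "convex_operator A \<Longrightarrow> convex_operator (A ^^ n)"
proof (induction n)
  case 0
  then show ?case by (simp add: convex_operator_def)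
next
  case (Suc n)
  then have n: "convex_operator (A ^^ n)" by simp
  show ?case
    unfolding convex_operator_def
  proof (intro conjI ballI allI impI)
    show "(A ^^ Suc n) f \<in> cont_funs" if "f \<in> cont_funs" for f
      using that convex_operator_cont[OF n] convex_operator_cont[OF Suc.prems] by simp
  next
    fix h f g :: "'a \<Rightarrow> real" and x and t k :: real
    assume H: "h \<in> cont_funs" "f \<in> cont_funs" "g \<in> cont_funs" "0 \<le> t" "t \<le> 1"
      "\<forall>x. h x \<le> t * f x + (1 - t) * g x + k"
    then have "(A ^^ n) h x \<le> t * (A ^^ n) f x + (1 - t) * (A ^^ n) g x + k" for x
      using convex_operator_le[OF n H(1-5)] by blast
    then show "(A ^^ Suc n) h x \<le> t * (A ^^ Suc n) f x + (1 - t) * (A ^^ Suc n) g x + k"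
      using H convex_operator_cont[OF n] convex_operator_le[OF Suc.prems] by simp
  qed
qed

lemma equicontinuousE:
  assumes "equicontinuous H" "0 < e"
  obtains d where "0 < d" "\<And>h x y. h \<in> H \<Longrightarrow> dist x y < d \<Longrightarrow> \<bar>h x - h y\<bar> \<le> e"
proof -
  have "\<exists>d>0. \<forall>h\<in>H. \<forall>x y. dist x y < d \<longrightarrow> \<bar>h x - h y\<bar> \<le> e"
    using assms unfolding equicontinuous_def by simp
  then obtain d where d: "d > 0" "\<forall>h\<in>H. \<forall>x y. dist x y < d \<longrightarrow> \<bar>h x - h y\<bar> \<le> e"
    by (elim exE conjE)
  then show thesis by (intro that[of d]) auto
qed

lemma equicontinuous_cont_funs:
  assumes "equicontinuous H" "h \<in> H" shows "h \<in> cont_funs"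
  unfolding cont_funs_def mem_Collect_eq continuous_on_iff
proof (intro ballI allI impI)
  fix x :: 'a and e :: real assume "0 < e"
  then have "0 < e/2" by simp
  from equicontinuousE[OF assms(1) this] obtain d where
    d: "d > 0" "\<And>x y. dist x y < d \<Longrightarrow> \<bar>h x - h y\<bar> \<le> e/2"
    using assms(2) by metis
  have "dist (h y) (h x) < e" if "dist y x < d" for y
    using d(2)[OF that] \<open>0 < e\<close> by (simp add: dist_real_def)
  then show "\<exists>d>0. \<forall>x'\<in>UNIV. dist x' x < d \<longrightarrow> dist (h x') (h x) < e" using d(1) by blast
qed

lemma abs_SUP_diff_le:
  fixes u v :: "'i \<Rightarrow> real"
  assumes "I \<noteq> {}" "bdd_above (u ` I)" "bdd_above (v ` I)" "\<And>i. i \<in> I \<Longrightarrow> \<bar>u i - v i\<bar> \<le> e"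
  shows "\<bar>(SUP i\<in>I. u i) - (SUP i\<in>I. v i)\<bar> \<le> e"
proof -
  have "(SUP i\<in>I. u i) \<le> (SUP i\<in>I. v i) + e"
  proof (rule cSUP_least[OF assms(1)])
    fix i assume i: "i \<in> I"
    have "u i \<le> v i + e" using assms(4)[OF i] by linarith
    also have "v i \<le> (SUP i\<in>I. v i)" using i assms(3) by (rule cSUP_upper)
    finally show "u i \<le> (SUP i\<in>I. v i) + e" by simp
  qed
  moreover have "(SUP i\<in>I. v i) \<le> (SUP i\<in>I. u i) + e"
  proof (rule cSUP_least[OF assms(1)])
    fix i assume i: "i \<in> I"
    have "v i \<le> u i + e" using assms(4)[OF i] by linarith
    also have "u i \<le> (SUP i\<in>I. u i)" using i assms(2) by (rule cSUP_upper)
    finally show "v i \<le> (SUP i\<in>I. u i) + e" by simp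
  qed
  ultimately show ?thesis by linarith
qed

section \<open>Limsup of an orbit and projection onto the fixed points\<close>

definition upper_orbit :: "(('a \<Rightarrow> real) \<Rightarrow> ('a \<Rightarrow> real)) \<Rightarrow> ('a \<Rightarrow> real) \<Rightarrow> nat \<Rightarrow> 'a \<Rightarrow> real" where
  "upper_orbit A g n x = (SUP m. (A ^^ (n + m)) g x)"

definition orbit_limsup :: "(('a \<Rightarrow> real) \<Rightarrow> ('a \<Rightarrow> real)) \<Rightarrow> ('a \<Rightarrow> real) \<Rightarrow> 'a \<Rightarrow> real" where
  "orbit_limsup A g x = (INF n. upper_orbit A g n x)"

definition fixed_point_projection :: "(('a \<Rightarrow> real) \<Rightarrow> ('a \<Rightarrow> real)) \<Rightarrow> ('a \<Rightarrow> real) \<Rightarrow> 'a \<Rightarrow> real" where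
  "fixed_point_projection A g x = (SUP n. (A ^^ n) (orbit_limsup A g) x)"

text \<open>The limsup \<open>l\<close> of an orbit satisfies \<open>l \<le> A l\<close> by monotonicity, so the iterates of \<open>l\<close>
  increase to a fixed point of \<open>A\<close>.\<close>

locale bounded_equicontinuous_operator =
  fixes A :: "('a::metric_space \<Rightarrow> real) \<Rightarrow> ('a \<Rightarrow> real)" and R :: real
  assumes compact_UNIV: "compact (UNIV :: 'a set)"
    and convex_operator: "convex_operator A"
    and equicontinuous_range: "equicontinuous (A ` cont_funs)"
    and orbit_zero: "\<And>n x. \<bar>(A ^^ n) (\<lambda>x. 0) x\<bar> \<le> R"
begin

lemmas power_op = convex_operator_power[OF convex_operator]
lemmas power_cont = convex_operator_cont[OF power_op]

lemma orbit_bounded: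
  assumes "g \<in> cont_funs" "\<And>x. \<bar>g x\<bar> \<le> b"
  shows "\<bar>(A ^^ n) g x\<bar> \<le> b + R"
  using convex_operator_nonexpansive[OF power_op assms(1), of "\<lambda>_. 0" b n x] assms(2)
    orbit_zero[of n x] by simp

text \<open>Every iterate except \<open>g\<close> itself lies in the range of \<open>A\<close>, so
  the modulus of the range only has to be combined with that of \<open>g\<close>.\<close>

lemma equicontinuous_orbit:
  assumes "g \<in> cont_funs" shows "equicontinuous (range (\<lambda>n. (A ^^ n) g))"
  unfolding equicontinuous_def
proof (intro allI impI)
  fix e :: real assume e: "0 < e"
  obtain d1 where d1: "d1 > 0" "\<And>x y. dist x y < d1 \<Longrightarrow> \<bar>g x - g y\<bar> \<le> e"
    using cont_funs_uniform[OF compact_UNIV assms e] by blast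
  obtain d2 where d2: "d2 > 0"
      "\<And>f x y. f \<in> cont_funs \<Longrightarrow> dist x y < d2 \<Longrightarrow> \<bar>A f x - A f y\<bar> \<le> e"
    using equicontinuousE[OF equicontinuous_range e] by (metis imageI)
  have "\<bar>(A ^^ n) g x - (A ^^ n) g y\<bar> \<le> e" if "dist x y < min d1 d2" for n x y
    using d1(2)[of x y] d2(2)[OF power_cont[OF assms]] that by (cases n) auto
  then show "\<exists>d>0. \<forall>h\<in>range (\<lambda>n. (A ^^ n) g). \<forall>x y. dist x y < d \<longrightarrow> \<bar>h x - h y\<bar> \<le> e"
    using d1(1) d2(1) by (intro exI[of _ "min d1 d2"]) auto
qed

lemma bdd_orbit:
  assumes "g \<in> cont_funs"
  shows "bdd_above (range (\<lambda>m. (A ^^ (n + m)) g x))" "bdd_below (range (\<lambda>m. (A ^^ (n + m)) g x))"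
proof -
  obtain b where b: "\<And>x. \<bar>g x\<bar> \<le> b" using cont_funs_bounded[OF compact_UNIV assms] by blast
  have "(A ^^ (n + m)) g x \<le> b + R" "- (b + R) \<le> (A ^^ (n + m)) g x" for m
    using orbit_bounded[OF assms b, of "n + m" x] by auto
  then show "bdd_above (range (\<lambda>m. (A ^^ (n + m)) g x))" "bdd_below (range (\<lambda>m. (A ^^ (n + m)) g x))"
    by (intro bdd_aboveI2[where M = "b + R"] bdd_belowI2[where m = "- (b + R)"]; blast)+
qed

lemma upper_orbit_ge:
  assumes "g \<in> cont_funs" "n \<le> j" shows "(A ^^ j) g x \<le> upper_orbit A g n x"
proof -
  have "(A ^^ (n + (j - n))) g x \<le> upper_orbit A g n x"
    unfolding upper_orbit_def by (rule cSUP_upper[OF UNIV_I bdd_orbit(1)[OF assms(1)]])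
  then show ?thesis using assms(2) by simp
qed

lemma upper_orbit_least:
  assumes "\<And>j. n \<le> j \<Longrightarrow> (A ^^ j) g x \<le> b" shows "upper_orbit A g n x \<le> b"
  unfolding upper_orbit_def by (rule cSUP_least) (use assms in auto)

lemma equicontinuous_upper_orbit:
  assumes "g \<in> cont_funs" shows "equicontinuous (range (upper_orbit A g))"
  unfolding equicontinuous_def
proof (intro allI impI)
  fix e :: real assume "0 < e"
  from equicontinuousE[OF equicontinuous_orbit[OF assms] this] obtain d where
      "d > 0" "\<And>n x y. dist x y < d \<Longrightarrow> \<bar>(A ^^ n) g x - (A ^^ n) g y\<bar> \<le> e"
    by (metis rangeI)
  then show "\<exists>d>0. \<forall>h\<in>range (upper_orbit A g). \<forall>x y. dist x y < d \<longrightarrow> \<bar>h x - h y\<bar> \<le> e"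
    unfolding upper_orbit_def
    by (intro exI[of _ d]) (auto intro!: abs_SUP_diff_le bdd_orbit(1) assms)
qed

lemma upper_orbit_cont: "g \<in> cont_funs \<Longrightarrow> upper_orbit A g n \<in> cont_funs"
  using equicontinuous_cont_funs[OF equicontinuous_upper_orbit] by blast

lemma orbit_limsup_tendsto:
  assumes "g \<in> cont_funs" shows "(\<lambda>n. upper_orbit A g n x) \<longlonglongrightarrow> orbit_limsup A g x"
  unfolding orbit_limsup_def
proof (rule LIMSEQ_decseq_INF)
  obtain b where b: "\<And>x. \<bar>g x\<bar> \<le> b" using cont_funs_bounded[OF compact_UNIV assms] by blast
  have "- (b + R) \<le> upper_orbit A g n x" for n
    using upper_orbit_ge[OF assms, of n n x] orbit_bounded[OF assms b, of n x] by linarith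
  then show "bdd_below (range (\<lambda>n. upper_orbit A g n x))" by (rule bdd_belowI2)
  show "decseq (\<lambda>n. upper_orbit A g n x)"
    by (auto simp: decseq_def intro!: upper_orbit_least upper_orbit_ge[OF assms])
qed

lemma equicontinuous_uniform:
  fixes s :: "nat \<Rightarrow> 'a \<Rightarrow> real"
  assumes "equicontinuous (range s)" "\<And>x. (\<lambda>n. s n x) \<longlonglongrightarrow> l x" "0 < e"
  obtains N where "\<And>n x. N \<le> n \<Longrightarrow> \<bar>s n x - l x\<bar> \<le> e"
proof -
  have "\<exists>N. \<forall>n\<ge>N. \<forall>x. \<bar>s n x - l x\<bar> \<le> e"
  proof (rule pointwise_imp_uniform[OF compact_UNIV _ assms(2,3)])
    fix e :: real assume "0 < e"
    from equicontinuousE[OF assms(1) this]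
    show "\<exists>d>0. \<forall>n x y. dist x y < d \<longrightarrow> \<bar>s n x - s n y\<bar> \<le> e" by (metis rangeI)
  qed
  then obtain N where N: "\<forall>n\<ge>N. \<forall>x. \<bar>s n x - l x\<bar> \<le> e" by (rule exE)
  show thesis by (rule that[of N]) (use N in simp)
qed

lemma equicontinuous_limit_cont:
  fixes l :: "'a \<Rightarrow> real"
  assumes "equicontinuous (range s)" "\<And>x. (\<lambda>n. s n x) \<longlonglongrightarrow> l x"
  shows "l \<in> cont_funs"
proof -
  have "equicontinuous {l}"
    unfolding equicontinuous_def
  proof (intro allI impI)
    fix e :: real assume "0 < e"
    from equicontinuousE[OF assms(1) this] obtain d where
        d: "d > 0" "\<And>n x y. dist x y < d \<Longrightarrow> \<bar>s n x - s n y\<bar> \<le> e"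
      by (metis rangeI)
    have "\<bar>l x - l y\<bar> \<le> e" if "dist x y < d" for x y
    proof (rule LIMSEQ_le_const2)
      show "(\<lambda>n. \<bar>s n x - s n y\<bar>) \<longlonglongrightarrow> \<bar>l x - l y\<bar>" by (intro tendsto_intros assms(2))
    qed (use d(2)[OF that] in auto)
    then show "\<exists>d>0. \<forall>h\<in>{l}. \<forall>x y. dist x y < d \<longrightarrow> \<bar>h x - h y\<bar> \<le> e" using d(1) by auto
  qed
  then show ?thesis by (rule equicontinuous_cont_funs) simp
qed

lemma orbit_limsup_cont: "g \<in> cont_funs \<Longrightarrow> orbit_limsup A g \<in> cont_funs"
  by (rule equicontinuous_limit_cont[OF equicontinuous_upper_orbit orbit_limsup_tendsto])

lemma orbit_limsup_uniform:
  assumes "g \<in> cont_funs" "0 < e"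
  obtains N where "\<And>n x. N \<le> n \<Longrightarrow> \<bar>upper_orbit A g n x - orbit_limsup A g x\<bar> \<le> e"
  using equicontinuous_uniform[OF equicontinuous_upper_orbit[OF assms(1)]
        orbit_limsup_tendsto[OF assms(1)] assms(2)] by metis

lemma upper_orbit_Suc_le:
  assumes g: "g \<in> cont_funs"
  shows "upper_orbit A g (Suc n) x \<le> A (upper_orbit A g n) x"
proof (rule upper_orbit_least)
  fix j assume "Suc n \<le> j"
  then obtain i where i: "j = Suc i" "n \<le> i" by (cases j) auto
  have "A ((A ^^ i) g) x \<le> A (upper_orbit A g n) x"
    by (intro convex_operator_mono[OF convex_operator] power_cont g upper_orbit_cont upper_orbit_ge i(2))
  then show "(A ^^ j) g x \<le> A (upper_orbit A g n) x" by (simp add: i(1))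
qed

text \<open>Passing to the limit in \<open>upper_orbit_Suc_le\<close> requires moving the limit
  through \<open>A\<close>. Equicontinuity makes the convergence of the tails uniform, and a uniform
  error \<open>e\<close> stays \<open>e\<close> under \<open>A\<close>.\<close>

lemma orbit_limsup_le:
  assumes g: "g \<in> cont_funs"
  shows "orbit_limsup A g x \<le> A (orbit_limsup A g) x"
proof (rule field_le_epsilon)
  fix e :: real assume "0 < e"
  from orbit_limsup_uniform[OF g this]
  obtain N where N: "\<And>x. \<bar>upper_orbit A g N x - orbit_limsup A g x\<bar> \<le> e" by (metis order_refl)
  have "decseq (\<lambda>n. upper_orbit A g n x)"
    by (auto simp: decseq_def intro!: upper_orbit_least upper_orbit_ge[OF g])
  then have "orbit_limsup A g x \<le> upper_orbit A g (Suc N) x"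
    by (rule decseq_ge[OF _ orbit_limsup_tendsto[OF g]])
  also have "\<dots> \<le> A (upper_orbit A g N) x" by (rule upper_orbit_Suc_le[OF g])
  also have "\<dots> \<le> A (orbit_limsup A g) x + e"
  proof (rule convex_operator_mono_add[OF convex_operator upper_orbit_cont[OF g] orbit_limsup_cont[OF g]])
    show "upper_orbit A g N y \<le> orbit_limsup A g y + e" for y using N[of y] by linarith
  qed
  finally show "orbit_limsup A g x \<le> A (orbit_limsup A g) x + e" .
qed

lemma projection_tendsto:
  assumes g: "g \<in> cont_funs"
  shows "incseq (\<lambda>n. (A ^^ n) (orbit_limsup A g) x)"
    "(\<lambda>n. (A ^^ n) (orbit_limsup A g) x) \<longlonglongrightarrow> fixed_point_projection A g x"
proof -
  have le: "(A ^^ n) (orbit_limsup A g) x \<le> (A ^^ Suc n) (orbit_limsup A g) x" for n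
  proof -
    have "(A ^^ n) (orbit_limsup A g) x \<le> (A ^^ n) (A (orbit_limsup A g)) x"
      using g by (intro convex_operator_mono[OF power_op] orbit_limsup_le orbit_limsup_cont
          convex_operator_cont[OF convex_operator])
    then show ?thesis by (simp add: funpow_swap1)
  qed
  then show inc: "incseq (\<lambda>n. (A ^^ n) (orbit_limsup A g) x)" by (rule incseq_SucI)
  show "(\<lambda>n. (A ^^ n) (orbit_limsup A g) x) \<longlonglongrightarrow> fixed_point_projection A g x"
    unfolding fixed_point_projection_def
    using bdd_orbit(1)[OF orbit_limsup_cont[OF g], of 0 x] inc by (intro LIMSEQ_incseq_SUP) auto
qed

lemma projection_cont: "g \<in> cont_funs \<Longrightarrow> fixed_point_projection A g \<in> cont_funs"
  by (rule equicontinuous_limit_cont[OF equicontinuous_orbit[OF orbit_limsup_cont] projection_tendsto(2)])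

lemma projection_ge:
  "g \<in> cont_funs \<Longrightarrow> (A ^^ n) (orbit_limsup A g) x \<le> fixed_point_projection A g x"
  by (rule incseq_le[OF projection_tendsto])

text \<open>The two inequalities differ in depth: that the limit lies below its image follows from
  monotonicity alone, whereas the converse needs the iterates to be uniformly close to their
  limit.\<close>

lemma projection_fixed:
  assumes g: "g \<in> cont_funs"
  shows "A (fixed_point_projection A g) = fixed_point_projection A g"
proof (rule ext, rule antisym)
  fix x
  note l = orbit_limsup_cont[OF g] and v = projection_cont[OF g]
  show "A (fixed_point_projection A g) x \<le> fixed_point_projection A g x"
  proof (rule field_le_epsilon)
    fix e :: real assume "0 < e"
    from equicontinuous_uniform[OF equicontinuous_orbit[OF l] projection_tendsto(2)[OF g] this]
    obtain N where N: "\<And>x. \<bar>(A ^^ N) (orbit_limsup A g) x - fixed_point_projection A g x\<bar> \<le> e"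
      by (metis order_refl)
    have "A (fixed_point_projection A g) x \<le> A ((A ^^ N) (orbit_limsup A g)) x + e"
    proof (rule convex_operator_mono_add[OF convex_operator v power_cont[OF l]])
      show "fixed_point_projection A g y \<le> (A ^^ N) (orbit_limsup A g) y + e" for y
        using N[of y] by linarith
    qed
    also have "A ((A ^^ N) (orbit_limsup A g)) x \<le> fixed_point_projection A g x"
      using projection_ge[OF g, of "Suc N" x] by simp
    finally show "A (fixed_point_projection A g) x \<le> fixed_point_projection A g x + e" by simp
  qed
  show "fixed_point_projection A g x \<le> A (fixed_point_projection A g) x"
  proof (rule LIMSEQ_le_const2[OF LIMSEQ_Suc[OF projection_tendsto(2)[OF g]]])
    have "(A ^^ Suc n) (orbit_limsup A g) x \<le> A (fixed_point_projection A g) x" for n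
      using convex_operator_mono[OF convex_operator power_cont[OF l] v projection_ge[OF g]] by simp
    then show "\<exists>N. \<forall>n\<ge>N. (A ^^ Suc n) (orbit_limsup A g) x \<le> A (fixed_point_projection A g) x" by blast
  qed
qed

lemma projection_id:
  assumes u: "u \<in> cont_funs" "A u = u"
  shows "fixed_point_projection A u = u"
proof -
  have p: "(A ^^ n) u = u" for n by (induction n) (use u(2) in auto)
  have "upper_orbit A u n = u" for n by (rule ext) (simp add: upper_orbit_def p)
  then have "orbit_limsup A u = u" by (auto simp: orbit_limsup_def)
  then show ?thesis by (auto simp: fixed_point_projection_def p)
qed

lemma projection_idem:
  "g \<in> cont_funs \<Longrightarrow> fixed_point_projection A (fixed_point_projection A g) = fixed_point_projection A g"
  by (intro projection_id projection_cont projection_fixed)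

text \<open>The supremum over a tail is subadditive, so the inequality between iterates survives;
  the infimum over a tail would reverse this step.\<close>

lemma orbit_limsup_convex:
  assumes H: "h \<in> cont_funs" "f \<in> cont_funs" "g \<in> cont_funs" "0 \<le> t" "t \<le> 1"
    and le: "\<And>x. h x \<le> t * f x + (1 - t) * g x + k"
  shows "orbit_limsup A h x \<le> t * orbit_limsup A f x + (1 - t) * orbit_limsup A g x + k"
proof (rule LIMSEQ_le)
  show "(\<lambda>n. upper_orbit A h n x) \<longlonglongrightarrow> orbit_limsup A h x" by (rule orbit_limsup_tendsto[OF H(1)])
  show "(\<lambda>n. t * upper_orbit A f n x + (1 - t) * upper_orbit A g n x + k)
      \<longlonglongrightarrow> t * orbit_limsup A f x + (1 - t) * orbit_limsup A g x + k"
    by (intro tendsto_intros orbit_limsup_tendsto H)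
  have "upper_orbit A h n x \<le> t * upper_orbit A f n x + (1 - t) * upper_orbit A g n x + k" for n
  proof (rule upper_orbit_least)
    fix j assume j: "n \<le> j"
    have "(A ^^ j) h x \<le> t * (A ^^ j) f x + (1 - t) * (A ^^ j) g x + k"
      by (rule convex_operator_le[OF power_op H le])
    also have "\<dots> \<le> t * upper_orbit A f n x + (1 - t) * upper_orbit A g n x + k"
      using H j by (intro add_mono mult_left_mono upper_orbit_ge) auto
    finally show "(A ^^ j) h x \<le> t * upper_orbit A f n x + (1 - t) * upper_orbit A g n x + k" .
  qed
  then show "\<exists>N. \<forall>n\<ge>N. upper_orbit A h n x \<le> t * upper_orbit A f n x + (1 - t) * upper_orbit A g n x + k"
    by blast
qed

lemma convex_operator_projection: "convex_operator (fixed_point_projection A)"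
  unfolding convex_operator_def
proof (intro conjI ballI allI impI)
  fix h f g :: "'a \<Rightarrow> real" and x and t k :: real
  assume H: "h \<in> cont_funs" "f \<in> cont_funs" "g \<in> cont_funs" "0 \<le> t" "t \<le> 1"
    "\<forall>x. h x \<le> t * f x + (1 - t) * g x + k"
  show "fixed_point_projection A h x
      \<le> t * fixed_point_projection A f x + (1 - t) * fixed_point_projection A g x + k"
  proof (rule LIMSEQ_le)
    show "(\<lambda>n. (A ^^ n) (orbit_limsup A h) x) \<longlonglongrightarrow> fixed_point_projection A h x"
      by (rule projection_tendsto(2)[OF H(1)])
    show "(\<lambda>n. t * (A ^^ n) (orbit_limsup A f) x + (1 - t) * (A ^^ n) (orbit_limsup A g) x + k)
      \<longlonglongrightarrow> t * fixed_point_projection A f x + (1 - t) * fixed_point_projection A g x + k"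
      by (intro tendsto_intros projection_tendsto(2) H)
    have "(A ^^ n) (orbit_limsup A h) x
        \<le> t * (A ^^ n) (orbit_limsup A f) x + (1 - t) * (A ^^ n) (orbit_limsup A g) x + k" for n
      by (rule convex_operator_le[OF power_op])
        (use H orbit_limsup_cont orbit_limsup_convex[OF H(1-5)] in auto)
    then show "\<exists>N. \<forall>n\<ge>N. (A ^^ n) (orbit_limsup A h) x
        \<le> t * (A ^^ n) (orbit_limsup A f) x + (1 - t) * (A ^^ n) (orbit_limsup A g) x + k" by blast
  qed
qed (rule projection_cont)

lemma orbit_limsup_le_projection: "g \<in> cont_funs \<Longrightarrow> orbit_limsup A g x \<le> fixed_point_projection A g x"
  using projection_ge[of g 0 x] by simp

text \<open>Used for the coercivity of the limiting operator. The bound is asked only of iterates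
  with index at least one, since it comes from a bound on \<open>A g\<close> and says nothing about
  \<open>g\<close>.\<close>

lemma projection_lower_bound:
  assumes g: "g \<in> cont_funs" and le: "\<And>n x. l \<le> (A ^^ Suc n) g x"
  shows "l \<le> fixed_point_projection A g x"
proof -
  have "l \<le> orbit_limsup A g x"
    unfolding orbit_limsup_def
  proof (rule cINF_greatest)
    show "l \<le> upper_orbit A g n x" for n
      using le[of n x] upper_orbit_ge[OF g, of n "Suc n" x] by simp
  qed simp
  then show ?thesis using orbit_limsup_le_projection[OF g, of x] by linarith
qed

text \<open>The integral does not decrease along the orbit, and a late iterate lies below the limsup
  up to a uniform \<open>e\<close>, hence below the projection up to \<open>e\<close>.\<close>

lemma integral_le_projection:
  assumes \<mu>: "\<mu> \<in> prob_measures" and le: "\<And>g. g \<in> cont_funs \<Longrightarrow> (\<integral>x. g x \<partial>\<mu>) \<le> (\<integral>x. A g x \<partial>\<mu>)"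
    and g: "g \<in> cont_funs"
  shows "(\<integral>x. g x \<partial>\<mu>) \<le> (\<integral>x. fixed_point_projection A g x \<partial>\<mu>)"
proof (rule field_le_epsilon)
  fix e :: real assume "0 < e"
  from orbit_limsup_uniform[OF g this]
  obtain N where N: "\<And>x. \<bar>upper_orbit A g N x - orbit_limsup A g x\<bar> \<le> e" by (metis order_refl)
  have "(\<integral>x. g x \<partial>\<mu>) \<le> (\<integral>x. (A ^^ n) g x \<partial>\<mu>)" for n
  proof (induction n)
    case (Suc n)
    also have "(\<integral>x. (A ^^ n) g x \<partial>\<mu>) \<le> (\<integral>x. (A ^^ Suc n) g x \<partial>\<mu>)"
      using le[OF power_cont[OF g]] by simp
    finally show ?case .
  qed simp
  then have "(\<integral>x. g x \<partial>\<mu>) \<le> (\<integral>x. (A ^^ N) g x \<partial>\<mu>)" .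
  also have "\<dots> \<le> (\<integral>x. fixed_point_projection A g x \<partial>\<mu>) + e"
  proof (rule integral_le_add[OF compact_UNIV projection_cont[OF g] power_cont[OF g] \<mu>])
    show "(A ^^ N) g x \<le> fixed_point_projection A g x + e" for x
      using upper_orbit_ge[OF g order_refl, of N x] N[of x] orbit_limsup_le_projection[OF g, of x]
      by linarith
  qed
  finally show "(\<integral>x. g x \<partial>\<mu>) \<le> (\<integral>x. fixed_point_projection A g x \<partial>\<mu>) + e" .
qed

end

subsection \<open>Transfers dual to convex operators\<close>

text \<open>In each minimax problem below, the measure integrating \<open>g\<close> and the one
  integrating \<open>A g\<close> are either the variable or a fixed measure. Treating both as maps
  of the variable lets one lemma serve duality, the Legendre transform, inf-convolution and
  subsolutions.\<close>

definition affine_continuous :: "('a::metric_space measure \<Rightarrow> 'a measure) \<Rightarrow> bool" where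
  "affine_continuous \<alpha> \<longleftrightarrow> (\<forall>\<sigma>\<in>prob_measures. \<alpha> \<sigma> \<in> prob_measures) \<and>
     (\<forall>g\<in>cont_funs. \<forall>\<sigma>\<in>prob_measures. \<forall>\<tau>\<in>prob_measures. \<forall>t. 0 \<le> t \<longrightarrow> t \<le> 1 \<longrightarrow>
        (\<integral>x. g x \<partial>\<alpha> (mixture t \<sigma> \<tau>)) = t * (\<integral>x. g x \<partial>\<alpha> \<sigma>) + (1 - t) * (\<integral>x. g x \<partial>\<alpha> \<tau>)) \<and>
     (\<forall>s \<sigma>. weakly_converges s \<sigma> \<longrightarrow> weakly_converges (\<lambda>n. \<alpha> (s n)) (\<alpha> \<sigma>))"

lemma affine_continuous_const: "\<nu> \<in> prob_measures \<Longrightarrow> affine_continuous (\<lambda>_. \<nu>)"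
  by (simp add: affine_continuous_def weakly_converges_def algebra_simps)

lemma convex_operator_ident: "convex_operator (\<lambda>g. g)"
  by (simp add: convex_operator_def)

context
  assumes compact_UNIV: "compact (UNIV :: 'a::metric_space set)"
begin

lemma affine_continuous_ident: "affine_continuous (\<lambda>\<sigma> :: 'a measure. \<sigma>)"
  by (simp add: affine_continuous_def integral_mixture[OF compact_UNIV])

text \<open>Convexity of \<open>A\<close> makes the payoff concave in \<open>g\<close>; in \<sigma>
  it is \<phi> plus an affine continuous part. The factor 2 in the Lipschitz condition of
  \<open>minimax\<close> accounts for the two integrals that change with \<open>g\<close>.\<close>

lemma operator_minimax:
  fixes A :: "('a \<Rightarrow> real) \<Rightarrow> ('a \<Rightarrow> real)"
  assumes A: "convex_operator A" and \<alpha>: "affine_continuous \<alpha>" and \<beta>: "affine_continuous \<beta>"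
    and cvx: "\<And>\<sigma> \<tau> t. \<sigma> \<in> prob_measures \<Longrightarrow> \<tau> \<in> prob_measures \<Longrightarrow> 0 \<le> t \<Longrightarrow> t \<le> 1 \<Longrightarrow>
        \<phi> (mixture t \<sigma> \<tau>) \<le> t * \<phi> \<sigma> + (1 - t) * \<phi> \<tau>"
    and lsc: "\<And>s \<sigma> b. (\<And>n. s n \<in> prob_measures) \<Longrightarrow> \<sigma> \<in> prob_measures \<Longrightarrow> weakly_converges s \<sigma> \<Longrightarrow>
        eventually (\<lambda>n. \<phi> (s n) \<le> b) sequentially \<Longrightarrow> \<phi> \<sigma> \<le> b"
    and ex: "\<And>\<sigma>. \<sigma> \<in> prob_measures \<Longrightarrow>
        \<exists>g\<in>cont_funs. a < \<phi> \<sigma> + (\<integral>x. g x \<partial>\<alpha> \<sigma>) - (\<integral>x. A g x \<partial>\<beta> \<sigma>)"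
  obtains g where "g \<in> cont_funs"
    "\<And>\<sigma>. \<sigma> \<in> prob_measures \<Longrightarrow> a \<le> \<phi> \<sigma> + (\<integral>x. g x \<partial>\<alpha> \<sigma>) - (\<integral>x. A g x \<partial>\<beta> \<sigma>)"
proof (rule minimax[OF compact_UNIV, of "\<lambda>g \<sigma>. \<phi> \<sigma> + (\<integral>x. g x \<partial>\<alpha> \<sigma>) - (\<integral>x. A g x \<partial>\<beta> \<sigma>)" a])
  note Ac = convex_operator_cont[OF A]
  have \<alpha>P: "\<alpha> \<sigma> \<in> prob_measures" and \<beta>P: "\<beta> \<sigma> \<in> prob_measures" if "\<sigma> \<in> prob_measures" for \<sigma>
    using \<alpha> \<beta> that by (auto simp: affine_continuous_def)
  {
    fix g :: "'a \<Rightarrow> real" and \<sigma> \<tau> :: "'a measure" and t :: real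
    assume H: "g \<in> cont_funs" "\<sigma> \<in> prob_measures" "\<tau> \<in> prob_measures" "0 \<le> t" "t \<le> 1"
    have "(\<integral>x. g x \<partial>\<alpha> (mixture t \<sigma> \<tau>)) = t * (\<integral>x. g x \<partial>\<alpha> \<sigma>) + (1 - t) * (\<integral>x. g x \<partial>\<alpha> \<tau>)"
      "(\<integral>x. A g x \<partial>\<beta> (mixture t \<sigma> \<tau>)) = t * (\<integral>x. A g x \<partial>\<beta> \<sigma>) + (1 - t) * (\<integral>x. A g x \<partial>\<beta> \<tau>)"
      using \<alpha> \<beta> H Ac[OF H(1)] unfolding affine_continuous_def by blast+
    then show "\<phi> (mixture t \<sigma> \<tau>) + (\<integral>x. g x \<partial>\<alpha> (mixture t \<sigma> \<tau>)) - (\<integral>x. A g x \<partial>\<beta> (mixture t \<sigma> \<tau>))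
        \<le> t * (\<phi> \<sigma> + (\<integral>x. g x \<partial>\<alpha> \<sigma>) - (\<integral>x. A g x \<partial>\<beta> \<sigma>))
          + (1 - t) * (\<phi> \<tau> + (\<integral>x. g x \<partial>\<alpha> \<tau>) - (\<integral>x. A g x \<partial>\<beta> \<tau>))"
      using cvx[OF H(2-5)] by (simp add: algebra_simps)
  next
    fix g h :: "'a \<Rightarrow> real" and \<sigma> :: "'a measure" and t :: real
    assume H: "g \<in> cont_funs" "h \<in> cont_funs" "\<sigma> \<in> prob_measures" "0 \<le> t" "t \<le> 1"
    define f where "f = (\<lambda>x. t * g x + (1 - t) * h x)"
    have f: "f \<in> cont_funs" unfolding f_def by (rule cont_funs_affine[OF H(1,2)])
    have "(\<integral>x. f x \<partial>\<alpha> \<sigma>) = t * (\<integral>x. g x \<partial>\<alpha> \<sigma>) + (1 - t) * (\<integral>x. h x \<partial>\<alpha> \<sigma>)"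
      unfolding f_def by (rule integral_affine[OF compact_UNIV H(1,2) \<alpha>P[OF H(3)]])
    moreover have "A f x \<le> t * A g x + (1 - t) * A h x + 0" for x
      by (rule convex_operator_le[OF A f H(1,2,4,5)]) (simp add: f_def)
    then have "(\<integral>x. A f x \<partial>\<beta> \<sigma>) \<le> t * (\<integral>x. A g x \<partial>\<beta> \<sigma>) + (1 - t) * (\<integral>x. A h x \<partial>\<beta> \<sigma>) + 0"
      by (rule integral_le_affine[OF compact_UNIV Ac[OF H(1)] Ac[OF H(2)] Ac[OF f] \<beta>P[OF H(3)]])
    ultimately show "t * (\<phi> \<sigma> + (\<integral>x. g x \<partial>\<alpha> \<sigma>) - (\<integral>x. A g x \<partial>\<beta> \<sigma>))
          + (1 - t) * (\<phi> \<sigma> + (\<integral>x. h x \<partial>\<alpha> \<sigma>) - (\<integral>x. A h x \<partial>\<beta> \<sigma>))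
        \<le> \<phi> \<sigma> + (\<integral>x. t * g x + (1 - t) * h x \<partial>\<alpha> \<sigma>)
          - (\<integral>x. A (\<lambda>x. t * g x + (1 - t) * h x) x \<partial>\<beta> \<sigma>)"
      unfolding f_def[symmetric] by (simp add: algebra_simps)
  next
    fix g :: "'a \<Rightarrow> real" and s and \<sigma> :: "'a measure" and b
    assume H: "g \<in> cont_funs" "\<And>n. s n \<in> prob_measures" "\<sigma> \<in> prob_measures" "weakly_converges s \<sigma>"
      and ev: "eventually (\<lambda>n. \<phi> (s n) + (\<integral>x. g x \<partial>\<alpha> (s n)) - (\<integral>x. A g x \<partial>\<beta> (s n)) \<le> b) sequentially"
    have lim: "(\<lambda>n. (\<integral>x. g x \<partial>\<alpha> (s n)) - (\<integral>x. A g x \<partial>\<beta> (s n)))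
        \<longlonglongrightarrow> (\<integral>x. g x \<partial>\<alpha> \<sigma>) - (\<integral>x. A g x \<partial>\<beta> \<sigma>)"
      using \<alpha> \<beta> H(4) H(1) Ac[OF H(1)] unfolding affine_continuous_def weakly_converges_def
      by (intro tendsto_diff) auto
    \<comment> \<open>As \<phi> is only lower semicontinuous, the convergent integrals are first
      frozen at their limit at the cost of \<open>e\<close>.\<close>
    have "\<phi> \<sigma> \<le> b - ((\<integral>x. g x \<partial>\<alpha> \<sigma>) - (\<integral>x. A g x \<partial>\<beta> \<sigma>))"
    proof (rule field_le_epsilon)
      fix e :: real assume "0 < e"
      show "\<phi> \<sigma> \<le> b - ((\<integral>x. g x \<partial>\<alpha> \<sigma>) - (\<integral>x. A g x \<partial>\<beta> \<sigma>)) + e"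
      proof (rule lsc[OF H(2-4)])
        show "eventually (\<lambda>n. \<phi> (s n) \<le> b - ((\<integral>x. g x \<partial>\<alpha> \<sigma>) - (\<integral>x. A g x \<partial>\<beta> \<sigma>)) + e) sequentially"
          using ev tendstoD[OF lim \<open>0 < e\<close>]
        proof eventually_elim
          case (elim n)
          then show ?case unfolding dist_real_def by arith
        qed
      qed
    qed
    then show "\<phi> \<sigma> + (\<integral>x. g x \<partial>\<alpha> \<sigma>) - (\<integral>x. A g x \<partial>\<beta> \<sigma>) \<le> b" by simp
  next
    fix g h :: "'a \<Rightarrow> real" and \<sigma> :: "'a measure" and e
    assume H: "g \<in> cont_funs" "h \<in> cont_funs" "\<sigma> \<in> prob_measures" and e: "\<And>x. \<bar>g x - h x\<bar> \<le> e"
    have "h x \<le> g x + e" "A g x \<le> A h x + e" for x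
      using e[of x] convex_operator_nonexpansive[OF A H(1,2) e, of x] by linarith+
    then have "(\<integral>x. h x \<partial>\<alpha> \<sigma>) \<le> (\<integral>x. g x \<partial>\<alpha> \<sigma>) + e" "(\<integral>x. A g x \<partial>\<beta> \<sigma>) \<le> (\<integral>x. A h x \<partial>\<beta> \<sigma>) + e"
      using H Ac \<alpha>P \<beta>P by (auto intro!: integral_le_add[OF compact_UNIV])
    then show "\<phi> \<sigma> + (\<integral>x. h x \<partial>\<alpha> \<sigma>) - (\<integral>x. A h x \<partial>\<beta> \<sigma>)
        \<le> \<phi> \<sigma> + (\<integral>x. g x \<partial>\<alpha> \<sigma>) - (\<integral>x. A g x \<partial>\<beta> \<sigma>) + 2 * e" by linarith
  }
qed (use ex that in auto)

section \<open>The weak-star topology and sequential convergence\<close>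

lemma continuous_map_weak_star_integral:
  fixes g :: "'a \<Rightarrow> real"
  assumes "g \<in> cont_funs"
  shows "continuous_map weak_star euclideanreal (\<lambda>\<mu>. \<integral>x. g x \<partial>\<mu>)"
  unfolding continuous_map_def
proof (intro conjI allI impI)
  fix U :: "real set" assume "openin euclideanreal U"
  then have "{\<mu> \<in> prob_measures. (\<integral>x. g x \<partial>\<mu>) \<in> U}
      \<in> {{\<mu> \<in> prob_measures. (\<integral>x. f x \<partial>\<mu>) \<in> U} | f U. f \<in> cont_funs \<and> open U}"
    using assms open_openin by blast
  then show "openin weak_star {\<mu> \<in> topspace weak_star. (\<integral>x. g x \<partial>\<mu>) \<in> U}"
    unfolding topspace_weak_star unfolding weak_star_def by (rule topology_generated_by_Basis)
qed auto

end

text \<open>Lets topological continuity of a transfer be used along sequences. The induction follows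
  the generation of open sets from the subbasis, where the claim is convergence of one
  integral.\<close>

lemma limitin_weak_star:
  assumes s: "\<And>n. s n \<in> prob_measures" and \<mu>: "\<mu> \<in> prob_measures" and w: "weakly_converges s \<mu>"
  shows "limitin weak_star s \<mu> sequentially"
  unfolding limitin_def
proof (intro conjI allI impI)
  show "\<mu> \<in> topspace weak_star" using \<mu> by (simp add: topspace_weak_star)
  fix U assume "openin weak_star U \<and> \<mu> \<in> U"
  then have "generate_topology_on {{\<mu> \<in> prob_measures. (\<integral>x. f x \<partial>\<mu>) \<in> U} | f U. f \<in> cont_funs \<and> open U} U"
      and "\<mu> \<in> U"
    unfolding weak_star_def by (auto simp: openin_topology_generated_by_iff)
  then show "eventually (\<lambda>n. s n \<in> U) sequentially"
  proof (induction rule: generate_topology_on.induct)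
    case (Int a b)
    then show ?case by (auto intro: eventually_conj)
  next
    case (UN K)
    then obtain k where "k \<in> K" "\<mu> \<in> k" by blast
    with UN have "eventually (\<lambda>n. s n \<in> k) sequentially" by blast
    then show ?case by eventually_elim (use \<open>k \<in> K\<close> in blast)
  next
    case (Basis B)
    then obtain f U where f: "f \<in> cont_funs" "open U" and B: "B = {\<mu> \<in> prob_measures. (\<integral>x. f x \<partial>\<mu>) \<in> U}"
      by blast
    have "(\<lambda>n. \<integral>x. f x \<partial>s n) \<longlonglongrightarrow> (\<integral>x. f x \<partial>\<mu>)" using w f(1) by (simp add: weakly_converges_def)
    then have "eventually (\<lambda>n. (\<integral>x. f x \<partial>s n) \<in> U) sequentially"
      using f(2) Basis(2) B by (intro topological_tendstoD) auto
    then show ?case using s by (simp add: B)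
  qed simp
qed

text \<open>The Kantorovich dual formula. As a supremum in the reals it carries meaning only when
  the differences are bounded above, which the locale \<open>coercive_operator\<close>
  ensures.\<close>

definition dual_transfer ::
    "(('a::metric_space \<Rightarrow> real) \<Rightarrow> ('a \<Rightarrow> real)) \<Rightarrow> 'a measure \<Rightarrow> 'a measure \<Rightarrow> real" where
  "dual_transfer A \<mu> \<nu> = (SUP g\<in>cont_funs. (\<integral>y. g y \<partial>\<nu>) - (\<integral>x. A g x \<partial>\<mu>))"

text \<open>The condition \<open>coercive\<close> is the bound on the differences in
  \<open>dual_transfer\<close> for Dirac masses; integrating it in each variable gives the bound for
  all pairs of measures.\<close>

locale coercive_operator =
  fixes A :: "('a::metric_space \<Rightarrow> real) \<Rightarrow> ('a \<Rightarrow> real)" and M :: real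
  assumes compact_UNIV: "compact (UNIV :: 'a set)"
    and convex_operator: "convex_operator A"
    and coercive: "\<And>g x y. g \<in> cont_funs \<Longrightarrow> g y \<le> A g x + M"
begin

lemmas op_cont = convex_operator_cont[OF convex_operator]

lemma difference_le:
  assumes g: "g \<in> cont_funs" and P: "\<mu> \<in> prob_measures" "\<nu> \<in> prob_measures"
  shows "(\<integral>y. g y \<partial>\<nu>) - (\<integral>x. A g x \<partial>\<mu>) \<le> M"
proof -
  have "(\<integral>x. g y \<partial>\<mu>) \<le> (\<integral>x. A g x \<partial>\<mu>) + M" for y
    using coercive[OF g] by (intro integral_le_add[OF compact_UNIV] op_cont g P cont_funs_const)
  then have "g y \<le> (\<integral>x. A g x \<partial>\<mu>) + M" for y by (simp only: integral_const_prob[OF P(1)])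
  then have "(\<integral>y. g y \<partial>\<nu>) \<le> (\<integral>y. (\<integral>x. A g x \<partial>\<mu>) \<partial>\<nu>) + M"
    by (intro integral_le_add[OF compact_UNIV] g P cont_funs_const)
  then show ?thesis unfolding integral_const_prob[OF P(2)] by simp
qed

lemma dual_transfer_ge:
  assumes "g \<in> cont_funs" "\<mu> \<in> prob_measures" "\<nu> \<in> prob_measures"
  shows "(\<integral>y. g y \<partial>\<nu>) - (\<integral>x. A g x \<partial>\<mu>) \<le> dual_transfer A \<mu> \<nu>"
  unfolding dual_transfer_def
  by (rule cSUP_upper[OF assms(1)], rule bdd_aboveI2[of _ _ M]) (rule difference_le[OF _ assms(2,3)])

lemma dual_transfer_least:
  assumes "\<And>g. g \<in> cont_funs \<Longrightarrow> (\<integral>y. g y \<partial>\<nu>) - (\<integral>x. A g x \<partial>\<mu>) \<le> b"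
  shows "dual_transfer A \<mu> \<nu> \<le> b"
  unfolding dual_transfer_def using assms cont_funs_const by (intro cSUP_least) blast+

lemma less_dual_transfer:
  assumes "b < dual_transfer A \<mu> \<nu>"
  obtains g where "g \<in> cont_funs" "b < (\<integral>y. g y \<partial>\<nu>) - (\<integral>x. A g x \<partial>\<mu>)"
  using dual_transfer_least[of \<nu> \<mu> b] assms by (meson not_le)

lemma dual_transfer_convex:
  assumes P: "\<mu>1 \<in> prob_measures" "\<mu>2 \<in> prob_measures" "\<nu>1 \<in> prob_measures" "\<nu>2 \<in> prob_measures"
    and t: "0 \<le> t" "t \<le> 1"
  shows "dual_transfer A (mixture t \<mu>1 \<mu>2) (mixture t \<nu>1 \<nu>2)
    \<le> t * dual_transfer A \<mu>1 \<nu>1 + (1 - t) * dual_transfer A \<mu>2 \<nu>2"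
proof (rule dual_transfer_least)
  fix g :: "'a \<Rightarrow> real" assume g: "g \<in> cont_funs"
  have "(\<integral>y. g y \<partial>mixture t \<nu>1 \<nu>2) - (\<integral>x. A g x \<partial>mixture t \<mu>1 \<mu>2)
      = t * ((\<integral>y. g y \<partial>\<nu>1) - (\<integral>x. A g x \<partial>\<mu>1)) + (1 - t) * ((\<integral>y. g y \<partial>\<nu>2) - (\<integral>x. A g x \<partial>\<mu>2))"
    by (simp add: integral_mixture[OF compact_UNIV] g op_cont P t algebra_simps)
  also have "\<dots> \<le> t * dual_transfer A \<mu>1 \<nu>1 + (1 - t) * dual_transfer A \<mu>2 \<nu>2"
    using t by (intro add_mono mult_left_mono dual_transfer_ge g P) auto
  finally show "(\<integral>y. g y \<partial>mixture t \<nu>1 \<nu>2) - (\<integral>x. A g x \<partial>mixture t \<mu>1 \<mu>2)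
      \<le> t * dual_transfer A \<mu>1 \<nu>1 + (1 - t) * dual_transfer A \<mu>2 \<nu>2" .
qed

lemma dual_transfer_convex2:
  assumes P: "\<mu> \<in> prob_measures" "\<nu>1 \<in> prob_measures" "\<nu>2 \<in> prob_measures" and t: "0 \<le> t" "t \<le> 1"
  shows "dual_transfer A \<mu> (mixture t \<nu>1 \<nu>2)
    \<le> t * dual_transfer A \<mu> \<nu>1 + (1 - t) * dual_transfer A \<mu> \<nu>2"
proof (rule dual_transfer_least)
  fix g :: "'a \<Rightarrow> real" assume g: "g \<in> cont_funs"
  have "(\<integral>y. g y \<partial>mixture t \<nu>1 \<nu>2) - (\<integral>x. A g x \<partial>\<mu>)
      = t * ((\<integral>y. g y \<partial>\<nu>1) - (\<integral>x. A g x \<partial>\<mu>)) + (1 - t) * ((\<integral>y. g y \<partial>\<nu>2) - (\<integral>x. A g x \<partial>\<mu>))"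
    by (simp add: integral_mixture[OF compact_UNIV] g P t algebra_simps)
  also have "\<dots> \<le> t * dual_transfer A \<mu> \<nu>1 + (1 - t) * dual_transfer A \<mu> \<nu>2"
    using t by (intro add_mono mult_left_mono dual_transfer_ge g P) auto
  finally show "(\<integral>y. g y \<partial>mixture t \<nu>1 \<nu>2) - (\<integral>x. A g x \<partial>\<mu>)
      \<le> t * dual_transfer A \<mu> \<nu>1 + (1 - t) * dual_transfer A \<mu> \<nu>2" .
qed

lemma dual_transfer_seq_lsc:
  assumes s: "\<And>n. s n \<in> prob_measures" and P: "\<mu> \<in> prob_measures" "\<nu> \<in> prob_measures"
    and w: "weakly_converges s \<nu>"
    and ev: "eventually (\<lambda>n. dual_transfer A \<mu> (s n) \<le> b) sequentially"
  shows "dual_transfer A \<mu> \<nu> \<le> b"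
proof (rule dual_transfer_least)
  fix g :: "'a \<Rightarrow> real" assume g: "g \<in> cont_funs"
  show "(\<integral>y. g y \<partial>\<nu>) - (\<integral>x. A g x \<partial>\<mu>) \<le> b"
  proof (rule tendsto_upperbound)
    show "(\<lambda>n. (\<integral>y. g y \<partial>s n) - (\<integral>x. A g x \<partial>\<mu>)) \<longlonglongrightarrow> (\<integral>y. g y \<partial>\<nu>) - (\<integral>x. A g x \<partial>\<mu>)"
      using w g by (intro tendsto_intros) (simp add: weakly_converges_def)
    show "eventually (\<lambda>n. (\<integral>y. g y \<partial>s n) - (\<integral>x. A g x \<partial>\<mu>) \<le> b) sequentially"
      using ev by eventually_elim (use dual_transfer_ge[OF g P(1) s] order_trans in blast)
  qed simp
qed

text \<open>The hard half of biconjugation. If it failed, minimax would produce one \<open>h\<close>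
  that refutes all \<nu> at once. Dirac masses turn this into a pointwise comparison of
  \<open>g\<close> with \<open>h\<close> plus a constant, and applying the monotone \<open>A\<close>
  contradicts the choice of \<open>b\<close>.\<close>

lemma legendre_dual_transfer_approx:
  assumes \<mu>: "\<mu> \<in> prob_measures" and g: "g \<in> cont_funs" and b: "b < (\<integral>x. A g x \<partial>\<mu>)"
  shows "\<exists>\<nu>\<in>prob_measures. b < (\<integral>y. g y \<partial>\<nu>) - dual_transfer A \<mu> \<nu>"
proof (rule ccontr)
  assume neg: "\<not> ?thesis"
  \<comment> \<open>The intermediate value provides the strict inequality that minimax asks for,
    while still lying below the integral to be contradicted.\<close>
  obtain b' where b': "b < b'" "b' < (\<integral>x. A g x \<partial>\<mu>)" using b dense by blast
  obtain h where h: "h \<in> cont_funs" "\<And>\<nu>. \<nu> \<in> prob_measures \<Longrightarrow>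
      - b' \<le> - (\<integral>y. g y \<partial>\<nu>) + (\<integral>y. h y \<partial>\<nu>) - (\<integral>x. A h x \<partial>\<mu>)"
  proof (rule operator_minimax[OF compact_UNIV convex_operator affine_continuous_ident[OF compact_UNIV]
        affine_continuous_const[OF \<mu>], of "\<lambda>\<nu>. - (\<integral>y. g y \<partial>\<nu>)" "-b'"])
    fix \<sigma> \<tau> :: "'a measure" and t :: real
    assume "\<sigma> \<in> prob_measures" "\<tau> \<in> prob_measures" "0 \<le> t" "t \<le> 1"
    then show "- (\<integral>y. g y \<partial>mixture t \<sigma> \<tau>) \<le> t * - (\<integral>y. g y \<partial>\<sigma>) + (1 - t) * - (\<integral>y. g y \<partial>\<tau>)"
      by (simp add: integral_mixture[OF compact_UNIV g])
  next
    fix s and \<sigma> :: "'a measure" and b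
    assume "weakly_converges s \<sigma>" and ev: "eventually (\<lambda>n. - (\<integral>y. g y \<partial>s n) \<le> b) sequentially"
    then have "(\<lambda>n. - (\<integral>y. g y \<partial>s n)) \<longlonglongrightarrow> - (\<integral>y. g y \<partial>\<sigma>)"
      using g by (intro tendsto_minus) (simp add: weakly_converges_def)
    then show "- (\<integral>y. g y \<partial>\<sigma>) \<le> b" using ev by (rule tendsto_upperbound) simp
  next
    fix \<nu> :: "'a measure" assume \<nu>: "\<nu> \<in> prob_measures"
    then have "(\<integral>y. g y \<partial>\<nu>) - b' < dual_transfer A \<mu> \<nu>" using neg b'(1) by force
    then obtain h where "h \<in> cont_funs" "(\<integral>y. g y \<partial>\<nu>) - b' < (\<integral>y. h y \<partial>\<nu>) - (\<integral>x. A h x \<partial>\<mu>)"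
      by (rule less_dual_transfer)
    then show "\<exists>h\<in>cont_funs. - b' < - (\<integral>y. g y \<partial>\<nu>) + (\<integral>y. h y \<partial>\<nu>) - (\<integral>x. A h x \<partial>\<mu>)"
      by (intro bexI[of _ h]) auto
  next
    fix h assume "h \<in> cont_funs" "\<And>\<nu>. \<nu> \<in> prob_measures \<Longrightarrow>
      - b' \<le> - (\<integral>y. g y \<partial>\<nu>) + (\<integral>y. h y \<partial>\<nu>) - (\<integral>x. A h x \<partial>\<mu>)"
    then show thesis by (rule that)
  qed
  have "g y \<le> h y + (b' - (\<integral>x. A h x \<partial>\<mu>))" for y
    using h(2)[OF return_in_prob_measures, of y] g h(1) by simp
  then have "A g x \<le> A h x + (b' - (\<integral>x. A h x \<partial>\<mu>))" for x
    by (rule convex_operator_mono_add[OF convex_operator g h(1)])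
  then have "(\<integral>x. A g x \<partial>\<mu>) \<le> (\<integral>x. A h x \<partial>\<mu>) + (b' - (\<integral>x. A h x \<partial>\<mu>))"
    by (rule integral_le_add[OF compact_UNIV op_cont[OF h(1)] op_cont[OF g] \<mu>])
  then show False using b'(2) by simp
qed

lemma legendre_dual_transfer:
  assumes \<mu>: "\<mu> \<in> prob_measures" and g: "g \<in> cont_funs"
  shows "legendre (\<lambda>\<mu> \<nu>. ereal (dual_transfer A \<mu> \<nu>)) \<mu> g = ereal (\<integral>x. A g x \<partial>\<mu>)"
  unfolding legendre_def
proof (rule antisym)
  show "(SUP \<nu>\<in>prob_measures. ereal (\<integral>y. g y \<partial>\<nu>) - ereal (dual_transfer A \<mu> \<nu>)) \<le> ereal (\<integral>x. A g x \<partial>\<mu>)"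
    using dual_transfer_ge[OF g \<mu>] by (intro SUP_least) (simp add: algebra_simps)
  show "ereal (\<integral>x. A g x \<partial>\<mu>) \<le> (SUP \<nu>\<in>prob_measures. ereal (\<integral>y. g y \<partial>\<nu>) - ereal (dual_transfer A \<mu> \<nu>))"
    unfolding le_SUP_iff
  proof (intro allI impI)
    fix y assume y: "y < ereal (\<integral>x. A g x \<partial>\<mu>)"
    then obtain b where b: "y < ereal b" "b < (\<integral>x. A g x \<partial>\<mu>)"
      using ereal_dense2[OF y] by auto
    obtain \<nu> where "\<nu> \<in> prob_measures" "b < (\<integral>y. g y \<partial>\<nu>) - dual_transfer A \<mu> \<nu>"
      using legendre_dual_transfer_approx[OF \<mu> g b(2)] by blast
    then show "\<exists>\<nu>\<in>prob_measures. y < ereal (\<integral>y. g y \<partial>\<nu>) - ereal (dual_transfer A \<mu> \<nu>)"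
      using b(1) by (intro bexI[of _ \<nu>]) (auto intro: less_trans)
  qed
qed

lemma backward_kantorovich_operator_dual:
  "backward_kantorovich_operator (\<lambda>\<mu> \<nu>. ereal (dual_transfer A \<mu> \<nu>)) A"
  unfolding backward_kantorovich_operator_def
proof (intro conjI ballI)
  fix g :: "'a \<Rightarrow> real" assume g: "g \<in> cont_funs"
  have "open {x. a < A g x}" for a
    using op_cont[OF g] by (intro open_Collect_less) (auto simp: cont_funs_def)
  then show "A g \<in> lsc_funs" by (simp add: lsc_funs_def lsc_map_def open_openin[symmetric])
  fix \<mu> assume "\<mu> \<in> transfer_domain1 (\<lambda>\<mu> \<nu>. ereal (dual_transfer A \<mu> \<nu>))"
  then have \<mu>: "\<mu> \<in> prob_measures" by (simp add: transfer_domain1_def)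
  show "integrable \<mu> (A g)" by (rule cont_funs_integrable[OF compact_UNIV op_cont[OF g] \<mu>])
  show "legendre (\<lambda>\<mu> \<nu>. ereal (dual_transfer A \<mu> \<nu>)) \<mu> g = ereal (\<integral>x. A g x \<partial>\<mu>)"
    by (rule legendre_dual_transfer[OF \<mu> g])
qed

text \<open>A supremum of functionals that are affine and weak-star continuous in the pair of
  measures is convex and lower semicontinuous: each superlevel set is a union of open sets over
  \<open>g\<close>. The lower bound comes from testing with the zero function.\<close>

lemma backward_linear_transfer_dual:
  "backward_linear_transfer (\<lambda>\<mu> \<nu>. ereal (dual_transfer A \<mu> \<nu>))"
  unfolding backward_linear_transfer_def
proof (intro conjI)
  show "\<exists>\<mu>\<in>prob_measures. \<exists>\<nu>\<in>prob_measures. ereal (dual_transfer A \<mu> \<nu>) < \<infinity>"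
    by (intro bexI[of _ "return borel undefined"]) auto
  show "\<exists>m. \<forall>\<mu>\<in>prob_measures. \<forall>\<nu>\<in>prob_measures. ereal m \<le> ereal (dual_transfer A \<mu> \<nu>)"
  proof -
    obtain B where "\<And>x. \<bar>A (\<lambda>_. 0) x\<bar> \<le> B"
      using cont_funs_bounded[OF compact_UNIV op_cont[OF cont_funs_const]] by blast
    then have "A (\<lambda>_. 0) x \<le> 0 + B" for x by (metis abs_le_D1 add_0)
    then have "(\<integral>x. A (\<lambda>_. 0) x \<partial>\<mu>) \<le> (\<integral>x. 0 \<partial>\<mu>) + B" if "\<mu> \<in> prob_measures" for \<mu> :: "'a measure"
      by (rule integral_le_add[OF compact_UNIV cont_funs_const op_cont[OF cont_funs_const] that])
    then have "- B \<le> dual_transfer A \<mu> \<nu>" if "\<mu> \<in> prob_measures" "\<nu> \<in> prob_measures" for \<mu> \<nu>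
      using dual_transfer_ge[OF cont_funs_const that, of 0] that by force
    then show ?thesis by (intro exI[of _ "-B"]) auto
  qed
  show "jointly_convex (\<lambda>\<mu> \<nu>. ereal (dual_transfer A \<mu> \<nu>))"
    unfolding jointly_convex_def using dual_transfer_convex by auto
  show "lsc_map (prod_topology weak_star weak_star) (\<lambda>(\<mu>, \<nu>). ereal (dual_transfer A \<mu> \<nu>))"
    unfolding lsc_map_def
  proof
    fix a :: ereal
    let ?X = "prod_topology weak_star weak_star :: ('a measure \<times> 'a measure) topology"
    let ?U = "\<lambda>g. {p \<in> topspace ?X. (\<integral>y. g y \<partial>snd p) - (\<integral>x. A g x \<partial>fst p) \<in> {r. a < ereal r}}"
    have "openin ?X (?U g)" if g: "g \<in> cont_funs" for g
    proof (rule openin_continuous_map_preimage)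
      show "continuous_map ?X euclideanreal (\<lambda>p. (\<integral>y. g y \<partial>snd p) - (\<integral>x. A g x \<partial>fst p))"
        using continuous_map_compose[OF continuous_map_snd continuous_map_weak_star_integral[OF compact_UNIV g], of weak_star]
          continuous_map_compose[OF continuous_map_fst continuous_map_weak_star_integral[OF compact_UNIV op_cont[OF g]], of weak_star]
        by (intro continuous_map_diff) (simp_all add: comp_def)
      have "open {r. a < ereal r}" by (intro open_Collect_less continuous_intros continuous_on_ereal)
      then show "openin euclideanreal {r. a < ereal r}" by (simp add: open_openin[symmetric])
    qed
    then have "openin ?X (\<Union>g\<in>cont_funs. ?U g)" by blast
    moreover have "{x \<in> topspace ?X. a < (case x of (\<mu>, \<nu>) \<Rightarrow> ereal (dual_transfer A \<mu> \<nu>))}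
        = (\<Union>g\<in>cont_funs. ?U g)"
    proof (intro set_eqI iffI)
      fix p assume "p \<in> {x \<in> topspace ?X. a < (case x of (\<mu>, \<nu>) \<Rightarrow> ereal (dual_transfer A \<mu> \<nu>))}"
      then obtain \<mu> \<nu> where p: "p = (\<mu>, \<nu>)" "p \<in> topspace ?X" and "a < ereal (dual_transfer A \<mu> \<nu>)"
        by (cases p) auto
      then obtain b where b: "a < ereal b" "b < dual_transfer A \<mu> \<nu>" using ereal_dense2 by force
      from b(2) obtain g where "g \<in> cont_funs" "b < (\<integral>y. g y \<partial>\<nu>) - (\<integral>x. A g x \<partial>\<mu>)"
        by (rule less_dual_transfer)
      moreover from this b have "a < ereal ((\<integral>y. g y \<partial>\<nu>) - (\<integral>x. A g x \<partial>\<mu>))"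
        by (meson ereal_less_le less_trans less_ereal.simps(1))
      ultimately show "p \<in> (\<Union>g\<in>cont_funs. ?U g)" using p by auto
    next
      fix p assume "p \<in> (\<Union>g\<in>cont_funs. ?U g)"
      then obtain g where g: "g \<in> cont_funs" "p \<in> topspace ?X"
          "a < ereal ((\<integral>y. g y \<partial>snd p) - (\<integral>x. A g x \<partial>fst p))" by auto
      have "fst p \<in> prob_measures" "snd p \<in> prob_measures" using g(2) by (auto simp: topspace_weak_star)
      then have "ereal ((\<integral>y. g y \<partial>snd p) - (\<integral>x. A g x \<partial>fst p)) \<le> ereal (dual_transfer A (fst p) (snd p))"
        using dual_transfer_ge[OF g(1)] by simp
      with g(3) have "a < ereal (dual_transfer A (fst p) (snd p))" by (rule less_le_trans)
      then show "p \<in> {x \<in> topspace ?X. a < (case x of (\<mu>, \<nu>) \<Rightarrow> ereal (dual_transfer A \<mu> \<nu>))}"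
        using g(2) by (simp add: case_prod_beta)
    qed
    ultimately show "openin ?X {x \<in> topspace ?X. a < (case x of (\<mu>, \<nu>) \<Rightarrow> ereal (dual_transfer A \<mu> \<nu>))}"
      by simp
  qed
  show "\<exists>K. backward_kantorovich_operator (\<lambda>\<mu> \<nu>. ereal (dual_transfer A \<mu> \<nu>)) K"
    using backward_kantorovich_operator_dual by blast
qed

text \<open>Exchanging infimum and supremum turns \<open>S \<star> dual_transfer A\<close> into the transfer that is dual to
  the composition \<open>B \<circ> A\<close>, where \<open>B\<close> is the operator of \<open>S\<close>.\<close>

lemma inf_convolution_dual_transfer:
  assumes P: "\<mu> \<in> prob_measures" "\<nu> \<in> prob_measures"
    and cvx: "\<And>\<sigma> \<tau> t. \<sigma> \<in> prob_measures \<Longrightarrow> \<tau> \<in> prob_measures \<Longrightarrow> 0 \<le> t \<Longrightarrow> t \<le> 1 \<Longrightarrow>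
        S \<mu> (mixture t \<sigma> \<tau>) \<le> t * S \<mu> \<sigma> + (1 - t) * S \<mu> \<tau>"
    and lsc: "\<And>s \<sigma> b. (\<And>n. s n \<in> prob_measures) \<Longrightarrow> \<sigma> \<in> prob_measures \<Longrightarrow> weakly_converges s \<sigma> \<Longrightarrow>
        eventually (\<lambda>n. S \<mu> (s n) \<le> b) sequentially \<Longrightarrow> S \<mu> \<sigma> \<le> b"
    and le: "\<And>h \<sigma>. h \<in> cont_funs \<Longrightarrow> \<sigma> \<in> prob_measures \<Longrightarrow> (\<integral>x. h x \<partial>\<sigma>) - S \<mu> \<sigma> \<le> (\<integral>x. B h x \<partial>\<mu>)"
    and approx: "\<And>h b. h \<in> cont_funs \<Longrightarrow> b < (\<integral>x. B h x \<partial>\<mu>) \<Longrightarrow>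
        \<exists>\<sigma>\<in>prob_measures. b < (\<integral>x. h x \<partial>\<sigma>) - S \<mu> \<sigma>"
    and BA: "\<And>g. g \<in> cont_funs \<Longrightarrow> B (A g) = A g"
  shows "inf_convolution (\<lambda>\<mu> \<nu>. ereal (S \<mu> \<nu>)) (\<lambda>\<mu> \<nu>. ereal (dual_transfer A \<mu> \<nu>)) \<mu> \<nu>
    = ereal (dual_transfer A \<mu> \<nu>)"
  unfolding inf_convolution_def
proof (rule antisym)
  \<comment> \<open>The easy half: insert the integral of \<open>A g\<close> against \<sigma>. Its
    excess over \<open>S\<close> is bounded by the integral of \<open>B (A g)\<close>, which is
    \<open>A g\<close> again.\<close>
  have "dual_transfer A \<mu> \<nu> \<le> S \<mu> \<sigma> + dual_transfer A \<sigma> \<nu>" if \<sigma>: "\<sigma> \<in> prob_measures" for \<sigma>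
  proof (rule dual_transfer_least)
    fix g :: "'a \<Rightarrow> real" assume g: "g \<in> cont_funs"
    show "(\<integral>y. g y \<partial>\<nu>) - (\<integral>x. A g x \<partial>\<mu>) \<le> S \<mu> \<sigma> + dual_transfer A \<sigma> \<nu>"
      using le[OF op_cont[OF g] \<sigma>] dual_transfer_ge[OF g \<sigma> P(2)] by (simp add: BA[OF g])
  qed
  then show "ereal (dual_transfer A \<mu> \<nu>)
      \<le> (INF \<sigma>\<in>prob_measures. ereal (S \<mu> \<sigma>) + ereal (dual_transfer A \<sigma> \<nu>))"
    by (intro INF_greatest) simp
  show "(INF \<sigma>\<in>prob_measures. ereal (S \<mu> \<sigma>) + ereal (dual_transfer A \<sigma> \<nu>))
      \<le> ereal (dual_transfer A \<mu> \<nu>)"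
  proof (rule ccontr)
    assume "\<not> ?thesis"
    then obtain a where a: "dual_transfer A \<mu> \<nu> < a"
        "ereal a < (INF \<sigma>\<in>prob_measures. ereal (S \<mu> \<sigma>) + ereal (dual_transfer A \<sigma> \<nu>))"
      using ereal_dense2 by (force simp: not_le)
    have lt: "a < S \<mu> \<sigma> + dual_transfer A \<sigma> \<nu>" if "\<sigma> \<in> prob_measures" for \<sigma>
      using less_INF_D[OF a(2) that] by simp
    obtain g where g: "g \<in> cont_funs" "\<And>\<sigma>. \<sigma> \<in> prob_measures \<Longrightarrow>
        a \<le> S \<mu> \<sigma> + (\<integral>y. g y \<partial>\<nu>) - (\<integral>x. A g x \<partial>\<sigma>)"
    proof (rule operator_minimax[OF compact_UNIV convex_operator affine_continuous_const[OF P(2)]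
          affine_continuous_ident[OF compact_UNIV], of "S \<mu>" a])
      fix \<sigma> :: "'a measure" assume "\<sigma> \<in> prob_measures"
      then have "a - S \<mu> \<sigma> < dual_transfer A \<sigma> \<nu>" using lt by fastforce
      then obtain g where "g \<in> cont_funs" "a - S \<mu> \<sigma> < (\<integral>y. g y \<partial>\<nu>) - (\<integral>x. A g x \<partial>\<sigma>)"
        by (rule less_dual_transfer)
      then show "\<exists>g\<in>cont_funs. a < S \<mu> \<sigma> + (\<integral>y. g y \<partial>\<nu>) - (\<integral>x. A g x \<partial>\<sigma>)"
        by (intro bexI[of _ g]) auto
    next
      fix g assume "g \<in> cont_funs" "\<And>\<sigma>. \<sigma> \<in> prob_measures \<Longrightarrow>
        a \<le> S \<mu> \<sigma> + (\<integral>y. g y \<partial>\<nu>) - (\<integral>x. A g x \<partial>\<sigma>)"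
      then show thesis by (rule that)
    next
      fix \<sigma> \<tau> :: "'a measure" and t :: real
      assume "\<sigma> \<in> prob_measures" "\<tau> \<in> prob_measures" "0 \<le> t" "t \<le> 1"
      then show "S \<mu> (mixture t \<sigma> \<tau>) \<le> t * S \<mu> \<sigma> + (1 - t) * S \<mu> \<tau>" by (rule cvx)
    next
      fix s and \<sigma> :: "'a measure" and b
      assume "\<And>n. s n \<in> prob_measures" "\<sigma> \<in> prob_measures" "weakly_converges s \<sigma>"
        "eventually (\<lambda>n. S \<mu> (s n) \<le> b) sequentially"
      then show "S \<mu> \<sigma> \<le> b" by (rule lsc)
    qed
    \<comment> \<open>The bound on \<open>g\<close> holds for every \<sigma>. Choosing \<sigma>
      nearly optimal in the Legendre formula for \<open>B\<close> at \<open>A g\<close> eliminates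
      it, and \<open>B (A g) = A g\<close> removes \<open>B\<close>.\<close>
    have "a \<le> (\<integral>y. g y \<partial>\<nu>) - (\<integral>x. A g x \<partial>\<mu>)"
    proof (rule ccontr)
      assume "\<not> ?thesis"
      then have "(\<integral>y. g y \<partial>\<nu>) - a < (\<integral>x. B (A g) x \<partial>\<mu>)" by (simp add: BA[OF g(1)])
      then obtain \<sigma> where "\<sigma> \<in> prob_measures" "(\<integral>y. g y \<partial>\<nu>) - a < (\<integral>x. A g x \<partial>\<sigma>) - S \<mu> \<sigma>"
        using approx[OF op_cont[OF g(1)]] by blast
      then show False using g(2)[of \<sigma>] by simp
    qed
    then show False using dual_transfer_ge[OF g(1) P] a(1) by simp
  qed
qed

lemma inf_convolution_dual_transfer_self:
  assumes P: "\<mu> \<in> prob_measures" "\<nu> \<in> prob_measures"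
    and "\<And>g. g \<in> cont_funs \<Longrightarrow> A (A g) = A g"
  shows "inf_convolution (\<lambda>\<mu> \<nu>. ereal (dual_transfer A \<mu> \<nu>)) (\<lambda>\<mu> \<nu>. ereal (dual_transfer A \<mu> \<nu>)) \<mu> \<nu>
    = ereal (dual_transfer A \<mu> \<nu>)"
proof (rule inf_convolution_dual_transfer[OF P, where B = A])
  show "(\<integral>x. h x \<partial>\<sigma>) - dual_transfer A \<mu> \<sigma> \<le> (\<integral>x. A h x \<partial>\<mu>)"
    if "h \<in> cont_funs" "\<sigma> \<in> prob_measures" for h \<sigma>
    using dual_transfer_ge[OF that(1) P(1) that(2)] by simp
next
  fix s and \<sigma> :: "'a measure" and b
  assume "\<And>n. s n \<in> prob_measures" "\<sigma> \<in> prob_measures" "weakly_converges s \<sigma>"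
    "eventually (\<lambda>n. dual_transfer A \<mu> (s n) \<le> b) sequentially"
  then show "dual_transfer A \<mu> \<sigma> \<le> b" by (intro dual_transfer_seq_lsc[of s \<mu> \<sigma>] P)
qed (use assms dual_transfer_convex2 legendre_dual_transfer_approx in auto)

end

subsection \<open>Continuous transfers\<close>

lemma weakly_converges_subseq:
  assumes "weakly_converges s \<mu>" "strict_mono r"
  shows "weakly_converges (\<lambda>n. s (r n)) \<mu>"
  using assms(1) LIMSEQ_subseq_LIMSEQ[OF _ assms(2)]
  unfolding weakly_converges_def comp_def by blast

text \<open>The given transfer with real values: \<open>K_ge\<close> and \<open>K_approx\<close> are
  the two halves of its Legendre identity, and weak-star continuity is expressed along
  sequences.\<close>

locale continuous_transfer =
  fixes T :: "'a::metric_space measure \<Rightarrow> 'a measure \<Rightarrow> real"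
    and K :: "('a \<Rightarrow> real) \<Rightarrow> ('a \<Rightarrow> real)"
  assumes compact_UNIV: "compact (UNIV :: 'a set)"
    and K_cont: "\<And>f. f \<in> cont_funs \<Longrightarrow> K f \<in> cont_funs"
    and K_ge: "\<And>\<mu> \<nu> g. \<mu> \<in> prob_measures \<Longrightarrow> \<nu> \<in> prob_measures \<Longrightarrow> g \<in> cont_funs \<Longrightarrow>
        (\<integral>y. g y \<partial>\<nu>) - T \<mu> \<nu> \<le> (\<integral>x. K g x \<partial>\<mu>)"
    and K_approx: "\<And>\<mu> g b. \<mu> \<in> prob_measures \<Longrightarrow> g \<in> cont_funs \<Longrightarrow> b < (\<integral>x. K g x \<partial>\<mu>) \<Longrightarrow>
        \<exists>\<nu>\<in>prob_measures. b < (\<integral>y. g y \<partial>\<nu>) - T \<mu> \<nu>"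
    and T_convex: "\<And>\<mu>1 \<mu>2 \<nu>1 \<nu>2 t. \<mu>1 \<in> prob_measures \<Longrightarrow> \<mu>2 \<in> prob_measures \<Longrightarrow>
        \<nu>1 \<in> prob_measures \<Longrightarrow> \<nu>2 \<in> prob_measures \<Longrightarrow> 0 \<le> t \<Longrightarrow> t \<le> 1 \<Longrightarrow>
        T (mixture t \<mu>1 \<mu>2) (mixture t \<nu>1 \<nu>2) \<le> t * T \<mu>1 \<nu>1 + (1 - t) * T \<mu>2 \<nu>2"
    and T_tendsto: "\<And>s u \<mu> \<nu>. (\<And>n. s n \<in> prob_measures) \<Longrightarrow> (\<And>n. u n \<in> prob_measures) \<Longrightarrow>
        \<mu> \<in> prob_measures \<Longrightarrow> \<nu> \<in> prob_measures \<Longrightarrow> weakly_converges s \<mu> \<Longrightarrow>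
        weakly_converges u \<nu> \<Longrightarrow> (\<lambda>n. T (s n) (u n)) \<longlonglongrightarrow> T \<mu> \<nu>"
begin

lemma mixture_self:
  assumes "\<mu> \<in> prob_measures" "0 \<le> t" "t \<le> 1" shows "mixture t \<mu> \<mu> = \<mu>"
proof (rule measure_eqI)
  fix A assume "A \<in> sets (mixture t \<mu> \<mu>)"
  then have "emeasure (mixture t \<mu> \<mu>) A = (ennreal t + ennreal (1 - t)) * emeasure \<mu> A"
    by (simp add: emeasure_mixture distrib_right)
  also have "ennreal t + ennreal (1 - t) = 1" using assms(2,3) by (simp flip: ennreal_plus)
  finally show "emeasure (mixture t \<mu> \<mu>) A = emeasure \<mu> A" by simp
qed simp

lemma T_convex2:
  assumes "\<mu> \<in> prob_measures" "\<sigma> \<in> prob_measures" "\<tau> \<in> prob_measures" "0 \<le> t" "t \<le> 1"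
  shows "T \<mu> (mixture t \<sigma> \<tau>) \<le> t * T \<mu> \<sigma> + (1 - t) * T \<mu> \<tau>"
  using T_convex[OF assms(1,1,2,3,4,5)] mixture_self[OF assms(1,4,5)] by simp

lemma weakly_converges_const: "weakly_converges (\<lambda>_. \<mu>) \<mu>"
  by (simp add: weakly_converges_def)

lemma T_seq_lsc:
  assumes "\<mu> \<in> prob_measures" "\<And>n. s n \<in> prob_measures" "\<sigma> \<in> prob_measures" "weakly_converges s \<sigma>"
    and "eventually (\<lambda>n. T \<mu> (s n) \<le> b) sequentially"
  shows "T \<mu> \<sigma> \<le> b"
  using T_tendsto[of "\<lambda>_. \<mu>" s, OF assms(1,2,1,3) weakly_converges_const assms(4)] assms(5)
  by (rule tendsto_upperbound) simp

lemma convergent_subsequence_pair: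
  fixes s u :: "nat \<Rightarrow> 'a measure"
  assumes "\<And>n. s n \<in> prob_measures" "\<And>n. u n \<in> prob_measures"
  obtains r \<mu> \<nu> where "strict_mono (r :: nat \<Rightarrow> nat)" "\<mu> \<in> prob_measures" "\<nu> \<in> prob_measures"
    "weakly_converges (\<lambda>n. s (r n)) \<mu>" "weakly_converges (\<lambda>n. u (r n)) \<nu>"
proof -
  obtain r \<mu> where r: "strict_mono r" "\<mu> \<in> prob_measures" "weakly_converges (\<lambda>n. s (r n)) \<mu>"
    by (rule prob_measures_seq_compact[OF compact_UNIV, of s, OF assms(1)])
  obtain q \<nu> where q: "strict_mono q" "\<nu> \<in> prob_measures" "weakly_converges (\<lambda>n. u (r (q n))) \<nu>"
    by (rule prob_measures_seq_compact[OF compact_UNIV, of "\<lambda>n. u (r n)", OF assms(2)])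
  have "strict_mono (\<lambda>n. r (q n))" using strict_mono_o[OF r(1) q(1)] by (simp add: comp_def)
  moreover have "weakly_converges (\<lambda>n. s (r (q n))) \<mu>" by (rule weakly_converges_subseq[OF r(3) q(1)])
  ultimately show thesis using that[of "\<lambda>n. r (q n)"] r(2) q(2,3) by blast
qed

lemma T_bounded:
  obtains M where "0 \<le> M" "\<And>\<mu> \<nu>. \<mu> \<in> prob_measures \<Longrightarrow> \<nu> \<in> prob_measures \<Longrightarrow> \<bar>T \<mu> \<nu>\<bar> \<le> M"
proof -
  have "\<exists>M::nat. \<forall>\<mu>\<in>prob_measures. \<forall>\<nu>\<in>prob_measures. \<bar>T \<mu> \<nu>\<bar> \<le> M"
  proof (rule ccontr)
    assume "\<not> ?thesis"
    then have "\<forall>n::nat. \<exists>\<mu> \<nu>. \<mu> \<in> prob_measures \<and> \<nu> \<in> prob_measures \<and> real n < \<bar>T \<mu> \<nu>\<bar>"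
      by (metis not_le)
    then obtain s u where su: "\<And>n. s n \<in> prob_measures" "\<And>n. u n \<in> prob_measures"
        "\<And>n::nat. real n < \<bar>T (s n) (u n)\<bar>" by metis
    obtain r \<mu> \<nu> where r: "strict_mono (r :: nat \<Rightarrow> nat)" and P: "\<mu> \<in> prob_measures" "\<nu> \<in> prob_measures"
      and w: "weakly_converges (\<lambda>n. s (r n)) \<mu>" "weakly_converges (\<lambda>n. u (r n)) \<nu>"
      by (rule convergent_subsequence_pair[of s u, OF su(1,2)])
    have "(\<lambda>n. T (s (r n)) (u (r n))) \<longlonglongrightarrow> T \<mu> \<nu>" by (rule T_tendsto[OF su(1,2) P w])
    then have "Bseq (\<lambda>n. T (s (r n)) (u (r n)))" by (intro convergent_imp_Bseq) (auto simp: convergent_def)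
    then obtain B where B: "\<And>n. \<bar>T (s (r n)) (u (r n))\<bar> \<le> B" by (auto simp: Bseq_def)
    obtain n :: nat where "B < real n" using reals_Archimedean2 by blast
    also have "real n \<le> real (r n)" using seq_suble[OF r] by simp
    also have "\<dots> < \<bar>T (s (r n)) (u (r n))\<bar>" by (rule su(3))
    finally show False using B[of n] by simp
  qed
  then obtain M :: nat where "\<forall>\<mu>\<in>prob_measures. \<forall>\<nu>\<in>prob_measures. \<bar>T \<mu> \<nu>\<bar> \<le> M" by blast
  then show thesis by (intro that[of "real M"]) auto
qed

lemma K_return: "f \<in> cont_funs \<Longrightarrow> (\<integral>y. K f y \<partial>return borel x) = K f x"
  by (rule integral_return_cont[OF K_cont])

lemma K_return_ge:
  "g \<in> cont_funs \<Longrightarrow> \<nu> \<in> prob_measures \<Longrightarrow> (\<integral>y. g y \<partial>\<nu>) - T (return borel x) \<nu> \<le> K g x"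
  using K_ge[OF return_in_prob_measures, of \<nu> g x] by (simp add: K_return)

lemma K_return_approx:
  "g \<in> cont_funs \<Longrightarrow> b < K g x \<Longrightarrow> \<exists>\<nu>\<in>prob_measures. b < (\<integral>y. g y \<partial>\<nu>) - T (return borel x) \<nu>"
  using K_approx[OF return_in_prob_measures, of g b x] by (simp add: K_return)

text \<open>At a Dirac mass the Legendre identity exhibits \<open>K g x\<close> as a supremum over
  \<nu> of functionals affine in \<open>g\<close>, whose linear parts are integrals against
  probability measures.\<close>

lemma convex_operator_K: "convex_operator K"
  unfolding convex_operator_def
proof (intro conjI ballI allI impI)
  fix h f g :: "'a \<Rightarrow> real" and x and t k :: real
  assume H: "h \<in> cont_funs" "f \<in> cont_funs" "g \<in> cont_funs" and t: "0 \<le> t" "t \<le> 1"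
    and le: "\<forall>x. h x \<le> t * f x + (1 - t) * g x + k"
  show "K h x \<le> t * K f x + (1 - t) * K g x + k"
  proof (rule ccontr)
    assume "\<not> ?thesis"
    then obtain \<nu> where \<nu>: "\<nu> \<in> prob_measures"
        "t * K f x + (1 - t) * K g x + k < (\<integral>y. h y \<partial>\<nu>) - T (return borel x) \<nu>"
      using K_return_approx[OF H(1)] by (meson not_le)
    have "(\<integral>y. h y \<partial>\<nu>) \<le> t * (\<integral>y. f y \<partial>\<nu>) + (1 - t) * (\<integral>y. g y \<partial>\<nu>) + k"
      using le by (intro integral_le_affine[OF compact_UNIV] H \<nu>(1)) auto
    then have "(\<integral>y. h y \<partial>\<nu>) - T (return borel x) \<nu> \<le> t * ((\<integral>y. f y \<partial>\<nu>) - T (return borel x) \<nu>)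
        + (1 - t) * ((\<integral>y. g y \<partial>\<nu>) - T (return borel x) \<nu>) + k" by (simp add: algebra_simps)
    also have "\<dots> \<le> t * K f x + (1 - t) * K g x + k"
      using t by (intro add_mono mult_left_mono K_return_ge H \<nu>(1)) auto
    finally show False using \<nu>(2) by simp
  qed
qed (rule K_cont)

lemma weakly_converges_return:
  "s \<longlonglongrightarrow> x \<Longrightarrow> weakly_converges (\<lambda>n. return borel (s n)) (return borel (x :: 'a))"
  unfolding weakly_converges_def
proof
  fix f :: "'a \<Rightarrow> real" assume x: "s \<longlonglongrightarrow> x" and f: "f \<in> cont_funs"
  have "(\<lambda>n. f (s n)) \<longlonglongrightarrow> f x"
    using f x by (intro continuous_on_tendsto_compose[of UNIV f]) (auto simp: cont_funs_def)
  then show "(\<lambda>n. \<integral>y. f y \<partial>return borel (s n)) \<longlonglongrightarrow> (\<integral>y. f y \<partial>return borel x)"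
    by (simp add: integral_return_cont[OF f])
qed

text \<open>For a nearly optimal \<nu> at \<open>x\<close>, the integral of \<open>f\<close> cancels
  when the same \<nu> is tried at \<open>y\<close>; only the change of \<open>T\<close> from one
  Dirac mass to the other remains. This change is small uniformly in \<nu> by compactness, so the
  modulus does not depend on \<open>f\<close>.\<close>

lemma equicontinuous_K: "equicontinuous (K ` cont_funs)"
  unfolding equicontinuous_def
proof (intro allI impI)
  fix e :: real assume e: "0 < e"
  have "\<exists>d>0. \<forall>x y. dist x y < d \<longrightarrow>
      (\<forall>\<nu>\<in>prob_measures. T (return borel y) \<nu> \<le> T (return borel x) \<nu> + e)"
  proof (rule ccontr)
    assume neg: "\<not> ?thesis"
    have "\<exists>x y \<nu>. dist x y < 1 / Suc n \<and> \<nu> \<in> prob_measures \<and>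
        T (return borel x) \<nu> + e < T (return borel y) \<nu>" for n
    proof -
      have "0 < 1 / real (Suc n)" by simp
      then show ?thesis using neg by (meson not_le)
    qed
    then obtain a b u where ab: "\<And>n. dist (a n) (b n) < 1 / Suc n" and u: "\<And>n. u n \<in> prob_measures"
      and gt: "\<And>n. T (return borel (a n)) (u n) + e < T (return borel (b n)) (u n)" by metis
    obtain q x where q: "strict_mono q" "(\<lambda>n. a (q n)) \<longlonglongrightarrow> x"
      by (rule convergent_subsequence[OF compact_UNIV])
    obtain r \<nu> where r: "strict_mono r" and \<nu>: "\<nu> \<in> prob_measures" "weakly_converges (\<lambda>n. u (q (r n))) \<nu>"
      by (rule prob_measures_seq_compact[OF compact_UNIV, of "\<lambda>n. u (q n)", OF u])
    have qr: "strict_mono (q \<circ> r)" using q(1) r by (rule strict_mono_o)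
    have al: "(\<lambda>n. a (q (r n))) \<longlonglongrightarrow> x" using LIMSEQ_subseq_LIMSEQ[OF q(2) r] by (simp add: comp_def)
    \<comment> \<open>The two sequences of points merge, so both sequences of values of
      \<open>T\<close> have the same limit, against the fixed gap \<open>e\<close>.\<close>
    have "(\<lambda>n. dist (a n) (b n)) \<longlonglongrightarrow> 0"
      by (rule tendsto_sandwich[OF _ _ tendsto_const LIMSEQ_inverse_real_of_nat])
        (use ab in \<open>auto simp: inverse_eq_divide intro!: always_eventually less_imp_le\<close>)
    then have "(\<lambda>n. dist (a (q (r n))) (b (q (r n)))) \<longlonglongrightarrow> 0"
      using LIMSEQ_subseq_LIMSEQ[OF _ qr] by (fastforce simp: comp_def)
    then have "(\<lambda>n. dist (a (q (r n))) (b (q (r n))) + dist (a (q (r n))) x) \<longlonglongrightarrow> 0 + 0"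
      using al by (intro tendsto_add) (simp_all add: tendsto_dist_iff[symmetric])
    then have bl: "(\<lambda>n. b (q (r n))) \<longlonglongrightarrow> x"
      by (rule metric_tendsto_imp_tendsto) (simp add: dist_triangle3)
    have "(\<lambda>n. T (return borel (a (q (r n)))) (u (q (r n))) + e) \<longlonglongrightarrow> T (return borel x) \<nu> + e"
      by (intro tendsto_intros T_tendsto return_in_prob_measures u \<nu> weakly_converges_return al)
    moreover have "(\<lambda>n. T (return borel (b (q (r n)))) (u (q (r n)))) \<longlonglongrightarrow> T (return borel x) \<nu>"
      by (intro T_tendsto return_in_prob_measures u \<nu> weakly_converges_return bl)
    ultimately have "T (return borel x) \<nu> + e \<le> T (return borel x) \<nu>"
      by (rule LIMSEQ_le) (intro exI allI impI less_imp_le gt)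
    then show False using e by simp
  qed
  then obtain d where d: "d > 0" and le: "\<And>x y \<nu>. dist x y < d \<Longrightarrow> \<nu> \<in> prob_measures \<Longrightarrow>
      T (return borel y) \<nu> \<le> T (return borel x) \<nu> + e" by metis
  have K_le: "K f x \<le> K f y + e" if f: "f \<in> cont_funs" and xy: "dist x y < d" for f x y
  proof (rule ccontr)
    assume "\<not> ?thesis"
    then obtain \<nu> where \<nu>: "\<nu> \<in> prob_measures" "K f y + e < (\<integral>y. f y \<partial>\<nu>) - T (return borel x) \<nu>"
      using K_return_approx[OF f] by (meson not_le)
    then show False using K_return_ge[OF f \<nu>(1), of y] le[OF xy \<nu>(1)] by simp
  qed
  have "\<bar>K f x - K f y\<bar> \<le> e" if "f \<in> cont_funs" "dist x y < d" for f x y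
    using K_le[OF that] K_le[OF that(1), of y x] that(2) by (simp add: dist_commute abs_le_iff)
  then show "\<exists>d>0. \<forall>h\<in>K ` cont_funs. \<forall>x y. dist x y < d \<longrightarrow> \<bar>h x - h y\<bar> \<le> e"
    using d by blast
qed

lemma T_diagonal_min:
  obtains \<mu> where "\<mu> \<in> prob_measures" "\<And>\<nu>. \<nu> \<in> prob_measures \<Longrightarrow> T \<mu> \<mu> \<le> T \<nu> \<nu>"
proof -
  obtain M where "0 \<le> M"
    and M: "\<And>\<mu> \<nu>. \<mu> \<in> prob_measures \<Longrightarrow> \<nu> \<in> prob_measures \<Longrightarrow> \<bar>T \<mu> \<nu>\<bar> \<le> M"
    by (rule T_bounded) blast
  define i where "i = (INF \<mu>\<in>prob_measures. T \<mu> \<mu>)"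
  have bdd: "bdd_below ((\<lambda>\<mu>. T \<mu> \<mu>) ` prob_measures)"
  proof (rule bdd_belowI2[of _ "-M"])
    show "- M \<le> T \<mu> \<mu>" if "\<mu> \<in> prob_measures" for \<mu> using M[OF that that] by linarith
  qed
  have ne: "(\<lambda>\<mu>. T \<mu> \<mu>) ` prob_measures \<noteq> {}" using return_in_prob_measures by blast
  have "\<exists>\<mu>\<in>prob_measures. T \<mu> \<mu> < i + 1 / Suc n" for n
    using cInf_lessD[OF ne, of "i + 1 / Suc n"] by (auto simp: i_def)
  then obtain s where s: "\<And>n. s n \<in> prob_measures" "\<And>n. T (s n) (s n) < i + 1 / Suc n" by metis
  obtain r \<mu> where r: "strict_mono r" and \<mu>: "\<mu> \<in> prob_measures" "weakly_converges (\<lambda>n. s (r n)) \<mu>"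
    by (rule prob_measures_seq_compact[OF compact_UNIV, of s, OF s(1)])
  have "T \<mu> \<mu> \<le> i"
  proof (rule LIMSEQ_le)
    show "(\<lambda>n. T (s (r n)) (s (r n))) \<longlonglongrightarrow> T \<mu> \<mu>" by (intro T_tendsto s(1) \<mu>)
    have "(\<lambda>n. i + inverse (real (Suc n))) \<longlonglongrightarrow> i + 0" by (intro tendsto_intros LIMSEQ_inverse_real_of_nat)
    from LIMSEQ_subseq_LIMSEQ[OF this r] show "(\<lambda>n. i + inverse (real (Suc (r n)))) \<longlonglongrightarrow> i"
      by (simp add: comp_def)
    show "\<exists>N. \<forall>n\<ge>N. T (s (r n)) (s (r n)) \<le> i + inverse (real (Suc (r n)))"
      using s(2) by (auto simp: inverse_eq_divide intro: less_imp_le)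
  qed
  moreover have "i \<le> T \<nu> \<nu>" if "\<nu> \<in> prob_measures" for \<nu>
    unfolding i_def by (rule cINF_lower[OF bdd that])
  ultimately show thesis using that[OF \<mu>(1)] by force
qed

lemma continuous_transfer_shift: "continuous_transfer (\<lambda>\<mu> \<nu>. T \<mu> \<nu> + c) (\<lambda>g x. K g x - c)"
proof
  have int: "(\<integral>x. K g x - c \<partial>\<mu>) = (\<integral>x. K g x \<partial>\<mu>) - c" if "\<mu> \<in> prob_measures" "g \<in> cont_funs" for \<mu> g
    using integral_diff_cont[OF compact_UNIV K_cont[OF that(2)] cont_funs_const that(1), of c]
    by (simp only: integral_const_prob[OF that(1)])
  show "(\<integral>y. g y \<partial>\<nu>) - (T \<mu> \<nu> + c) \<le> (\<integral>x. K g x - c \<partial>\<mu>)"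
    if "\<mu> \<in> prob_measures" "\<nu> \<in> prob_measures" "g \<in> cont_funs" for \<mu> \<nu> g
    unfolding int[OF that(1,3)] using K_ge[OF that] by simp
  show "\<exists>\<nu>\<in>prob_measures. b < (\<integral>y. g y \<partial>\<nu>) - (T \<mu> \<nu> + c)"
    if "\<mu> \<in> prob_measures" "g \<in> cont_funs" "b < (\<integral>x. K g x - c \<partial>\<mu>)" for \<mu> g b
    using K_approx[OF that(1,2), of "b + c"] that(3) unfolding int[OF that(1,2)] by (auto simp: algebra_simps)
  show "T (mixture t \<mu>1 \<mu>2) (mixture t \<nu>1 \<nu>2) + c \<le> t * (T \<mu>1 \<nu>1 + c) + (1 - t) * (T \<mu>2 \<nu>2 + c)"
    if "\<mu>1 \<in> prob_measures" "\<mu>2 \<in> prob_measures" "\<nu>1 \<in> prob_measures" "\<nu>2 \<in> prob_measures"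
      "0 \<le> t" "t \<le> 1" for \<mu>1 \<mu>2 \<nu>1 \<nu>2 t
    using T_convex[OF that] by (simp add: algebra_simps)
  show "(\<lambda>x. K f x - c) \<in> cont_funs" if "f \<in> cont_funs" for f
    by (intro cont_funs_diff K_cont that cont_funs_const)
  show "(\<lambda>n. T (s n) (u n) + c) \<longlonglongrightarrow> T \<mu> \<nu> + c"
    if "\<And>n. s n \<in> prob_measures" "\<And>n. u n \<in> prob_measures" "\<mu> \<in> prob_measures" "\<nu> \<in> prob_measures"
      "weakly_converges s \<mu>" "weakly_converges u \<nu>" for s u \<mu> \<nu>
    by (intro tendsto_intros T_tendsto that)
qed (rule compact_UNIV)

text \<open>The term \<open>\<integral> g d\<nu> - \<integral> g d\<sigma>\<close> acts as a penalty
  that forces \<sigma> to be \<nu>, so the infimum over \<sigma> of the supremum over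
  \<open>g\<close> is \<open>T \<mu> \<nu>\<close>. After the exchange, the inner infimum over
  \<sigma> is a Legendre transform and produces \<open>K g\<close>.\<close>

lemma T_duality:
  assumes P: "\<mu> \<in> prob_measures" "\<nu> \<in> prob_measures" and a: "a < T \<mu> \<nu>"
  obtains g where "g \<in> cont_funs" "a \<le> (\<integral>y. g y \<partial>\<nu>) - (\<integral>x. K g x \<partial>\<mu>)"
proof -
  obtain g where g: "g \<in> cont_funs" "\<And>\<sigma>. \<sigma> \<in> prob_measures \<Longrightarrow>
      a \<le> T \<mu> \<sigma> + (\<integral>y. g y \<partial>\<nu>) - (\<integral>x. g x \<partial>\<sigma>)"
  proof (rule operator_minimax[OF compact_UNIV convex_operator_ident affine_continuous_const[OF P(2)]
        affine_continuous_ident[OF compact_UNIV], of "T \<mu>" a])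
    fix \<sigma> :: "'a measure" assume \<sigma>: "\<sigma> \<in> prob_measures"
    show "\<exists>g\<in>cont_funs. a < T \<mu> \<sigma> + (\<integral>y. g y \<partial>\<nu>) - (\<integral>x. g x \<partial>\<sigma>)"
    \<comment> \<open>Two measures that agree on all continuous functions are not identified as
      measures; continuity of \<open>T\<close> shows directly that it cannot tell them
      apart.\<close>
    proof (cases "\<forall>g\<in>cont_funs. (\<integral>y. g y \<partial>\<nu>) = (\<integral>x. g x \<partial>\<sigma>)")
      case True
      then have "weakly_converges (\<lambda>_. \<sigma>) \<nu>" by (simp add: weakly_converges_def)
      from T_tendsto[OF P(1) \<sigma> P weakly_converges_const this] have "T \<mu> \<sigma> = T \<mu> \<nu>"
        by (simp add: LIMSEQ_const_iff)
      then show ?thesis using a by (intro bexI[of _ "\<lambda>_. 0"]) auto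
    next
      case False
      then obtain g where g: "g \<in> cont_funs" "(\<integral>y. g y \<partial>\<nu>) - (\<integral>x. g x \<partial>\<sigma>) \<noteq> 0" by auto
      \<comment> \<open>The scaling that lifts the payoff to exactly \<open>a + 1\<close>.\<close>
      define k where "k = (a - T \<mu> \<sigma> + 1) / ((\<integral>y. g y \<partial>\<nu>) - (\<integral>x. g x \<partial>\<sigma>))"
      have "k * ((\<integral>y. g y \<partial>\<nu>) - (\<integral>x. g x \<partial>\<sigma>)) = a - T \<mu> \<sigma> + 1" using g(2) by (simp add: k_def)
      then show ?thesis
        using g(1) by (intro bexI[of _ "\<lambda>x. k * g x"] cont_funs_mult) (auto simp: algebra_simps)
    qed
  next
    fix \<sigma> \<tau> :: "'a measure" and t :: real
    assume "\<sigma> \<in> prob_measures" "\<tau> \<in> prob_measures" "0 \<le> t" "t \<le> 1"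
    then show "T \<mu> (mixture t \<sigma> \<tau>) \<le> t * T \<mu> \<sigma> + (1 - t) * T \<mu> \<tau>" by (rule T_convex2[OF P(1)])
  next
    fix s and \<sigma> :: "'a measure" and b
    assume "\<And>n. s n \<in> prob_measures" "\<sigma> \<in> prob_measures" "weakly_converges s \<sigma>"
      "eventually (\<lambda>n. T \<mu> (s n) \<le> b) sequentially"
    then show "T \<mu> \<sigma> \<le> b" by (rule T_seq_lsc[OF P(1)])
  next
    fix g assume "g \<in> cont_funs" "\<And>\<sigma>. \<sigma> \<in> prob_measures \<Longrightarrow>
      a \<le> T \<mu> \<sigma> + (\<integral>y. g y \<partial>\<nu>) - (\<integral>x. g x \<partial>\<sigma>)"
    then show thesis by (rule that)
  qed
  have "a \<le> (\<integral>y. g y \<partial>\<nu>) - (\<integral>x. K g x \<partial>\<mu>)"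
  proof (rule ccontr)
    assume "\<not> ?thesis"
    then have "(\<integral>y. g y \<partial>\<nu>) - a < (\<integral>x. K g x \<partial>\<mu>)" by simp
    then obtain \<sigma> where "\<sigma> \<in> prob_measures" "(\<integral>y. g y \<partial>\<nu>) - a < (\<integral>y. g y \<partial>\<sigma>) - T \<mu> \<sigma>"
      using K_approx[OF P(1) g(1)] by blast
    then show False using g(2)[of \<sigma>] by simp
  qed
  then show thesis using that g(1) by blast
qed

lemma power_K_fixed_shift:
  assumes u: "u \<in> cont_funs" and "\<And>x. K u x = u x + c"
  shows "(K ^^ n) u x = u x + real n * c"
proof (induction n arbitrary: x)
  case (Suc n)
  have "(K ^^ n) u = (\<lambda>x. u x + real n * c)" using Suc.IH by blast
  then have "(K ^^ Suc n) u x = K (\<lambda>x. u x + real n * c) x" by simp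
  also have "\<dots> = K u x + real n * c" by (rule convex_operator_add_const[OF convex_operator_K u])
  finally show ?case using assms(2) by (simp add: algebra_simps)
qed simp

end

section \<open>Transfers normalised to have minimum 0 on the diagonal\<close>

locale normalized_transfer = continuous_transfer T K
  for T :: "'a::metric_space measure \<Rightarrow> 'a measure \<Rightarrow> real" and K +
  fixes \<mu>\<^sub>0 :: "'a measure"
  assumes \<mu>\<^sub>0: "\<mu>\<^sub>0 \<in> prob_measures" and T_\<mu>\<^sub>0: "T \<mu>\<^sub>0 \<mu>\<^sub>0 = 0"
    and T_diagonal: "\<And>\<mu>. \<mu> \<in> prob_measures \<Longrightarrow> 0 \<le> T \<mu> \<mu>"
begin

text \<open>By duality, nonnegativity on the diagonal provides for each \<sigma> some
  \<open>g\<close> whose integral is nearly at least that of \<open>K g\<close>. Minimax makes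
  \<open>g\<close> independent of \<sigma>, and Dirac masses make the inequality pointwise. As the
  infimum over \<open>g\<close> need not be attained, an error \<open>e\<close> remains.\<close>

lemma approximate_subsolution:
  assumes "0 < e"
  obtains g where "g \<in> cont_funs" "\<And>x. K g x \<le> g x + e"
proof -
  obtain g where g: "g \<in> cont_funs" "\<And>\<sigma>. \<sigma> \<in> prob_measures \<Longrightarrow>
      - e \<le> 0 + (\<integral>y. g y \<partial>\<sigma>) - (\<integral>x. K g x \<partial>\<sigma>)"
  proof (rule operator_minimax[OF compact_UNIV convex_operator_K affine_continuous_ident[OF compact_UNIV]
        affine_continuous_ident[OF compact_UNIV], of "\<lambda>_. 0" "-e"])
    fix \<sigma> :: "'a measure" assume \<sigma>: "\<sigma> \<in> prob_measures"
    have "- e / 2 < T \<sigma> \<sigma>" using T_diagonal[OF \<sigma>] assms by simp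
    then obtain g where "g \<in> cont_funs" "- e / 2 \<le> (\<integral>y. g y \<partial>\<sigma>) - (\<integral>x. K g x \<partial>\<sigma>)"
      by (rule T_duality[OF \<sigma> \<sigma>])
    then show "\<exists>g\<in>cont_funs. - e < 0 + (\<integral>y. g y \<partial>\<sigma>) - (\<integral>x. K g x \<partial>\<sigma>)"
      using assms by (intro bexI[of _ g]) auto
  next
    fix g assume "g \<in> cont_funs" "\<And>\<sigma>. \<sigma> \<in> prob_measures \<Longrightarrow>
      - e \<le> 0 + (\<integral>y. g y \<partial>\<sigma>) - (\<integral>x. K g x \<partial>\<sigma>)"
    then show thesis by (rule that)
  next
    fix s :: "nat \<Rightarrow> 'a measure" and b :: real
    assume "eventually (\<lambda>n. 0 \<le> b) sequentially"
    then show "0 \<le> b" by simp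
  qed simp
  have "K g x \<le> g x + e" for x
    using g(2)[OF return_in_prob_measures, of x] g(1) by (simp add: K_return)
  then show thesis using that g(1) by blast
qed

text \<open>The role of the minimal measure: it behaves like an invariant measure in one direction,
  and thereby bounds orbits from below.\<close>

lemma integral_le_K:
  "g \<in> cont_funs \<Longrightarrow> (\<integral>x. g x \<partial>\<mu>\<^sub>0) \<le> (\<integral>x. K g x \<partial>\<mu>\<^sub>0)"
  using K_ge[OF \<mu>\<^sub>0 \<mu>\<^sub>0] by (simp add: T_\<mu>\<^sub>0)

text \<open>Trying at \<open>y\<close> a measure that is nearly optimal at \<open>x\<close> changes
  only the value of \<open>T\<close>, by at most \<open>2 * M\<close>.\<close>

lemma K_oscillation:
  assumes M: "\<And>\<mu> \<nu>. \<mu> \<in> prob_measures \<Longrightarrow> \<nu> \<in> prob_measures \<Longrightarrow> \<bar>T \<mu> \<nu>\<bar> \<le> M" and f: "f \<in> cont_funs"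
  shows "K f x \<le> K f y + 2 * M"
proof (rule ccontr)
  assume "\<not> ?thesis"
  then obtain \<nu> where \<nu>: "\<nu> \<in> prob_measures" "K f y + 2 * M < (\<integral>y. f y \<partial>\<nu>) - T (return borel x) \<nu>"
    using K_return_approx[OF f] by (meson not_le)
  then show False
    using K_return_ge[OF f \<nu>(1), of y] M[OF return_in_prob_measures \<nu>(1), of x]
      M[OF return_in_prob_measures \<nu>(1), of y] by linarith
qed

text \<open>From above, 0 is dominated by an approximate subsolution plus a constant, and such a
  function grows slowly under iteration. From below, the integral against the minimal measure stays
  nonnegative, and the oscillation bound turns this into a pointwise bound. Each side gives
  \<open>2 * M\<close>, which is rounded up to \<open>4 * M\<close>.\<close>

lemma bounded_orbit_zero:
  assumes M0: "0 \<le> M" and M: "\<And>\<mu> \<nu>. \<mu> \<in> prob_measures \<Longrightarrow> \<nu> \<in> prob_measures \<Longrightarrow> \<bar>T \<mu> \<nu>\<bar> \<le> M"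
  shows "\<bar>(K ^^ n) (\<lambda>_. 0) x\<bar> \<le> 4 * M"
proof -
  note K_pow = convex_operator_power[OF convex_operator_K]
  have osc: "K f x \<le> K f y + 2 * M" if "f \<in> cont_funs" for f x y
    by (rule K_oscillation[OF _ that]) (rule M)
  have "(K ^^ n) (\<lambda>_. 0) x \<le> 4 * M"
  proof (rule field_le_epsilon)
    fix e :: real assume "0 < e"
    \<comment> \<open>The total error after \<open>n\<close> iterations stays below
      \<open>e\<close>; dividing by \<open>Suc n\<close> includes the case
      \<open>n = 0\<close>.\<close>
    then have e: "0 < e / Suc n" by simp
    obtain g where g: "g \<in> cont_funs" "\<And>x. K g x \<le> g x + e / Suc n"
      by (rule approximate_subsolution[OF e]) blast
    \<comment> \<open>The image \<open>K g\<close> is an approximate subsolution as well, and unlike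
      \<open>g\<close> it has an oscillation bounded in terms of \<open>M\<close>.\<close>
    define h where "h = K g"
    have h: "h \<in> cont_funs" unfolding h_def by (rule K_cont[OF g(1)])
    have hK: "K h x \<le> h x + e / Suc n" for x
      using convex_operator_mono_add[OF convex_operator_K h g(1)] g(2) unfolding h_def by blast
    have hn: "(K ^^ j) h x \<le> h x + j * (e / Suc n)" for j
    proof (induction j)
      case (Suc m)
      have "(K ^^ Suc m) h x = (K ^^ m) (K h) x" by (simp add: funpow_swap1)
      also have "\<dots> \<le> (K ^^ m) h x + e / Suc n"
        by (rule convex_operator_mono_add[OF K_pow K_cont[OF h] h hK])
      also have "\<dots> \<le> (h x + m * (e / Suc n)) + e / Suc n" using Suc.IH by simp
      also have "\<dots> = h x + Suc m * (e / Suc n)"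
        by (simp only: of_nat_Suc[of m] distrib_right)
      finally show ?case .
    qed simp
    have "(K ^^ n) (\<lambda>_. 0) x \<le> (K ^^ n) h x + (2 * M - h x)"
    proof (rule convex_operator_mono_add[OF K_pow cont_funs_const h])
      show "0 \<le> h y + (2 * M - h x)" for y using osc[OF g(1), of x y] by (simp add: h_def)
    qed
    also have "\<dots> \<le> n * (e / Suc n) + 2 * M" using hn[of n] by linarith
    also have "n * (e / Suc n) \<le> e" using \<open>0 < e\<close> by (simp add: field_simps)
    finally show "(K ^^ n) (\<lambda>_. 0) x \<le> 4 * M + e" using M0 by simp
  qed
  moreover have "- (2 * M) \<le> (K ^^ n) (\<lambda>_. 0) x"
  \<comment> \<open>The oscillation bound concerns values of \<open>K\<close>, so the zeroth iterate
    is treated apart.\<close>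
  proof (cases n)
    case 0
    then show ?thesis using M0 by simp
  next
    case (Suc m)
    have z: "(K ^^ j) (\<lambda>_. 0) \<in> cont_funs" for j
      by (rule convex_operator_cont[OF K_pow cont_funs_const])
    have "0 \<le> (\<integral>x. (K ^^ j) (\<lambda>_. 0) x \<partial>\<mu>\<^sub>0)" for j
    proof (induction j)
      case (Suc j)
      then show ?case using integral_le_K[OF z[of j]] by simp
    qed simp
    then have "0 \<le> (\<integral>x. (K ^^ n) (\<lambda>_. 0) x \<partial>\<mu>\<^sub>0)" .
    also have "\<dots> \<le> (\<integral>y. (K ^^ n) (\<lambda>_. 0) x \<partial>\<mu>\<^sub>0) + 2 * M"
    proof (rule integral_le_add[OF compact_UNIV cont_funs_const z \<mu>\<^sub>0])
      show "(K ^^ n) (\<lambda>_. 0) y \<le> (K ^^ n) (\<lambda>_. 0) x + 2 * M" for y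
        using osc[OF z[of m], of y x] by (simp add: Suc)
    qed
    finally show ?thesis unfolding integral_const_prob[OF \<mu>\<^sub>0] by simp
  qed
  ultimately show ?thesis using M0 by (simp add: abs_le_iff)
qed

text \<open>The projection absorbs the operator and itself, \<open>K P = P\<close> and
  \<open>P P = P\<close>, which is what the exchange lemma for inf-convolutions asks for. The
  remaining work is the coercivity of the projection and the value of its dual at the minimal
  measure.\<close>

theorem transfer_fixed_points:
  "\<exists>P M. coercive_operator P M \<and>
    (\<forall>f\<in>cont_funs. P (P f) = P f \<and> K (P f) = P f) \<and>
    (\<forall>u\<in>cont_funs. K u = u \<longrightarrow> P u = u) \<and>
    dual_transfer P \<mu>\<^sub>0 \<mu>\<^sub>0 = 0 \<and>
    (\<forall>\<mu>\<in>prob_measures. \<forall>\<nu>\<in>prob_measures.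
      inf_convolution (\<lambda>\<mu> \<nu>. ereal (T \<mu> \<nu>)) (\<lambda>\<mu> \<nu>. ereal (dual_transfer P \<mu> \<nu>)) \<mu> \<nu>
        = ereal (dual_transfer P \<mu> \<nu>))"
proof -
  obtain M where M0: "0 \<le> M"
    and M: "\<And>\<mu> \<nu>. \<mu> \<in> prob_measures \<Longrightarrow> \<nu> \<in> prob_measures \<Longrightarrow> \<bar>T \<mu> \<nu>\<bar> \<le> M"
    by (rule T_bounded) blast
  have orbit: "\<bar>(K ^^ n) (\<lambda>_. 0) x\<bar> \<le> 4 * M" for n x
    by (rule bounded_orbit_zero[OF M0]) (rule M)
  interpret bounded_equicontinuous_operator K "4 * M"
    by unfold_locales (rule compact_UNIV convex_operator_K equicontinuous_K orbit)+
  define P where "P = fixed_point_projection K"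
  \<comment> \<open>Testing the Legendre formula with the Dirac mass at \<open>y\<close> costs one
    \<open>M\<close> and puts the function \<open>K g\<close> above the constant
    \<open>g y - M\<close>. Comparing its iterates with the orbit of 0 costs another
    \<open>4 * M\<close>.\<close>
  have lower: "g y \<le> P g x + 5 * M" if g: "g \<in> cont_funs" for g x y
  proof -
    have "g y - M - 4 * M \<le> fixed_point_projection K g x"
    proof (rule projection_lower_bound[OF g])
      fix n x
      have "0 \<le> K g z + (M - g y)" for z
        using K_return_ge[OF g return_in_prob_measures, of y z] g
          M[OF return_in_prob_measures return_in_prob_measures, of z y] by simp
      then have "(K ^^ n) (\<lambda>_. 0) x \<le> (K ^^ n) (K g) x + (M - g y)"
        by (rule convex_operator_mono_add[OF power_op cont_funs_const K_cont[OF g]])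
      then show "g y - M - 4 * M \<le> (K ^^ Suc n) g x"
        using orbit[of n x] by (simp add: funpow_swap1 abs_le_iff)
    qed
    then show ?thesis by (simp add: P_def)
  qed
  interpret P: coercive_operator P "5 * M"
    using compact_UNIV convex_operator_projection lower by unfold_locales (auto simp: P_def)
  have fixed: "K (P f) = P f" and idem: "P (P f) = P f" if "f \<in> cont_funs" for f
    unfolding P_def by (rule projection_fixed[OF that], rule projection_idem[OF that])
  have "dual_transfer P \<mu>\<^sub>0 \<mu>\<^sub>0 \<le> 0"
    by (rule P.dual_transfer_least)
      (use integral_le_projection[OF \<mu>\<^sub>0 integral_le_K] in \<open>simp add: P_def\<close>)
  \<comment> \<open>The test function is \<open>P\<close> applied to 0: as \<open>P\<close> fixes
    it, its two integrals cancel.\<close>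
  moreover have "0 \<le> dual_transfer P \<mu>\<^sub>0 \<mu>\<^sub>0"
    using P.dual_transfer_ge[OF P.op_cont[OF cont_funs_const[of 0]] \<mu>\<^sub>0 \<mu>\<^sub>0] by (simp add: idem)
  moreover have "inf_convolution (\<lambda>\<mu> \<nu>. ereal (T \<mu> \<nu>)) (\<lambda>\<mu> \<nu>. ereal (dual_transfer P \<mu> \<nu>)) \<mu> \<nu>
      = ereal (dual_transfer P \<mu> \<nu>)" if \<mu>\<nu>: "\<mu> \<in> prob_measures" "\<nu> \<in> prob_measures" for \<mu> \<nu>
  proof (rule P.inf_convolution_dual_transfer[OF \<mu>\<nu>, where B = K])
    fix s and \<sigma> :: "'a measure" and b
    assume "\<And>n. s n \<in> prob_measures" "\<sigma> \<in> prob_measures" "weakly_converges s \<sigma>"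
      "eventually (\<lambda>n. T \<mu> (s n) \<le> b) sequentially"
    then show "T \<mu> \<sigma> \<le> b" by (rule T_seq_lsc[OF \<mu>\<nu>(1)])
  qed (use \<mu>\<nu>(1) T_convex2 K_ge K_approx fixed in auto)
  ultimately show ?thesis
    using P.coercive_operator_axioms fixed idem projection_id unfolding P_def
    by (intro exI[of _ "fixed_point_projection K"] exI[of _ "5 * M"]) auto
qed

end

lemma continuous_transferI:
  fixes T :: "'a::metric_space measure \<Rightarrow> 'a measure \<Rightarrow> ereal"
  assumes "compact (UNIV :: 'a set)" and "backward_linear_transfer T"
    and "\<forall>\<mu>\<in>prob_measures. \<forall>\<nu>\<in>prob_measures. \<bar>T \<mu> \<nu>\<bar> \<noteq> \<infinity>"
    and cont: "continuous_map (prod_topology weak_star weak_star) euclidean (\<lambda>(\<mu>, \<nu>). T \<mu> \<nu>)"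
    and "backward_kantorovich_operator T K"
    and "\<forall>f\<in>cont_funs. K f \<in> cont_funs"
  shows "continuous_transfer (\<lambda>\<mu> \<nu>. real_of_ereal (T \<mu> \<nu>)) K"
proof -
  define S where "S \<mu> \<nu> = real_of_ereal (T \<mu> \<nu>)" for \<mu> \<nu>
  have T_eq: "T \<mu> \<nu> = ereal (S \<mu> \<nu>)" if "\<mu> \<in> prob_measures" "\<nu> \<in> prob_measures" for \<mu> \<nu>
    using assms(3) that by (simp add: S_def ereal_real)
  have leg: "(SUP \<nu>\<in>prob_measures. ereal (\<integral>y. g y \<partial>\<nu>) - T \<mu> \<nu>) = ereal (\<integral>x. K g x \<partial>\<mu>)"
    if "\<mu> \<in> prob_measures" "g \<in> cont_funs" for \<mu> g
  proof -
    \<comment> \<open>Finiteness of \<open>T\<close> makes every probability measure admissible, in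
      particular the Dirac masses, from which pointwise values of \<open>K\<close> are read
      off.\<close>
    have "\<mu> \<in> transfer_domain1 T"
      using that(1) by (auto simp: transfer_domain1_def T_eq intro!: bexI[of _ \<mu>])
    then show ?thesis
      using assms(5) that(2) unfolding backward_kantorovich_operator_def legendre_def by blast
  qed
  have "continuous_transfer S K"
  proof
    show "(\<integral>y. g y \<partial>\<nu>) - S \<mu> \<nu> \<le> (\<integral>x. K g x \<partial>\<mu>)"
      if "\<mu> \<in> prob_measures" "\<nu> \<in> prob_measures" "g \<in> cont_funs" for \<mu> \<nu> g
      using SUP_upper[OF that(2), of "\<lambda>\<nu>. ereal (\<integral>y. g y \<partial>\<nu>) - T \<mu> \<nu>"]
      by (simp add: leg[OF that(1,3)] T_eq[OF that(1,2)])
    show "\<exists>\<nu>\<in>prob_measures. b < (\<integral>y. g y \<partial>\<nu>) - S \<mu> \<nu>"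
      if "\<mu> \<in> prob_measures" "g \<in> cont_funs" "b < (\<integral>x. K g x \<partial>\<mu>)" for \<mu> g b
    proof -
      have "ereal b < (SUP \<nu>\<in>prob_measures. ereal (\<integral>y. g y \<partial>\<nu>) - T \<mu> \<nu>)"
        using that(3) by (simp add: leg[OF that(1,2)])
      then obtain \<nu> where "\<nu> \<in> prob_measures" "ereal b < ereal (\<integral>y. g y \<partial>\<nu>) - T \<mu> \<nu>"
        unfolding less_SUP_iff by blast
      then show ?thesis by (intro bexI[of _ \<nu>]) (simp_all add: T_eq[OF that(1)])
    qed
    show "S (mixture t \<mu>1 \<mu>2) (mixture t \<nu>1 \<nu>2) \<le> t * S \<mu>1 \<nu>1 + (1 - t) * S \<mu>2 \<nu>2"
      if H: "\<mu>1 \<in> prob_measures" "\<mu>2 \<in> prob_measures" "\<nu>1 \<in> prob_measures" "\<nu>2 \<in> prob_measures"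
        "0 \<le> t" "t \<le> 1" for \<mu>1 \<mu>2 \<nu>1 \<nu>2 t
    proof -
      have "T (mixture t \<mu>1 \<mu>2) (mixture t \<nu>1 \<nu>2) \<le> ereal t * T \<mu>1 \<nu>1 + ereal (1 - t) * T \<mu>2 \<nu>2"
        using assms(2) H unfolding backward_linear_transfer_def jointly_convex_def by blast
      then show ?thesis by (simp add: T_eq H mixture_in_prob_measures)
    qed
    show "(\<lambda>n. S (s n) (u n)) \<longlonglongrightarrow> S \<mu> \<nu>"
      if H: "\<And>n. s n \<in> prob_measures" "\<And>n. u n \<in> prob_measures" "\<mu> \<in> prob_measures" "\<nu> \<in> prob_measures"
        "weakly_converges s \<mu>" "weakly_converges u \<nu>" for s u \<mu> \<nu>
    proof -
      have "limitin (prod_topology weak_star weak_star) (\<lambda>n. (s n, u n)) (\<mu>, \<nu>) sequentially"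
        by (simp add: limitin_pairwise comp_def limitin_weak_star H)
      from continuous_map_limit[OF cont this] have "(\<lambda>n. T (s n) (u n)) \<longlonglongrightarrow> T \<mu> \<nu>"
        by (simp add: comp_def)
      then have "(\<lambda>n. ereal (S (s n) (u n))) \<longlonglongrightarrow> ereal (S \<mu> \<nu>)" by (simp add: T_eq H)
      then show ?thesis by simp
    qed
  qed (use assms in auto)
  then show ?thesis by (simp add: S_def[abs_def])
qed

theorem theorem2:
  fixes T :: "'a::metric_space measure \<Rightarrow> 'a measure \<Rightarrow> ereal"
    and K :: "('a \<Rightarrow> real) \<Rightarrow> ('a \<Rightarrow> real)"
  assumes "compact (UNIV :: 'a set)"
    and "backward_linear_transfer T"
    and "\<forall>\<mu>\<in>prob_measures. \<forall>\<nu>\<in>prob_measures. \<bar>T \<mu> \<nu>\<bar> \<noteq> \<infinity>"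
    and "continuous_map (prod_topology weak_star weak_star) euclidean (\<lambda>(\<mu>, \<nu>). T \<mu> \<nu>)"
    and "backward_kantorovich_operator T K"
    and "\<forall>f\<in>cont_funs. K f \<in> cont_funs"
  shows "\<exists>(c::real) (Tinf :: 'a measure \<Rightarrow> 'a measure \<Rightarrow> ereal)
      (Kinf :: ('a \<Rightarrow> real) \<Rightarrow> ('a \<Rightarrow> real)).
    backward_linear_transfer Tinf \<and>
    backward_kantorovich_operator Tinf Kinf \<and>
    (\<forall>f\<in>cont_funs. Kinf f \<in> cont_funs) \<and>
    (\<forall>\<mu>\<in>prob_measures. \<forall>\<nu>\<in>prob_measures.
        Tinf \<mu> \<nu> = inf_convolution (\<lambda>\<mu> \<nu>. T \<mu> \<nu> + ereal c) Tinf \<mu> \<nu> \<and>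
        Tinf \<mu> \<nu> = inf_convolution Tinf Tinf \<mu> \<nu>) \<and>
    (\<forall>f\<in>cont_funs. Kinf (Kinf f) = Kinf f) \<and>
    ereal (- c) = (INF \<mu>\<in>prob_measures. T \<mu> \<mu>) \<and>
    (\<exists>\<mu>\<in>{\<mu> \<in> prob_measures. Tinf \<mu> \<mu> = 0}.
        T \<mu> \<mu> = ereal (- c) \<and>
        (\<mu>, \<mu>) \<in> {(\<mu>, \<nu>) \<in> prob_measures \<times> prob_measures. T \<mu> \<nu> + Tinf \<nu> \<mu> = ereal (- c)}) \<and>
    (\<forall>f\<in>cont_funs. \<forall>n::nat. \<forall>x. (K ^^ n) (Kinf f) x - real n * c = Kinf f x) \<and>
    (\<forall>u\<in>cont_funs. (\<forall>n::nat. \<forall>x. (K ^^ n) u x - real n * c = u x) \<longrightarrow>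
        (\<exists>f\<in>cont_funs. u = Kinf f))"
proof -
  define S where "S \<mu> \<nu> = real_of_ereal (T \<mu> \<nu>)" for \<mu> \<nu>
  have T_eq: "T \<mu> \<nu> = ereal (S \<mu> \<nu>)" if "\<mu> \<in> prob_measures" "\<nu> \<in> prob_measures" for \<mu> \<nu>
    using assms(3) that by (simp add: S_def ereal_real)
  interpret continuous_transfer S K
    unfolding S_def[abs_def] by (rule continuous_transferI[OF assms])
  obtain \<mu>0 where \<mu>0: "\<mu>0 \<in> prob_measures" "\<And>\<nu>. \<nu> \<in> prob_measures \<Longrightarrow> S \<mu>0 \<mu>0 \<le> S \<nu> \<nu>"
    using T_diagonal_min by metis
  define c where "c = - S \<mu>0 \<mu>0"
  \<comment> \<open>Adding \<open>c\<close> to the transfer subtracts \<open>c\<close> from its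
    Legendre transform, so the operator to iterate is \<open>K\<close> minus
    \<open>c\<close>.\<close>
  interpret N: normalized_transfer "\<lambda>\<mu> \<nu>. S \<mu> \<nu> + c" "\<lambda>g x. K g x - c" \<mu>0
    by (intro normalized_transfer.intro continuous_transfer_shift normalized_transfer_axioms.intro)
      (use \<mu>0 in \<open>auto simp: c_def\<close>)
  obtain P M where "coercive_operator P M"
    and PP: "\<forall>f\<in>cont_funs. P (P f) = P f \<and> (\<lambda>x. K (P f) x - c) = P f"
    and Pu: "\<forall>u\<in>cont_funs. (\<lambda>x. K u x - c) = u \<longrightarrow> P u = u"
    and zero: "dual_transfer P \<mu>0 \<mu>0 = 0"
    and conv: "\<forall>\<mu>\<in>prob_measures. \<forall>\<nu>\<in>prob_measures.
      inf_convolution (\<lambda>\<mu> \<nu>. ereal (S \<mu> \<nu> + c)) (\<lambda>\<mu> \<nu>. ereal (dual_transfer P \<mu> \<nu>)) \<mu> \<nu>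
        = ereal (dual_transfer P \<mu> \<nu>)"
    using N.transfer_fixed_points by (elim exE conjE)
  have P: "P (P f) = P f" "(\<lambda>x. K (P f) x - c) = P f" if "f \<in> cont_funs" for f
    using PP that by simp_all
  interpret P: coercive_operator P M by fact
  define Tinf where "Tinf \<mu> \<nu> = ereal (dual_transfer P \<mu> \<nu>)" for \<mu> \<nu>
  have "inf_convolution (\<lambda>\<mu> \<nu>. T \<mu> \<nu> + ereal c) Tinf \<mu> \<nu> = Tinf \<mu> \<nu>"
    if "\<mu> \<in> prob_measures" "\<nu> \<in> prob_measures" for \<mu> \<nu>
  proof -
    have "inf_convolution (\<lambda>\<mu> \<nu>. T \<mu> \<nu> + ereal c) Tinf \<mu> \<nu>
        = inf_convolution (\<lambda>\<mu> \<nu>. ereal (S \<mu> \<nu> + c)) Tinf \<mu> \<nu>"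
      unfolding inf_convolution_def using T_eq[OF that(1)] by (intro INF_cong) auto
    then show ?thesis using conv that by (simp add: Tinf_def[abs_def])
  qed
  moreover have "inf_convolution Tinf Tinf \<mu> \<nu> = Tinf \<mu> \<nu>"
    if "\<mu> \<in> prob_measures" "\<nu> \<in> prob_measures" for \<mu> \<nu>
    using P.inf_convolution_dual_transfer_self[OF that P(1)] by (simp add: Tinf_def[abs_def])
  moreover have "backward_linear_transfer Tinf" "backward_kantorovich_operator Tinf P"
    using P.backward_linear_transfer_dual P.backward_kantorovich_operator_dual
    by (simp_all add: Tinf_def[abs_def])
  moreover have "ereal (- c) = (INF \<mu>\<in>prob_measures. T \<mu> \<mu>)"
  proof (rule antisym)
    show "ereal (- c) \<le> (INF \<mu>\<in>prob_measures. T \<mu> \<mu>)"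
      using \<mu>0(2) by (intro INF_greatest) (simp add: T_eq c_def)
    show "(INF \<mu>\<in>prob_measures. T \<mu> \<mu>) \<le> ereal (- c)"
      using INF_lower[OF \<mu>0(1), of "\<lambda>\<mu>. T \<mu> \<mu>"] by (simp add: T_eq \<mu>0(1) c_def)
  qed
  \<comment> \<open>The diagonal minimiser serves: there \<open>T\<close> equals \<open>- c\<close>
    by the choice of \<open>c\<close>, and the limiting transfer contributes 0 by
    \<open>zero\<close>.\<close>
  moreover have "\<exists>\<mu>\<in>{\<mu> \<in> prob_measures. Tinf \<mu> \<mu> = 0}. T \<mu> \<mu> = ereal (- c) \<and>
      (\<mu>, \<mu>) \<in> {(\<mu>, \<nu>) \<in> prob_measures \<times> prob_measures. T \<mu> \<nu> + Tinf \<nu> \<mu> = ereal (- c)}"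
    using \<mu>0(1) zero by (intro bexI[of _ \<mu>0]) (auto simp: Tinf_def T_eq c_def zero_ereal_def)
  moreover have "(K ^^ n) (P f) x - real n * c = P f x" if f: "f \<in> cont_funs" for f n x
  proof -
    have "K (P f) x = P f x + c" for x using fun_cong[OF P(2)[OF f], of x] by simp
    from power_K_fixed_shift[OF P.op_cont[OF f] this] show ?thesis by simp
  qed
  moreover have "\<exists>f\<in>cont_funs. u = P f"
    if u: "u \<in> cont_funs" and K: "\<forall>n x. (K ^^ n) u x - real n * c = u x" for u
  proof -
    \<comment> \<open>The hypothesis for \<open>n = 1\<close> alone makes \<open>u\<close> a fixed
      point of the normalised operator. The projection leaves such a \<open>u\<close> unchanged, so
      \<open>u\<close> is its own preimage.\<close>
    have "(\<lambda>x. K u x - c) = u" using K[rule_format, of 1] by auto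
    then show ?thesis using Pu u by (intro bexI[of _ u]) simp_all
  qed
  ultimately show ?thesis
    using P(1) P.op_cont by (intro exI[of _ c] exI[of _ Tinf] exI[of _ P]) auto
qed

end
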